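(* Let $(N,\omega)$ be a symplectic surface without boundary and let $H:N\to\mathbb{R}$ be a proper smooth function having a non-degenerate saddle point at $z_1\in N$, with $c:=H(z_1)$. Let $\delta_0>0$ and let $(x,y):U\to(-\delta_0,\delta_0)^2$ be a chart centered at $z_1$, positively oriented with respect to the orientation induced by $\omega$, such that $H(x,y)=c+xy$. Then for all $0<\epsilon<\delta<\delta_0$ there exist numbers $\epsilon_1,\epsilon_2,\epsilon_3,\epsilon_4\in(0,\epsilon)$ such that each of the sets $B_1:=\{H=c+\delta\epsilon_1,\ x>0,\ y>0\}$, $B_2:=\{H=c-\delta\epsilon_2,\ x<0,\ y>0\}$, $B_3:=\{H=c+\delta\epsilon_3,\ x<0,\ y<0\}$, $B_4:=\{H=c-\delta\epsilon_4,\ x>0,\ y<0\}$ (all taken inside the chart domain $U$) is contained in a non-resonant circle of $H$.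
   Context: $X_H$ is defined by $\omega(X_H,\cdot)=-\mathrm{d}H$. An embedded circle of $H$ is the image of a non-constant periodic orbit of $X_H$; it lies in a level $\{H=c_0\}$ and consists of regular points, so there is a smooth family $c'\mapsto L_{c'}$, $c'$ near $c_0$, of embedded circles of $H$ at level $c'$ with $L_{c_0}=L$. Letting $T(c')$ be the period of the orbit of $X_H$ on $L_{c'}$, the circle $L$ is non-resonant if $T'(c_0)\neq0$. *)

theory Defs
  imports "HOL-Analysis.Analysis"
begin

text \<open>Smooth surfaces are modelled concretely: a topological space of type 'a with an
atlas of charts (U, phi), where U is open in 'a and phi maps U homeomorphically onto an open
subset of R^2 = real * real, with C-infinity transition maps.\<close>

type_synonym 'a chart = "'a set \<times> ('a \<Rightarrow> real \<times> real)"

fun Ck_on :: "nat \<Rightarrow> (real \<times> real) set \<Rightarrow> (real \<times> real \<Rightarrow> 'b::real_normed_vector) \<Rightarrow> bool" where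
  "Ck_on 0 S f = continuous_on S f"
| "Ck_on (Suc k) S f = (\<exists>f'. (\<forall>x\<in>S. (f has_derivative f' x) (at x)) \<and>
                              (\<forall>v. Ck_on k S (\<lambda>x. f' x v)))"

definition smooth_on :: "(real \<times> real) set \<Rightarrow> (real \<times> real \<Rightarrow> 'b::real_normed_vector) \<Rightarrow> bool" where
  "smooth_on S f \<longleftrightarrow> (\<forall>k. Ck_on k S f)"

definition jac_det :: "(real \<times> real \<Rightarrow> real \<times> real) \<Rightarrow> real \<times> real \<Rightarrow> real" where
  "jac_det f q = (let D = frechet_derivative f (at q) in
      fst (D (1,0)) * snd (D (0,1)) - fst (D (0,1)) * snd (D (1,0)))"

definition compatible_chart :: "'a::topological_space chart set \<Rightarrow> 'a chart \<Rightarrow> bool" where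
  "compatible_chart A C \<longleftrightarrow> (case C of (U, \<phi>) \<Rightarrow>
      open U \<and> open (\<phi> ` U) \<and> (\<exists>g. homeomorphism U (\<phi> ` U) \<phi> g) \<and>
      (\<forall>(V, \<psi>)\<in>A. smooth_on (\<phi> ` (U \<inter> V)) (\<psi> \<circ> inv_into U \<phi>) \<and>
                    smooth_on (\<psi> ` (U \<inter> V)) (\<phi> \<circ> inv_into V \<psi>)))"

definition surface_atlas :: "'a::topological_space chart set \<Rightarrow> bool" where
  "surface_atlas A \<longleftrightarrow> (\<forall>C\<in>A. compatible_chart A C) \<and> (\<Union>C\<in>A. fst C) = UNIV"

text \<open>A symplectic (= nowhere vanishing area) form on the surface: in each atlas chart
(U,phi) it is w (U,phi) dx /\ dy with w smooth and nonvanishing; the coefficients transform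
by the Jacobian determinant of the transition maps.\<close>
definition symplectic_form :: "'a::topological_space chart set \<Rightarrow> ('a chart \<Rightarrow> real \<times> real \<Rightarrow> real) \<Rightarrow> bool" where
  "symplectic_form A w \<longleftrightarrow>
     (\<forall>(U, \<phi>)\<in>A. smooth_on (\<phi> ` U) (w (U, \<phi>)) \<and> (\<forall>q\<in>\<phi> ` U. w (U, \<phi>) q \<noteq> 0)) \<and>
     (\<forall>(U, \<phi>)\<in>A. \<forall>(V, \<psi>)\<in>A. \<forall>p\<in>U \<inter> V.
        w (U, \<phi>) (\<phi> p) = w (V, \<psi>) (\<psi> p) * jac_det (\<psi> \<circ> inv_into U \<phi>) (\<phi> p))"

text \<open>A compatible chart is positively oriented w.r.t. the orientation induced by omega
iff its coefficient of dx /\ dy is positive.\<close>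
definition positively_oriented :: "'a::topological_space chart set \<Rightarrow> ('a chart \<Rightarrow> real \<times> real \<Rightarrow> real) \<Rightarrow> 'a chart \<Rightarrow> bool" where
  "positively_oriented A w C \<longleftrightarrow> (case C of (U, \<phi>) \<Rightarrow>
      (\<forall>(V, \<psi>)\<in>A. \<forall>p\<in>U \<inter> V. w (V, \<psi>) (\<psi> p) * jac_det (\<psi> \<circ> inv_into U \<phi>) (\<phi> p) > 0))"

definition smooth_fun :: "'a::topological_space chart set \<Rightarrow> ('a \<Rightarrow> real) \<Rightarrow> bool" where
  "smooth_fun A H \<longleftrightarrow> (\<forall>(U, \<phi>)\<in>A. smooth_on (\<phi> ` U) (H \<circ> inv_into U \<phi>))"

definition proper_fun :: "('a::topological_space \<Rightarrow> real) \<Rightarrow> bool" where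
  "proper_fun H \<longleftrightarrow> (\<forall>K. compact K \<longrightarrow> compact (H -` K))"

definition loc :: "'a chart \<Rightarrow> ('a \<Rightarrow> real) \<Rightarrow> real \<times> real \<Rightarrow> real" where
  "loc C H = (case C of (U, \<phi>) \<Rightarrow> H \<circ> inv_into U \<phi>)"

definition pd :: "real \<times> real \<Rightarrow> (real \<times> real \<Rightarrow> real) \<Rightarrow> real \<times> real \<Rightarrow> real" where
  "pd e h q = frechet_derivative h (at q) e"

definition nondeg_saddle :: "'a::topological_space chart set \<Rightarrow> ('a \<Rightarrow> real) \<Rightarrow> 'a \<Rightarrow> bool" where
  "nondeg_saddle A H z \<longleftrightarrow> (\<exists>(U, \<phi>)\<in>A. z \<in> U \<and>
     (let h = loc (U, \<phi>) H; q = \<phi> z in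
        pd (1,0) h q = 0 \<and> pd (0,1) h q = 0 \<and>
        pd (1,0) (pd (1,0) h) q * pd (0,1) (pd (0,1) h) q
          - pd (0,1) (pd (1,0) h) q * pd (1,0) (pd (0,1) h) q < 0))"

text \<open>Hamiltonian vector field X_H in a chart, defined by omega(X_H, .) = - dH,
with omega = w dx /\ dy.\<close>
definition ham_vec :: "('a chart \<Rightarrow> real \<times> real \<Rightarrow> real) \<Rightarrow> ('a \<Rightarrow> real) \<Rightarrow> 'a chart \<Rightarrow> real \<times> real \<Rightarrow> real \<times> real" where
  "ham_vec w H C q = (- pd (0,1) (loc C H) q / w C q, pd (1,0) (loc C H) q / w C q)"

definition ham_curve :: "'a::topological_space chart set \<Rightarrow> ('a chart \<Rightarrow> real \<times> real \<Rightarrow> real) \<Rightarrow> ('a \<Rightarrow> real) \<Rightarrow> (real \<Rightarrow> 'a) \<Rightarrow> bool" where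
  "ham_curve A w H \<gamma> \<longleftrightarrow> continuous_on UNIV \<gamma> \<and>
     (\<forall>(U, \<phi>)\<in>A. \<forall>t. \<gamma> t \<in> U \<longrightarrow>
        ((\<phi> \<circ> \<gamma>) has_vector_derivative ham_vec w H (U, \<phi>) (\<phi> (\<gamma> t))) (at t))"

definition is_period :: "(real \<Rightarrow> 'a) \<Rightarrow> real \<Rightarrow> bool" where
  "is_period \<gamma> T \<longleftrightarrow> T > 0 \<and> (\<forall>t. \<gamma> (t + T) = \<gamma> t)"

definition min_period :: "(real \<Rightarrow> 'a) \<Rightarrow> real \<Rightarrow> bool" where
  "min_period \<gamma> T \<longleftrightarrow> is_period \<gamma> T \<and> (\<forall>S. 0 < S \<and> S < T \<longrightarrow> \<not> is_period \<gamma> S)"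

definition emb_circle :: "'a::topological_space chart set \<Rightarrow> ('a chart \<Rightarrow> real \<times> real \<Rightarrow> real) \<Rightarrow> ('a \<Rightarrow> real) \<Rightarrow> 'a set \<Rightarrow> bool" where
  "emb_circle A w H L \<longleftrightarrow> (\<exists>\<gamma>. ham_curve A w H \<gamma> \<and> (\<exists>T. is_period \<gamma> T) \<and>
       (\<exists>s t. \<gamma> s \<noteq> \<gamma> t) \<and> L = range \<gamma>)"

definition nonresonant :: "'a::topological_space chart set \<Rightarrow> ('a chart \<Rightarrow> real \<times> real \<Rightarrow> real) \<Rightarrow> ('a \<Rightarrow> real) \<Rightarrow> 'a set \<Rightarrow> bool" where
  "nonresonant A w H L \<longleftrightarrow> (\<exists>c0 e \<Gamma> T. e > 0 \<and>
     (\<forall>c'\<in>{c0 - e<..<c0 + e}. ham_curve A w H (\<Gamma> c') \<and> min_period (\<Gamma> c') (T c') \<and>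
         (\<forall>t. H (\<Gamma> c' t) = c')) \<and>
     range (\<Gamma> c0) = L \<and>
     continuous_on ({c0 - e<..<c0 + e} \<times> UNIV) (\<lambda>(c', t). \<Gamma> c' t) \<and>
     (\<exists>D. D \<noteq> 0 \<and> (T has_real_derivative D) (at c0)))"

end

theory Submission
  imports Defs
begin

text \<open>Near a regular point, integrating \<open>- w / H\<^sub>y\<close> along the level curves yields coordinates
(time, energy) in which the Hamiltonian flow is a translation. This gives uniqueness and, since
the levels are compact and critical points cannot be reached in finite time, a global flow on
the regular points that is differentiable in the initial point.

Let \<open>P e\<close>, for energies \<open>e\<close> near \<open>c\<close>, be the points of a segment crossing one half of the
\<open>x\<close>-axis of the saddle chart. Time and energy are area preserving, so orbits through the segment
that never close up would embed a strip of infinite area into a compact energy range; hence for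
energies arbitrarily close to \<open>c\<close> on either side some \<open>P e\<close> is periodic. If the period were
stationary at all periodic points on one side of \<open>c\<close>, it would be locally constant, and \<open>P e\<close>
would return after one fixed time \<open>T\<close> for all \<open>e\<close> on that side, and in the limit also for
\<open>e = c\<close>. But then a compact orbit of regular points would contain the half axis and hence the
saddle. So the period has a nonzero derivative at some energy, and the hyperbola arc of that
energy, being connected and regular, lies in a single orbit.\<close>

section \<open>Calculus in the plane\<close>

text \<open>The orbit through a point of the segment need not close up: its level may contain
  further critical points to which the orbit is asymptotic, and critical values may accumulate at
  \<open>c\<close>. So no annulus of circles beside the saddle is available in advance. Area
  supplies single periodic orbits, and the stationarity assumed for contradiction is what spreads
  them over the whole energy interval. The growth of the period at the saddle is never estimated: a
  fixed return time that survives in the limit is contradiction enough. Differentiability of the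
  period suffices, because a derivative vanishing on an interval already makes it constant.

  Conservation of \<open>H\<close> reduces the motion to a quadrature, so local existence,
  uniqueness and dependence on the initial point come from inverting two explicit planar maps. The
  saddle chart need not belong to the atlas, which is why charts that are only compatible are
  carried along. The segment lies over x = \<plusminus>\<delta>, where a level c \<plusminus>
  \<delta> \<epsilon>1 has |y| = \<epsilon>1; this is the origin of the energies in the
  statement.\<close>

lemma Ck_on_cong:
  assumes "open S" "\<And>x. x \<in> S \<Longrightarrow> f x = g x" "Ck_on k S f"
  shows "Ck_on k S g"
proof (cases k)
  case 0
  with assms show ?thesis by (simp cong: continuous_on_cong)
next
  case (Suc n)
  with assms(3) obtain f' where
    f': "\<forall>x\<in>S. (f has_derivative f' x) (at x)" "\<forall>v. Ck_on n S (\<lambda>x. f' x v)"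
    by auto
  have "\<forall>x\<in>S. (g has_derivative f' x) (at x)"
    using f'(1) has_derivative_transform_within_open[OF _ assms(1)] assms(2) by blast
  with f'(2) Suc show ?thesis by auto
qed

lemma smooth_on_has_derivative:
  assumes "smooth_on S f" "x \<in> S"
  shows "(f has_derivative frechet_derivative f (at x)) (at x)"
proof -
  have "Ck_on (Suc 0) S f" using assms(1) smooth_on_def by blast
  with assms(2) have "f differentiable (at x)"
    unfolding differentiable_def by auto
  then show ?thesis by (simp add: frechet_derivative_works)
qed

lemma smooth_on_frechet_derivative:
  assumes "open S" "smooth_on S f"
  shows "smooth_on S (\<lambda>x. frechet_derivative f (at x) v)"
  unfolding smooth_on_def
proof
  fix k
  have "Ck_on (Suc k) S f" using assms(2) smooth_on_def by blast
  then obtain f' where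
    f': "\<forall>x\<in>S. (f has_derivative f' x) (at x)" "\<forall>v. Ck_on k S (\<lambda>x. f' x v)"
    by auto
  show "Ck_on k S (\<lambda>x. frechet_derivative f (at x) v)"
  proof (rule Ck_on_cong[OF assms(1)])
    show "Ck_on k S (\<lambda>x. f' x v)" using f'(2) by blast
    show "f' x v = frechet_derivative f (at x) v" if "x \<in> S" for x
      using f'(1) that frechet_derivative_at by fastforce
  qed
qed

lemma smooth_on_continuous: "smooth_on S f \<Longrightarrow> continuous_on S f"
  unfolding smooth_on_def by (metis Ck_on.simps(1))

text \<open>The partial derivatives are carried as explicit functions, so that quotients and
  coordinate changes keep formulas for them. Continuous partials are what differentiation under the
  integral sign uses.\<close>

definition C1grad :: "(real \<times> real) set \<Rightarrow> (real \<times> real \<Rightarrow> real) \<Rightarrow> (real \<times> real \<Rightarrow> real) \<Rightarrow>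
    (real \<times> real \<Rightarrow> real) \<Rightarrow> bool" where
  "C1grad S f fx fy \<longleftrightarrow>
     (\<forall>z\<in>S. (f has_derivative (\<lambda>v. fx z * fst v + fy z * snd v)) (at z)) \<and>
     continuous_on S fx \<and> continuous_on S fy"

lemma linear_real_pair:
  fixes f :: "real \<times> real \<Rightarrow> 'b::real_vector"
  assumes "linear f"
  shows "f v = fst v *\<^sub>R f (1,0) + snd v *\<^sub>R f (0,1)"
proof -
  have "f v = f (fst v *\<^sub>R (1,0) + snd v *\<^sub>R (0,1))"
    by (rule arg_cong[where f = f]) (simp add: prod_eq_iff)
  then show ?thesis by (simp only: linear_add[OF assms] linear_scale[OF assms])
qed

lemma smooth_on_pd:
  assumes "open S" "smooth_on S f"
  shows "smooth_on S (pd e f)"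
  using smooth_on_frechet_derivative[OF assms, of e] unfolding pd_def .

lemma has_derivative_pd:
  assumes "(f has_derivative f') (at z)"
  shows "(f has_derivative (\<lambda>v. pd (1,0) f z * fst v + pd (0,1) f z * snd v)) (at z)"
proof -
  have "linear f'" using assms has_derivative_linear by blast
  then have "f' v = pd (1,0) f z * fst v + pd (0,1) f z * snd v" for v
    unfolding pd_def frechet_derivative_at[OF assms, symmetric]
    by (subst linear_real_pair) (simp_all add: mult.commute)
  then have "f' = (\<lambda>v. pd (1,0) f z * fst v + pd (0,1) f z * snd v)" by (rule ext)
  with assms show ?thesis by simp
qed

lemma smooth_on_C1grad:
  assumes "open S" "smooth_on S f"
  shows "C1grad S f (pd (1,0) f) (pd (0,1) f)"
  unfolding C1grad_def
  by (intro conjI ballI has_derivative_pd[OF smooth_on_has_derivative[OF assms(2)]]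
    smooth_on_continuous[OF smooth_on_pd[OF assms]])

lemma C1grad_D:
  assumes "C1grad S f fx fy" "z \<in> S"
  shows "(f has_derivative (\<lambda>v. fx z * fst v + fy z * snd v)) (at z)"
  using assms C1grad_def by blast

text \<open>Invariance of domain makes an injective continuous map open with continuous inverse;
  after that the derivative can be inverted point by point, and \<open>f'\<close> is only asked to
  be injective at each point.\<close>

lemma planar_diffeo:
  fixes f :: "real \<times> real \<Rightarrow> real \<times> real"
  assumes S: "open S"
    and f': "\<And>z. z \<in> S \<Longrightarrow> (f has_derivative f' z) (at z)"
    and inj: "inj_on f S"
    and inj': "\<And>z. z \<in> S \<Longrightarrow> inj (f' z)"
  shows "open (f ` S)"
    and "homeomorphism S (f ` S) f (inv_into S f)"
    and "\<And>z. z \<in> S \<Longrightarrow> (inv_into S f has_derivative inv (f' z)) (at (f z))"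
proof -
  have cont: "continuous_on S f"
    using f' S by (meson continuous_at_imp_continuous_on has_derivative_continuous)
  show "open (f ` S)" by (rule invariance_of_domain[OF cont S inj])
  show "homeomorphism S (f ` S) f (inv_into S f)"
    using inj S cont by (simp add: continuous_on_inverse_open homeomorphism_def)
  fix z assume z: "z \<in> S"
  have lin: "linear (f' z)" using f'[OF z] has_derivative_linear by blast
  then have "bij (f' z)"
    using inj'[OF z] linear_injective_imp_surjective bij_def by blast
  then have "f' z \<circ> inv (f' z) = id"
    using bij_is_surj[of "f' z"] surj_iff[of "f' z"] by blast
  then show "(inv_into S f has_derivative inv (f' z)) (at (f z))"
    using has_derivative_inverse_strong[OF S z cont, of "inv_into S f" "f' z"] f'[OF z] inj by auto
qed

section \<open>Time and energy as coordinates in the plane\<close>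

abbreviation square :: "real \<Rightarrow> real \<Rightarrow> real \<Rightarrow> (real \<times> real) set" where
  "square r x y \<equiv> {x - r<..<x + r} \<times> {y - r<..<y + r}"

lemma open_contains_square:
  assumes "open S" "(x, y) \<in> S"
  obtains r where "r > 0" "square r x y \<subseteq> S"
proof -
  obtain A B where AB: "open A" "open B" "x \<in> A" "y \<in> B" "A \<times> B \<subseteq> S"
    using open_prod_elim[OF assms] by (metis mem_Sigma_iff)
  obtain a where a: "a > 0" "ball x a \<subseteq> A" using AB openE by blast
  obtain b where b: "b > 0" "ball y b \<subseteq> B" using AB openE by blast
  have "square (min a b) x y \<subseteq> S"
  proof
    fix z assume z: "z \<in> square (min a b) x y"
    then have "fst z \<in> ball x a" "snd z \<in> ball y b"
      by (auto simp: dist_real_def)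
    then show "z \<in> S" using AB a b by (metis mem_Sigma_iff prod.collapse subsetD)
  qed
  then show ?thesis using a b that[of "min a b"] by auto
qed

text \<open>\<open>\<tau>\<close> is the integral of \<open>v\<close> along the horizontal segment
  from \<open>x0\<close>, rescaled to the fixed domain \<open>{0..1}\<close> so that the Leibniz
  rule handles both variables at once. The partial in the first variable is \<open>v\<close> again;
  of the other one only existence matters, hence the anonymous \<open>k\<close>.\<close>

lemma line_integral_derivative:
  fixes v :: "real \<times> real \<Rightarrow> real"
  assumes C: "C1grad (square b x0 e0) v vx ve" and z: "z \<in> square b x0 e0"
  defines "\<tau> \<equiv> \<lambda>z. (fst z - x0) * integral {0..1} (\<lambda>u. v (x0 + u * (fst z - x0), snd z))"
  shows "\<exists>k. (\<tau> has_derivative (\<lambda>d. v z * fst d + k * snd d)) (at z)"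
proof -
  define R where "R = square b x0 e0"
  have oR: "open R" "convex R" unfolding R_def
    by (auto intro!: open_Times convex_Times)
  define L where "L = (\<lambda>z u. (x0 + u * (fst z - x0), snd z) :: real \<times> real)"
  have LR: "L y u \<in> R" if "y \<in> R" "u \<in> {0..1}" for y u
  proof -
    have "L y u = (1 - u) *\<^sub>R (x0, snd y) + u *\<^sub>R y"
      by (auto simp: L_def prod_eq_iff algebra_simps)
    moreover have "(x0, snd y) \<in> R" using that(1) by (auto simp: R_def)
    ultimately show ?thesis using that convexD[OF oR(2), of "(x0, snd y)" y "1 - u" u] by simp
  qed
  have cL: "continuous_on (R \<times> cbox 0 1) (\<lambda>(y, u). L y u)"
    unfolding L_def case_prod_beta by (intro continuous_intros)
  have comp: "continuous_on (R \<times> cbox 0 1) (\<lambda>(y, u). f (L y u))"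
    if "continuous_on R f" for f :: "_ \<Rightarrow> real"
    using continuous_on_compose2[OF that cL] LR by (simp add: case_prod_beta image_subset_iff)
  have cv: "continuous_on R v"
    using C unfolding C1grad_def R_def[symmetric]
    by (meson continuous_at_imp_continuous_on has_derivative_continuous)
  have cvx: "continuous_on R vx" "continuous_on R ve"
    using C unfolding C1grad_def R_def by auto
  \<comment> \<open>Derivative of the integrand in the parameter; the factor \<open>u\<close> is the
    first-variable derivative of \<open>L\<close>.\<close>
  define F where "F = (\<lambda>y u. (u * vx (L y u)) *\<^sub>R fst_blinfun + ve (L y u) *\<^sub>R (snd_blinfun :: (real \<times> real) \<Rightarrow>\<^sub>L real))"
  have "continuous_on (R \<times> cbox 0 1) (\<lambda>(y, u). F y u)"
    unfolding F_def case_prod_beta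
    using comp[OF cvx(1)] comp[OF cvx(2)] unfolding case_prod_beta
    by (intro continuous_intros)
  moreover have "((\<lambda>y. v (L y u)) has_derivative blinfun_apply (F y u)) (at y within R)"
    if "y \<in> R" "u \<in> cbox 0 1" for y u
  proof -
    have "(v has_derivative (\<lambda>d. vx (L y u) * fst d + ve (L y u) * snd d)) (at (L y u))"
      using C1grad_D[OF C] LR that unfolding R_def by auto
    moreover have "((\<lambda>y. L y u) has_derivative (\<lambda>d. (u * fst d, snd d))) (at y within R)"
      unfolding L_def by (auto intro!: derivative_eq_intros)
    ultimately have "((\<lambda>y. v (L y u)) has_derivative (\<lambda>d. vx (L y u) * (u * fst d) + ve (L y u) * snd d)) (at y within R)"
      using has_derivative_compose[of "\<lambda>y. L y u" _ y R v] by fastforce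
    moreover have "blinfun_apply (F y u) = (\<lambda>d. vx (L y u) * (u * fst d) + ve (L y u) * snd d)"
      by (auto simp: F_def blinfun.add_left blinfun.scaleR_left fun_eq_iff)
    ultimately show ?thesis by simp
  qed
  moreover have int: "(\<lambda>u. v (L y u)) integrable_on cbox 0 1" if "y \<in> R" for y
  proof (rule integrable_continuous)
    show "continuous_on (cbox 0 1) (\<lambda>u. v (L y u))"
      using continuous_on_compose2[OF comp[OF cv], of "cbox 0 1" "\<lambda>u. (y, u)"] that
      by (simp add: image_subset_iff continuous_on_Pair)
  qed
  ultimately have I: "((\<lambda>y. integral (cbox 0 1) (\<lambda>u. v (L y u))) has_derivative
      integral (cbox 0 1) (F z)) (at z)"
    using leibniz_rule[of R 0 1 "\<lambda>y u. v (L y u)" F z] z oR at_within_open[of z R]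
    unfolding R_def by auto
  let ?I = "integral (cbox 0 1) (\<lambda>u. v (L z u))"
  let ?J = "blinfun_apply (integral (cbox 0 1) (F z))"
  have \<tau>': "(\<tau> has_derivative (\<lambda>d. (fst z - x0) * ?J d + fst d * ?I)) (at z)"
    unfolding \<tau>_def using I unfolding L_def cbox_interval
    by (auto intro!: derivative_eq_intros)
  have cF: "continuous_on (cbox 0 1) (F z)"
    using continuous_on_compose2[OF \<open>continuous_on (R \<times> cbox 0 1) (\<lambda>(y, u). F y u)\<close>, of "cbox 0 1" "\<lambda>u. (z, u)"] z
    by (simp add: image_subset_iff continuous_on_Pair R_def[symmetric])
  then have Fint: "F z integrable_on cbox 0 1" by (rule integrable_continuous)
  have J: "?J d = integral (cbox 0 1) (\<lambda>u. F z u d)" for d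
    using integral_linear[OF Fint blinfun.bounded_linear_left[of d]] by (simp add: o_def)
  \<comment> \<open>The integrand is the u-derivative of \<open>u * v (L z u)\<close>, whose
    boundary values are 0 and \<open>v z\<close>. This identifies the first partial of
    \<open>\<tau>\<close> with \<open>v z\<close>.\<close>
  have ftc: "((\<lambda>u. (fst z - x0) * F z u (1,0) + v (L z u)) has_integral (1 * v (L z 1) - 0 * v (L z 0))) {0..1}"
  proof (rule fundamental_theorem_of_calculus)
    fix u :: real assume u: "u \<in> {0..1}"
    have d: "(v has_derivative (\<lambda>d. vx (L z u) * fst d + ve (L z u) * snd d)) (at (L z u))"
      using C1grad_D[OF C] LR u z unfolding R_def by auto
    have "((\<lambda>u. L z u) has_derivative (\<lambda>d. (d * (fst z - x0), 0))) (at u within {0..1})"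
      unfolding L_def by (auto intro!: derivative_eq_intros)
    then have "((\<lambda>u. v (L z u)) has_derivative (\<lambda>d. vx (L z u) * (d * (fst z - x0)))) (at u within {0..1})"
      using has_derivative_compose[of "L z" _ u "{0..1}" v, OF _ d] by fastforce
    then have "((\<lambda>u. v (L z u)) has_real_derivative (vx (L z u) * (fst z - x0))) (at u within {0..1})"
      unfolding has_field_derivative_def by (rule has_derivative_eq_rhs) (auto simp: fun_eq_iff)
    then have "((\<lambda>u. u * v (L z u)) has_real_derivative (u * (vx (L z u) * (fst z - x0)) + v (L z u))) (at u within {0..1})"
      by (auto intro!: derivative_eq_intros)
    then show "((\<lambda>u. u * v (L z u)) has_vector_derivative ((fst z - x0) * F z u (1,0) + v (L z u))) (at u within {0..1})"
      by (simp add: has_real_derivative_iff_has_vector_derivative F_def blinfun.add_left blinfun.scaleR_left mult_ac)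
  qed simp
  have "((\<lambda>u. (fst z - x0) * F z u (1,0) + v (L z u)) has_integral ((fst z - x0) * ?J (1,0) + ?I)) (cbox 0 1)"
  proof (rule has_integral_add)
    have "(\<lambda>u. F z u (1,0)) integrable_on cbox 0 1"
      using integrable_linear[OF Fint blinfun.bounded_linear_left[of "(1,0)"]] by (simp add: o_def)
    then show "((\<lambda>u. (fst z - x0) * F z u (1,0)) has_integral (fst z - x0) * ?J (1,0)) (cbox 0 1)"
      unfolding J by (intro has_integral_mult_right integrable_integral)
    show "((\<lambda>u. v (L z u)) has_integral ?I) (cbox 0 1)"
      using int z by (auto simp: R_def intro: integrable_integral)
  qed
  from has_integral_unique[OF this[unfolded cbox_interval] ftc]
  have "(fst z - x0) * ?J (1,0) + ?I = v (L z 1)" by (simp add: cbox_interval)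
  then have e: "(fst z - x0) * ?J (1,0) + ?I = v z" by (simp add: L_def)
  have "(\<lambda>d. (fst z - x0) * ?J d + fst d * ?I) = (\<lambda>d. v z * fst d + ((fst z - x0) * ?J (0,1)) * snd d)"
  proof
    fix d :: "real \<times> real"
    have "?J d = fst d * ?J (1,0) + snd d * ?J (0,1)"
      using linear_real_pair[of ?J d] by (simp add: blinfun.bounded_linear_right bounded_linear.linear)
    then show "(fst z - x0) * ?J d + fst d * ?I = v z * fst d + ((fst z - x0) * ?J (0,1)) * snd d"
      unfolding e[symmetric] by (simp add: algebra_simps)
  qed
  with \<tau>' show ?thesis by auto
qed

text \<open>The square carries (time, energy), with time centred at 0. Only the time derivative of
  \<open>g\<close> is prescribed, which makes its horizontal lines integral curves of
  \<open>X\<close>; in the energy direction differentiability is enough.\<close>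

definition flow_box ::
  "real \<Rightarrow> real \<Rightarrow> (real \<times> real) set \<Rightarrow> (real \<times> real \<Rightarrow> real \<times> real) \<Rightarrow> (real \<times> real \<Rightarrow> real \<times> real) \<Rightarrow>
    (real \<times> real \<Rightarrow> real) \<Rightarrow> (real \<times> real \<Rightarrow> real \<times> real) \<Rightarrow> bool" where
  "flow_box a e0 W g \<theta> h X \<longleftrightarrow> a > 0 \<and> open W \<and> homeomorphism (square a 0 e0) W g \<theta> \<and>
     (\<forall>z\<in>W. snd (\<theta> z) = h z \<and> \<theta> differentiable (at z)) \<and>
     (\<forall>b\<in>square a 0 e0. \<exists>g'. (g has_derivative g') (at b) \<and> g' (1, 0) = X (g b))"

lemma open_square [simp]: "open (square r x y)"
  by (simp add: open_Times)

text \<open>Rolle's theorem. It is applied along vertical lines to show that \<open>(x, h)\<close>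
  are coordinates and along horizontal lines to show the same for
  \<open>(\<tau>, h)\<close>.\<close>

lemma vertical_inj:
  fixes f :: "real \<Rightarrow> real"
  assumes "\<And>y. y \<in> {a<..<b} \<Longrightarrow> (f has_real_derivative f' y) (at y)"
    and "\<And>y. y \<in> {a<..<b} \<Longrightarrow> f' y \<noteq> 0"
  shows "inj_on f {a<..<b}"
proof (rule linorder_inj_onI')
  fix x y assume xy: "x \<in> {a<..<b}" "y \<in> {a<..<b}" "x < y"
  show "f x \<noteq> f y"
  proof
    assume "f x = f y"
    moreover have "continuous_on {x..y} f"
      using assms(1) xy
      by (intro continuous_at_imp_continuous_on ballI) (meson DERIV_isCont atLeastAtMost_iff
          greaterThanLessThan_iff le_less_trans less_le_trans)
    ultimately obtain z where "x < z" "z < y" "(\<lambda>u. f' z * u) = (\<lambda>u. 0)"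
      using Rolle_deriv[of x y f "\<lambda>z u. f' z * u"] xy assms(1)
      by (metis (mono_tags, lifting) greaterThanLessThan_iff has_field_derivative_imp_has_derivative
          less_trans)
    then show False using assms(2)[of z] xy by (metis greaterThanLessThan_iff less_trans mult_cancel_left1
          mult_eq_0_iff one_neq_zero)
  qed
qed

lemma homeomorphism_restrict:
  assumes "homeomorphism S T f g" "S' \<subseteq> S"
  shows "homeomorphism S' (f ` S') f g"
  by (rule homeomorphism_of_subsets[OF assms order_refl refl, THEN homeomorphism_of_subsets])
    (use assms in \<open>auto simp: homeomorphism_def\<close>)

text \<open>Where \<open>hy\<close> does not vanish the levels are graphs over the first axis, so
  \<open>(x, h)\<close> are coordinates. The field in question is tangent to the levels and has
  first component \<open>1 / m\<close>, so along a level time is the integral of \<open>m\<close> in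
  x; replacing x by that integral gives (time, energy).\<close>

lemma planar_flow_box_graph:
  assumes S: "open S" and q: "q \<in> S" and h: "C1grad S h hx hy" and m: "C1grad S m mx my"
    and hy: "\<And>z. z \<in> S \<Longrightarrow> hy z \<noteq> 0" and m0: "\<And>z. z \<in> S \<Longrightarrow> m z \<noteq> 0"
  shows "\<exists>a W g \<theta>. flow_box a (h q) W g \<theta> h (\<lambda>z. (1 / m z, - hx z / (m z * hy z))) \<and> W \<subseteq> S \<and> g (0, h q) = q"
proof -
  obtain x0 y0 where q0: "q = (x0, y0)" by (cases q)
  obtain r where r: "r > 0" "square r x0 y0 \<subseteq> S" using open_contains_square S q q0 by metis
  \<comment> \<open>In a square the vertical segment between two points stays inside, so Rolle's
    theorem can be used on it.\<close>
  define R where "R = square r x0 y0"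
  have RS: "R \<subseteq> S" "open R" "q \<in> R" using r q0 by (auto simp: R_def)
  define f where "f = (\<lambda>z. (fst z, h z))"
  define f' where "f' = (\<lambda>z v. (fst v, hx z * fst v + hy z * snd v) :: real \<times> real)"
  have f': "(f has_derivative f' z) (at z)" if "z \<in> R" for z
    unfolding f_def f'_def using C1grad_D[OF h, of z] RS that
    by (auto intro!: derivative_eq_intros)
  have "inj_on f R"
  proof (rule inj_onI)
    fix z z' assume zz: "z \<in> R" "z' \<in> R" "f z = f z'"
    have "inj_on (\<lambda>y. h (fst z, y)) {y0 - r<..<y0 + r}"
    proof (rule vertical_inj)
      fix y assume "y \<in> {y0 - r<..<y0 + r}"
      then have yR: "(fst z, y) \<in> S" using zz RS unfolding R_def by auto
      have "((\<lambda>y. (fst z, y)) has_derivative (\<lambda>d. (0, d))) (at y)"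
        by (auto intro!: derivative_eq_intros)
      from has_derivative_compose[OF this C1grad_D[OF h yR]]
      show "((\<lambda>y. h (fst z, y)) has_real_derivative hy (fst z, y)) (at y)"
        unfolding has_field_derivative_def by (rule has_derivative_eq_rhs) (auto simp: fun_eq_iff)
      show "hy (fst z, y) \<noteq> 0" by (rule hy[OF yR])
    qed
    moreover have "fst z = fst z'" "h z = h z'" using zz(3) unfolding f_def by auto
    then have "h (fst z, snd z) = h (fst z, snd z')" by (metis prod.collapse)
    moreover have "snd z \<in> {y0 - r<..<y0 + r}" "snd z' \<in> {y0 - r<..<y0 + r}"
      using zz(1,2) unfolding R_def by (simp_all add: mem_Times_iff)
    ultimately have "snd z = snd z'" using inj_onD[where f = "\<lambda>y. h (fst z, y)"] by blast
    with \<open>fst z = fst z'\<close> show "z = z'" by (simp add: prod_eq_iff)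
  qed
  moreover have "inj (f' z)" if "z \<in> R" for z
    using hy[of z] RS that by (auto simp: f'_def inj_on_def prod_eq_iff)
  ultimately have f: "open (f ` R)" "homeomorphism R (f ` R) f (inv_into R f)"
    "\<And>z. z \<in> R \<Longrightarrow> (inv_into R f has_derivative inv (f' z)) (at (f z))"
    using planar_diffeo[OF RS(2) f'] by blast+
  define k where "k = inv_into R f"
  have kf: "k (f z) = z" if "z \<in> R" for z
    using f(2) that by (auto simp: k_def homeomorphism_def)
  have inv_f': "inv (f' z) = (\<lambda>v. (fst v, (snd v - hx z * fst v) / hy z))" if "z \<in> R" for z
    using hy[of z] RS that by (intro inv_equality) (auto simp: f'_def field_simps)
  have "f q \<in> f ` R" using RS by auto
  then obtain b where b: "b > 0" "square b x0 (h q) \<subseteq> f ` R"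
    using open_contains_square[OF f(1), of x0 "h q"] by (auto simp: f_def q0)
  define Q where "Q = square b x0 (h q)"
  have Q: "open Q" "Q \<subseteq> f ` R" "(x0, h q) \<in> Q" using b by (auto simp: Q_def)
  have kQ: "k y \<in> R" "f (k y) = y" if "y \<in> Q" for y
    using that Q kf by auto
  have k': "(k has_derivative (\<lambda>v. (fst v, (snd v - hx (k y) * fst v) / hy (k y)))) (at y)" if "y \<in> Q" for y
    using f(3)[OF kQ(1)[OF that]] kQ[OF that] inv_f'[OF kQ(1)[OF that]] by (simp add: k_def)
  have ck: "continuous_on Q k"
    using k' by (meson continuous_at_imp_continuous_on has_derivative_continuous)
  have comp: "continuous_on Q (\<lambda>y. u (k y))" if "continuous_on S u" for u :: "_ \<Rightarrow> real"
    using continuous_on_compose2[OF that ck] kQ(1) RS by blast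
  \<comment> \<open>dt/dx along a level, read in the coordinates \<open>(x, h)\<close>.\<close>
  define v where "v = (\<lambda>y. m (k y))"
  have "C1grad Q v (\<lambda>y. mx (k y) - my (k y) * hx (k y) / hy (k y)) (\<lambda>y. my (k y) / hy (k y))"
    unfolding C1grad_def
  proof (intro conjI ballI)
    fix y assume y: "y \<in> Q"
    have "k y \<in> S" using kQ y RS by blast
    from has_derivative_compose[OF k'[OF y] C1grad_D[OF m this]]
    show "(v has_derivative (\<lambda>d. (mx (k y) - my (k y) * hx (k y) / hy (k y)) * fst d + my (k y) / hy (k y) * snd d)) (at y)"
      unfolding v_def by (rule has_derivative_eq_rhs) (auto simp: fun_eq_iff algebra_simps diff_divide_distrib)
  next
    show "continuous_on Q (\<lambda>y. mx (k y) - my (k y) * hx (k y) / hy (k y))"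
      "continuous_on Q (\<lambda>y. my (k y) / hy (k y))"
      using m h hy kQ RS unfolding C1grad_def by (auto intro!: continuous_intros comp)
  qed
  note v = this[unfolded Q_def]
  define \<tau> where "\<tau> = (\<lambda>z. (fst z - x0) * integral {0..1} (\<lambda>u. v (x0 + u * (fst z - x0), snd z)))"
  have "\<exists>K. \<forall>z\<in>Q. (\<tau> has_derivative (\<lambda>d. v z * fst d + K z * snd d)) (at z)"
    unfolding \<tau>_def Q_def by (intro bchoice ballI line_integral_derivative[OF v])
  then obtain K where K: "\<And>z. z \<in> Q \<Longrightarrow> (\<tau> has_derivative (\<lambda>d. v z * fst d + K z * snd d)) (at z)"
    by blast
  have v0: "v z \<noteq> 0" if "z \<in> Q" for z using m0 kQ that RS unfolding v_def by blast
  \<comment> \<open>Triangular in these coordinates, with determinant \<open>v\<close>. The unknown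
    partial \<open>K\<close> multiplies only the energy component, so it affects neither
    invertibility nor the image of \<open>(1, 0)\<close> under the inverse.\<close>
  define p where "p = (\<lambda>z. (\<tau> z, snd z))"
  define p' where "p' = (\<lambda>z d. (v z * fst d + K z * snd d, snd d) :: real \<times> real)"
  have p': "(p has_derivative p' z) (at z)" if "z \<in> Q" for z
    unfolding p_def p'_def using K[OF that] by (auto intro!: derivative_eq_intros)
  have "inj_on p Q"
  proof (rule inj_onI)
    fix z z' assume zz: "z \<in> Q" "z' \<in> Q" "p z = p z'"
    have "inj_on (\<lambda>x. \<tau> (x, snd z)) {x0 - b<..<x0 + b}"
    proof (rule vertical_inj)
      fix x assume "x \<in> {x0 - b<..<x0 + b}"
      then have xQ: "(x, snd z) \<in> Q" using zz unfolding Q_def by auto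
      have "((\<lambda>x. (x, snd z)) has_derivative (\<lambda>d. (d, 0))) (at x)"
        by (auto intro!: derivative_eq_intros)
      from has_derivative_compose[OF this K[OF xQ]]
      show "((\<lambda>x. \<tau> (x, snd z)) has_real_derivative v (x, snd z)) (at x)"
        unfolding has_field_derivative_def by (rule has_derivative_eq_rhs) (auto simp: fun_eq_iff)
      show "v (x, snd z) \<noteq> 0" by (rule v0[OF xQ])
    qed
    moreover have "snd z = snd z'" "\<tau> z = \<tau> z'" using zz(3) unfolding p_def by auto
    then have "\<tau> (fst z, snd z) = \<tau> (fst z', snd z)" by (metis prod.collapse)
    moreover have "fst z \<in> {x0 - b<..<x0 + b}" "fst z' \<in> {x0 - b<..<x0 + b}"
      using zz(1,2) unfolding Q_def by (simp_all add: mem_Times_iff)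
    ultimately have "fst z = fst z'" using inj_onD[where f = "\<lambda>x. \<tau> (x, snd z)"] by blast
    with \<open>snd z = snd z'\<close> show "z = z'" by (simp add: prod_eq_iff)
  qed
  moreover have "inj (p' z)" if "z \<in> Q" for z
    using v0[OF that] by (auto simp: p'_def inj_on_def prod_eq_iff)
  ultimately have p: "open (p ` Q)" "homeomorphism Q (p ` Q) p (inv_into Q p)"
    "\<And>z. z \<in> Q \<Longrightarrow> (inv_into Q p has_derivative inv (p' z)) (at (p z))"
    using planar_diffeo[OF Q(1) p'] by blast+
  have inv_p': "inv (p' z) = (\<lambda>d. ((fst d - K z * snd d) / v z, snd d))" if "z \<in> Q" for z
    using v0[OF that] by (intro inv_equality) (auto simp: p'_def field_simps)
  define l where "l = inv_into Q p"
  have lp: "l (p z) = z" if "z \<in> Q" for z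
    using p(2) that by (auto simp: l_def homeomorphism_def)
  \<comment> \<open>The integral starts at \<open>x0\<close>, so \<open>q\<close> gets time
    0.\<close>
  have p0: "p (x0, h q) = (0, h q)" by (simp add: p_def \<tau>_def)
  then have "(0, h q) \<in> p ` Q" using Q(3) by force
  then obtain a where a: "a > 0" "square a 0 (h q) \<subseteq> p ` Q"
    using open_contains_square[OF p(1)] by metis
  define B where "B = square a 0 (h q)"
  have lB: "l y \<in> Q" "p (l y) = y" if "y \<in> B" for y
    using that a lp unfolding B_def by auto
  define g where "g = k \<circ> l"
  define \<theta> where "\<theta> = p \<circ> f"
  have "homeomorphism B (l ` B) l p"
    using homeomorphism_restrict[OF homeomorphism_symD[OF p(2)]] a unfolding B_def l_def by auto
  moreover have "homeomorphism (l ` B) (k ` l ` B) k f"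
    unfolding k_def
    by (rule homeomorphism_restrict[OF homeomorphism_symD[OF f(2)]]) (meson image_subsetI lB(1) Q(2) subsetD)
  ultimately have hom: "homeomorphism B (g ` B) g \<theta>"
    unfolding g_def \<theta>_def by (metis homeomorphism_compose image_comp)
  have gB: "g y \<in> R" "f (g y) = l y" if "y \<in> B" for y
    using that lB kQ by (auto simp: g_def)
  have g': "\<exists>g'. (g has_derivative g') (at y) \<and> g' (1, 0) = (1 / m (g y), - hx (g y) / (m (g y) * hy (g y)))"
    if "y \<in> B" for y
  proof (intro exI conjI)
    have 1: "(l has_derivative (\<lambda>d. ((fst d - K (l y) * snd d) / v (l y), snd d))) (at y)"
      using p(3)[OF lB(1)[OF that]] lB[OF that] inv_p'[OF lB(1)[OF that]] by (simp add: l_def)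
    show "(g has_derivative (\<lambda>d. (\<lambda>d. (fst d, (snd d - hx (g y) * fst d) / hy (g y)))
        ((fst d - K (l y) * snd d) / v (l y), snd d))) (at y)"
      using has_derivative_compose[OF 1 k'[OF lB(1)[OF that]]] unfolding g_def by (simp add: o_def)
  qed (auto simp: v_def g_def mult.commute)
  have "open (g ` B)"
  proof (rule invariance_of_domain)
    show "continuous_on B g" "inj_on g B" using hom
      by (auto simp: homeomorphism_def intro: inj_on_inverseI)
    show "open B" unfolding B_def by (rule open_square)
  qed
  moreover have "\<theta> differentiable (at z)" "snd (\<theta> z) = h z" if z: "z \<in> g ` B" for z
  proof -
    have zR: "z \<in> R" "f z \<in> Q" using z gB lB by auto
    have "((\<lambda>z. p (f z)) has_derivative (\<lambda>d. p' (f z) (f' z d))) (at z)"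
      by (rule has_derivative_compose[OF f'[OF zR(1)] p'[OF zR(2)]])
    then show "\<theta> differentiable (at z)" unfolding \<theta>_def o_def differentiable_def by blast
    show "snd (\<theta> z) = h z" by (simp add: \<theta>_def p_def f_def)
  qed
  moreover have "g ` B \<subseteq> S" using gB RS by auto
  moreover have "l (0, h q) = (x0, h q)" using lp[OF Q(3)] p0 by simp
  then have "g (0, h q) = q" using kf[OF RS(3)] by (simp add: g_def f_def q0)
  ultimately show ?thesis
    using a(1) hom g' unfolding flow_box_def B_def
    by (intro exI[of _ a] exI[of _ "g ` B"] exI[of _ g] exI[of _ \<theta>]) (simp add: B_def)
qed

lemma C1grad_subset: "C1grad S f fx fy \<Longrightarrow> T \<subseteq> S \<Longrightarrow> C1grad T f fx fy"
  unfolding C1grad_def using continuous_on_subset by blast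

lemma C1grad_continuous: "C1grad S f fx fy \<Longrightarrow> continuous_on S f"
  unfolding C1grad_def by (meson continuous_at_imp_continuous_on has_derivative_continuous)

lemma C1grad_divide:
  assumes f: "C1grad S f fx fy" and k: "C1grad S k kx ky" and nz: "\<And>z. z \<in> S \<Longrightarrow> k z \<noteq> 0"
  shows "C1grad S (\<lambda>z. f z / k z) (\<lambda>z. (fx z * k z - f z * kx z) / (k z * k z))
    (\<lambda>z. (fy z * k z - f z * ky z) / (k z * k z))"
  unfolding C1grad_def
proof (intro conjI ballI)
  fix z assume z: "z \<in> S"
  show "((\<lambda>z. f z / k z) has_derivative (\<lambda>v. (fx z * k z - f z * kx z) / (k z * k z) * fst v +
      (fy z * k z - f z * ky z) / (k z * k z) * snd v)) (at z)"
    using has_derivative_divide'[OF C1grad_D[OF f z] C1grad_D[OF k z] nz[OF z]]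
    by (rule has_derivative_eq_rhs) (auto simp: fun_eq_iff add_divide_distrib diff_divide_distrib algebra_simps)
qed (use f k nz C1grad_continuous[OF f] C1grad_continuous[OF k] in
  \<open>auto simp: C1grad_def intro!: continuous_intros\<close>)

lemma C1grad_swap:
  assumes "C1grad S f fx fy"
  shows "C1grad (prod.swap -` S) (f \<circ> prod.swap) (fy \<circ> prod.swap) (fx \<circ> prod.swap)"
  unfolding C1grad_def
proof (intro conjI ballI)
  fix z :: "real \<times> real" assume z: "z \<in> prod.swap -` S"
  have "(prod.swap has_derivative (prod.swap :: real \<times> real \<Rightarrow> _)) (at z)"
    unfolding prod.swap_def by (auto intro!: derivative_eq_intros)
  from has_derivative_compose[OF this C1grad_D[OF assms]] z
  show "(f \<circ> prod.swap has_derivative (\<lambda>v. (fy \<circ> prod.swap) z * fst v + (fx \<circ> prod.swap) z * snd v)) (at z)"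
    by (auto simp: o_def add.commute)
next
  have "continuous_on (prod.swap -` S) prod.swap" by (rule continuous_on_swap)
  then show "continuous_on (prod.swap -` S) (fy \<circ> prod.swap)"
    "continuous_on (prod.swap -` S) (fx \<circ> prod.swap)"
    using assms continuous_on_compose2[where s = "prod.swap -` S" and f = prod.swap and t = S]
    unfolding C1grad_def o_def by blast+
qed

lemma flow_box_cong:
  assumes "flow_box a e W g \<theta> h X" "\<And>z. z \<in> W \<Longrightarrow> X z = Y z"
  shows "flow_box a e W g \<theta> h Y"
proof -
  have "g b \<in> W" if "b \<in> square a 0 e" for b
    using assms(1) that unfolding flow_box_def homeomorphism_def by blast
  then show ?thesis using assms unfolding flow_box_def by metis
qed

text \<open>Carries a box back from exchanged coordinates. This serves the points where the level is
  a graph over the second axis only.\<close>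

lemma flow_box_swap:
  assumes "flow_box a e W g \<theta> (h \<circ> prod.swap) X"
  shows "flow_box a e (prod.swap -` W) (prod.swap \<circ> g) (\<theta> \<circ> prod.swap) h (prod.swap \<circ> X \<circ> prod.swap)"
proof -
  have d: "(prod.swap has_derivative (prod.swap :: real \<times> real \<Rightarrow> _)) (at z)" for z :: "real \<times> real"
    unfolding prod.swap_def by (auto intro!: derivative_eq_intros)
  then have d': "prod.swap differentiable (at z)" for z :: "real \<times> real"
    unfolding differentiable_def by blast
  have W: "prod.swap -` W = prod.swap ` W" by force
  have "homeomorphism W (prod.swap ` W) prod.swap prod.swap"
    by (auto simp: homeomorphism_def image_image intro: continuous_on_swap)
  then have "homeomorphism (square a 0 e) (prod.swap -` W) (prod.swap \<circ> g) (\<theta> \<circ> prod.swap)"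
    using assms unfolding flow_box_def W by (blast intro: homeomorphism_compose)
  moreover have "open (prod.swap -` W)"
    using assms unfolding flow_box_def by (intro open_vimage continuous_on_swap) auto
  moreover have "(\<theta> \<circ> prod.swap) differentiable (at z)" if "z \<in> prod.swap -` W" for z
    using assms that d' unfolding flow_box_def
    by (intro differentiable_chain_at) auto
  moreover have "\<exists>g'. (prod.swap \<circ> g has_derivative g') (at b) \<and> g' (1, 0) = (prod.swap \<circ> X \<circ> prod.swap) ((prod.swap \<circ> g) b)"
    if b: "b \<in> square a 0 e" for b
  proof -
    obtain g' where "(g has_derivative g') (at b)" "g' (1, 0) = X (g b)"
      using assms b unfolding flow_box_def by blast
    then show ?thesis using has_derivative_compose[OF _ d, of g g' b UNIV]
      by (intro exI[of _ "\<lambda>x. prod.swap (g' x)"]) (auto simp: o_def)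
  qed
  ultimately show ?thesis using assms unfolding flow_box_def by (auto simp: o_def)
qed

text \<open>A nonzero field means a nonzero partial of \<open>h\<close>. If it is the second one,
  the first component of \<open>X\<close> is \<open>- pd (0,1) h / w\<close>, so \<open>m\<close> is
  \<open>- w / pd (0,1) h\<close>. Otherwise the coordinates are exchanged, the leading component
  becomes \<open>pd (1,0) h / w\<close>, and \<open>m\<close> is its reciprocal.\<close>

lemma planar_flow_box:
  assumes S: "open S" and q: "q \<in> S" and h: "smooth_on S h" and w: "smooth_on S w"
    and w0: "\<And>z. z \<in> S \<Longrightarrow> w z \<noteq> 0"
  defines "X \<equiv> \<lambda>z. (- pd (0,1) h z / w z, pd (1,0) h z / w z)"
  assumes X: "X q \<noteq> 0"
  obtains a W g \<theta> where "flow_box a (h q) W g \<theta> h X" "W \<subseteq> S" "g (0, h q) = q"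
proof -
  let ?x = "pd (1,0) h" and ?y = "pd (0,1) h"
  note Ch = smooth_on_C1grad[OF S h]
  note Cx = smooth_on_C1grad[OF S smooth_on_pd[OF S h, of "(1,0)"]]
  note Cy = smooth_on_C1grad[OF S smooth_on_pd[OF S h, of "(0,1)"]]
  note Cw = smooth_on_C1grad[OF S w]
  have nz: "open {z\<in>S. k z \<noteq> 0}" if "C1grad S k kx ky" for k kx ky
  proof -
    have "{z\<in>S. k z \<noteq> 0} = S \<inter> k -` (- {0})" by auto
    then show ?thesis using continuous_open_preimage[OF C1grad_continuous[OF that] S, of "- {0}"]
      by (simp add: open_Compl)
  qed
  show ?thesis
  proof (cases "?y q = 0")
    case False
    define S' where "S' = {z\<in>S. ?y z \<noteq> 0}"
    have S': "open S'" "S' \<subseteq> S" "q \<in> S'" using nz[OF Cy] q False by (auto simp: S'_def)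
    have y0: "\<And>z. z \<in> S' \<Longrightarrow> ?y z \<noteq> 0" by (simp add: S'_def)
    have "C1grad S' (\<lambda>z. - 1 * w z) (\<lambda>z. - 1 * pd (1,0) w z) (\<lambda>z. - 1 * pd (0,1) w z)"
      using C1grad_subset[OF Cw S'(2)] unfolding C1grad_def
      by (auto intro!: continuous_intros derivative_eq_intros)
    note m = C1grad_divide[OF this C1grad_subset[OF Cy S'(2)] y0]
    obtain a W g \<theta> where *: "flow_box a (h q) W g \<theta> h
        (\<lambda>z. (1 / (- 1 * w z / ?y z), - ?x z / (- 1 * w z / ?y z * ?y z)))" "W \<subseteq> S'" "g (0, h q) = q"
      using planar_flow_box_graph[OF S'(1,3) C1grad_subset[OF Ch S'(2)] m y0] w0 S'(2) y0 by fastforce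
    have "flow_box a (h q) W g \<theta> h X"
      by (rule flow_box_cong[OF *(1)]) (use *(2) y0 w0 S'(2) in \<open>auto simp: X_def field_simps subset_iff\<close>)
    then show ?thesis using * S' that by blast
  next
    case True
    then have "?x q \<noteq> 0" using X by (auto simp: X_def zero_prod_def)
    define S' where "S' = {z\<in>S. ?x z \<noteq> 0}"
    have S': "open S'" "S' \<subseteq> S" "q \<in> S'" using nz[OF Cx] q \<open>?x q \<noteq> 0\<close> by (auto simp: S'_def)
    have x0: "\<And>z. z \<in> S' \<Longrightarrow> ?x z \<noteq> 0" by (simp add: S'_def)
    note m = C1grad_divide[OF C1grad_subset[OF Cw S'(2)] C1grad_subset[OF Cx S'(2)] x0]
    have o: "open (prod.swap -` S')" using S' by (intro open_vimage continuous_on_swap)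
    have "prod.swap q \<in> prod.swap -` S'" using S' by simp
    from planar_flow_box_graph[OF o this C1grad_swap[OF C1grad_subset[OF Ch S'(2)]] C1grad_swap[OF m]]
    obtain a W g \<theta> where *: "flow_box a (h q) W g \<theta> (h \<circ> prod.swap)
        (\<lambda>z. (1 / ((\<lambda>z. w z / ?x z) \<circ> prod.swap) z,
          - (?y \<circ> prod.swap) z / (((\<lambda>z. w z / ?x z) \<circ> prod.swap) z * (?x \<circ> prod.swap) z)))"
      "W \<subseteq> prod.swap -` S'" "g (0, h q) = prod.swap q"
      using w0 S'(2) x0 by (auto simp: subset_iff)
    have "flow_box a (h q) (prod.swap -` W) (prod.swap \<circ> g) (\<theta> \<circ> prod.swap) h X"
    proof (rule flow_box_cong[OF flow_box_swap[OF *(1)]])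
      fix z assume "z \<in> prod.swap -` W"
      then have "z \<in> S'" using subsetD[OF *(2), of "prod.swap z"] by simp
      then show "(prod.swap \<circ> (\<lambda>z. (1 / ((\<lambda>z. w z / ?x z) \<circ> prod.swap) z,
          - (?y \<circ> prod.swap) z / (((\<lambda>z. w z / ?x z) \<circ> prod.swap) z * (?x \<circ> prod.swap) z))) \<circ> prod.swap) z = X z"
        using x0[of z] w0[of z] S'(2) by (auto simp: X_def field_simps)
    qed
    moreover have "prod.swap -` W \<subseteq> S"
    proof
      fix z assume "z \<in> prod.swap -` W"
      then show "z \<in> S" using subsetD[OF *(2), of "prod.swap z"] S'(2) by auto
    qed
    ultimately show ?thesis using *(3) that by auto
  qed
qed

section \<open>Charts and the Hamiltonian vector field\<close>

lemma compatible_chartD: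
  assumes "compatible_chart A (U, \<phi>)"
  shows "open U" "open (\<phi> ` U)" "homeomorphism U (\<phi> ` U) \<phi> (inv_into U \<phi>)"
    and "(V, \<psi>) \<in> A \<Longrightarrow> smooth_on (\<phi> ` (U \<inter> V)) (\<psi> \<circ> inv_into U \<phi>)"
    and "(V, \<psi>) \<in> A \<Longrightarrow> smooth_on (\<psi> ` (U \<inter> V)) (\<phi> \<circ> inv_into V \<psi>)"
proof -
  show "open U" "open (\<phi> ` U)"
    "(V, \<psi>) \<in> A \<Longrightarrow> smooth_on (\<phi> ` (U \<inter> V)) (\<psi> \<circ> inv_into U \<phi>)"
    "(V, \<psi>) \<in> A \<Longrightarrow> smooth_on (\<psi> ` (U \<inter> V)) (\<phi> \<circ> inv_into V \<psi>)"
    using assms unfolding compatible_chart_def by auto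
  obtain g where g: "homeomorphism U (\<phi> ` U) \<phi> g"
    using assms unfolding compatible_chart_def by auto
  then have "inj_on \<phi> U" by (metis homeomorphism_apply1 inj_onI)
  then have "inv_into U \<phi> y = g y" if "y \<in> \<phi> ` U" for y
    using that g by (auto simp: homeomorphism_def)
  then show "homeomorphism U (\<phi> ` U) \<phi> (inv_into U \<phi>)"
    by (intro homeomorphism_cong[OF g]) auto
qed

lemma has_derivative_cong_eventually:
  assumes "(f has_derivative D) (at x)" "\<forall>\<^sub>F y in nhds x. f y = g y"
  shows "(g has_derivative D) (at x)"
  using assms has_derivative_transform_within_open unfolding eventually_nhds by blast

locale hamiltonian_surface =
  fixes A :: "'a::t2_space chart set" and w :: "'a chart \<Rightarrow> real \<times> real \<Rightarrow> real" and H :: "'a \<Rightarrow> real"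
  assumes atlas: "surface_atlas A" and sympl: "symplectic_form A w"
    and smooth_H: "smooth_fun A H" and proper_H: "proper_fun H"
begin

text \<open>Membership in the atlas is deliberately not asked for: the saddle chart is only known to
  be compatible with it.\<close>

definition compat :: "'a set \<Rightarrow> ('a \<Rightarrow> real \<times> real) \<Rightarrow> bool" where
  "compat U \<phi> \<longleftrightarrow> compatible_chart A (U, \<phi>)"

lemma compat_atlas: "(V, \<psi>) \<in> A \<Longrightarrow> compat V \<psi>"
  using atlas unfolding surface_atlas_def compat_def by blast

lemma atlas_cover: obtains V \<psi> where "(V, \<psi>) \<in> A" "p \<in> V"
  using atlas unfolding surface_atlas_def
  by (metis (no_types, lifting) UNIV_I UN_E prod.collapse)

lemma chart_open: "compat U \<phi> \<Longrightarrow> open U" "compat U \<phi> \<Longrightarrow> open (\<phi> ` U)"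
  using compatible_chartD unfolding compat_def by blast+

lemma chart_homeo: "compat U \<phi> \<Longrightarrow> homeomorphism U (\<phi> ` U) \<phi> (inv_into U \<phi>)"
  using compatible_chartD unfolding compat_def by blast

lemma chart_inv: "compat U \<phi> \<Longrightarrow> p \<in> U \<Longrightarrow> inv_into U \<phi> (\<phi> p) = p"
  using chart_homeo homeomorphism_apply1 by blast

lemma chart_open_image:
  assumes "compat U \<phi>" "open S" "S \<subseteq> U"
  shows "open (\<phi> ` S)"
  using homeomorphism_imp_open_map[OF chart_homeo[OF assms(1)]] assms
    by (metis chart_open(2) inf.absorb_iff2 openin_open_eq openin_open openin_open_trans)

lemma chart_isCont: "compat U \<phi> \<Longrightarrow> p \<in> U \<Longrightarrow> isCont \<phi> p"
  using chart_homeo chart_open(1) continuous_on_eq_continuous_at homeomorphism_cont1 by blast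

lemma chart_inv_isCont: "compat U \<phi> \<Longrightarrow> p \<in> U \<Longrightarrow> isCont (inv_into U \<phi>) (\<phi> p)"
  using chart_homeo chart_open(2) continuous_on_eq_continuous_at homeomorphism_cont2 by blast

lemma eventually_chart_inv:
  assumes "compat U \<phi>" "p \<in> U" "open S" "p \<in> S"
  shows "\<forall>\<^sub>F y in nhds (\<phi> p). y \<in> \<phi> ` U \<and> inv_into U \<phi> y \<in> U \<inter> S"
proof -
  have "\<phi> ` (U \<inter> S) \<subseteq> \<phi> ` U" "open (\<phi> ` (U \<inter> S))" "\<phi> p \<in> \<phi> ` (U \<inter> S)"
    using assms chart_open(1)[OF assms(1)] by (auto intro!: chart_open_image)
  then show ?thesis
    unfolding eventually_nhds using chart_inv[OF assms(1)] by (intro exI[of _ "\<phi> ` (U \<inter> S)"]) auto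
qed

text \<open>Compatibility speaks about transitions to and from charts of \<open>A\<close>, so one of
  the two charts has to belong to \<open>A\<close>.\<close>

lemma transition_derivative:
  assumes V: "compat V \<psi>" and U: "compat U \<phi>" and A: "(V, \<psi>) \<in> A \<or> (U, \<phi>) \<in> A" and p: "p \<in> U" "p \<in> V"
  shows "(\<psi> \<circ> inv_into U \<phi> has_derivative frechet_derivative (\<psi> \<circ> inv_into U \<phi>) (at (\<phi> p))) (at (\<phi> p))"
proof (rule smooth_on_has_derivative)
  show "smooth_on (\<phi> ` (U \<inter> V)) (\<psi> \<circ> inv_into U \<phi>)"
    using A compatible_chartD(4,5) U V unfolding compat_def by (metis inf_commute)
qed (use p in auto)

lemma chart_change_eventually:
  assumes V: "compat V \<psi>" and U: "compat U \<phi>" and p: "p \<in> U" "p \<in> V"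
  shows "\<forall>\<^sub>F y in nhds (\<phi> p). (f \<circ> inv_into V \<psi>) ((\<psi> \<circ> inv_into U \<phi>) y) = (f \<circ> inv_into U \<phi>) y"
  using eventually_chart_inv[OF U p(1) chart_open(1)[OF V] p(2)]
  by eventually_elim (simp add: chart_inv[OF V])

lemma chart_change_derivative:
  assumes V: "compat V \<psi>" and U: "compat U \<phi>" and A: "(V, \<psi>) \<in> A \<or> (U, \<phi>) \<in> A" and p: "p \<in> U" "p \<in> V"
    and f: "(f \<circ> inv_into V \<psi> has_derivative f') (at (\<psi> p))"
  shows "(f \<circ> inv_into U \<phi> has_derivative (\<lambda>v. f' (frechet_derivative (\<psi> \<circ> inv_into U \<phi>) (at (\<phi> p)) v))) (at (\<phi> p))"
proof -
  have "(\<psi> \<circ> inv_into U \<phi>) (\<phi> p) = \<psi> p" by (simp add: chart_inv[OF U p(1)])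
  with f have "(f \<circ> inv_into V \<psi> has_derivative f') (at ((\<psi> \<circ> inv_into U \<phi>) (\<phi> p)))" by simp
  from has_derivative_compose[OF transition_derivative[OF V U A p] this]
  show ?thesis
    by (rule has_derivative_cong_eventually) (use chart_change_eventually[OF V U p, of f] in simp)
qed

section \<open>Differentiable functions on the surface\<close>

definition mdiff :: "('a \<Rightarrow> real) \<Rightarrow> 'a \<Rightarrow> bool" where
  "mdiff f p \<longleftrightarrow> (\<exists>(V, \<psi>)\<in>A. p \<in> V \<and> (f \<circ> inv_into V \<psi>) differentiable (at (\<psi> p)))"

text \<open>One atlas chart witnesses \<open>mdiff\<close>; the chain rule through the transition
  map moves it to every compatible chart, in particular to the saddle chart.\<close>

lemma mdiffD:
  assumes "mdiff f p" "compat U \<phi>" "p \<in> U"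
  shows "(f \<circ> inv_into U \<phi>) differentiable (at (\<phi> p))"
proof -
  obtain V \<psi> where "(V, \<psi>) \<in> A" "p \<in> V" "(f \<circ> inv_into V \<psi>) differentiable (at (\<psi> p))"
    using assms(1) unfolding mdiff_def by auto
  then show ?thesis
    using chart_change_derivative[OF compat_atlas assms(2) _ assms(3)] unfolding differentiable_def by blast
qed

lemma mdiff_cong:
  assumes "mdiff f p" "open S" "p \<in> S" "\<And>q. q \<in> S \<Longrightarrow> f q = g q"
  shows "mdiff g p"
proof -
  obtain V \<psi> where V: "(V, \<psi>) \<in> A" "p \<in> V" "(f \<circ> inv_into V \<psi>) differentiable (at (\<psi> p))"
    using assms(1) unfolding mdiff_def by auto
  then obtain f' where "(f \<circ> inv_into V \<psi> has_derivative f') (at (\<psi> p))"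
    unfolding differentiable_def by blast
  moreover have "\<forall>\<^sub>F y in nhds (\<psi> p). (f \<circ> inv_into V \<psi>) y = (g \<circ> inv_into V \<psi>) y"
    using eventually_chart_inv[OF compat_atlas[OF V(1)] V(2) assms(2,3)]
    by eventually_elim (use assms(4) in auto)
  ultimately have "(g \<circ> inv_into V \<psi> has_derivative f') (at (\<psi> p))"
    by (rule has_derivative_cong_eventually)
  then show ?thesis using V unfolding mdiff_def differentiable_def by blast
qed

lemma mdiff_H: "mdiff H p"
proof -
  obtain V \<psi> where V: "(V, \<psi>) \<in> A" "p \<in> V" by (rule atlas_cover)
  then have "smooth_on (\<psi> ` V) (H \<circ> inv_into V \<psi>)" using smooth_H unfolding smooth_fun_def by blast
  from smooth_on_has_derivative[OF this] V show ?thesis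
    unfolding mdiff_def differentiable_def by blast
qed

lemma continuous_H: "continuous_on UNIV H"
proof (rule continuous_at_imp_continuous_on, rule ballI)
  fix p
  obtain V \<psi> where V: "(V, \<psi>) \<in> A" "p \<in> V" by (rule atlas_cover)
  note c = compat_atlas[OF V(1)]
  have "isCont (H \<circ> inv_into V \<psi>) (\<psi> p)"
    using mdiffD[OF mdiff_H c V(2)] by (simp add: differentiable_imp_continuous_within)
  then have "isCont ((H \<circ> inv_into V \<psi>) \<circ> \<psi>) p"
    using chart_isCont[OF c V(2)] by (rule continuous_at_compose[rotated])
  moreover have "\<forall>\<^sub>F q in nhds p. ((H \<circ> inv_into V \<psi>) \<circ> \<psi>) q = H q"
    using eventually_nhds_in_open[OF chart_open(1)[OF c] V(2)]
    by eventually_elim (simp add: chart_inv[OF c])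
  ultimately show "isCont H p" using isCont_cong by blast
qed

abbreviation XH :: "'a set \<times> ('a \<Rightarrow> real \<times> real) \<Rightarrow> real \<times> real \<Rightarrow> real \<times> real" where
  "XH \<equiv> ham_vec w H"

text \<open>Stated at a single time, so that solutions on intervals can be restricted, shifted and
  glued pointwise; \<open>ham_curve\<close> is \<open>ode\<close> at all times.\<close>

definition ode :: "(real \<Rightarrow> 'a) \<Rightarrow> real \<Rightarrow> bool" where
  "ode \<gamma> t \<longleftrightarrow> isCont \<gamma> t \<and>
     (\<forall>(V, \<psi>)\<in>A. \<gamma> t \<in> V \<longrightarrow> (\<psi> \<circ> \<gamma> has_vector_derivative XH (V, \<psi>) (\<psi> (\<gamma> t))) (at t))"

definition reg :: "'a \<Rightarrow> bool" where
  "reg p \<longleftrightarrow> (\<exists>(V, \<psi>)\<in>A. p \<in> V \<and> XH (V, \<psi>) (\<psi> p) \<noteq> 0)"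

text \<open>The coefficient of the area form in the chart \<open>(U, \<phi>)\<close>, computed
  through the atlas chart \<open>(V, \<psi>)\<close>. For \<open>(U, \<phi>)\<close> in the atlas it
  is \<open>w (U, \<phi>)\<close>; for a merely compatible chart it takes the place of that
  value.\<close>

definition coeff :: "'a set \<Rightarrow> ('a \<Rightarrow> real \<times> real) \<Rightarrow> 'a set \<Rightarrow> ('a \<Rightarrow> real \<times> real) \<Rightarrow> 'a \<Rightarrow> real" where
  "coeff V \<psi> U \<phi> p = w (V, \<psi>) (\<psi> p) * jac_det (\<psi> \<circ> inv_into U \<phi>) (\<phi> p)"

lemma w_nonzero: "(V, \<psi>) \<in> A \<Longrightarrow> p \<in> V \<Longrightarrow> w (V, \<psi>) (\<psi> p) \<noteq> 0"
  using sympl unfolding symplectic_form_def by blast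

lemma coeff_atlas: "(V, \<psi>) \<in> A \<Longrightarrow> (U, \<phi>) \<in> A \<Longrightarrow> p \<in> U \<Longrightarrow> p \<in> V \<Longrightarrow> coeff V \<psi> U \<phi> p = w (U, \<phi>) (\<phi> p)"
proof -
  assume *: "(V, \<psi>) \<in> A" "(U, \<phi>) \<in> A" "p \<in> U" "p \<in> V"
  have "\<forall>C\<in>A. \<forall>D\<in>A. \<forall>p\<in>fst C \<inter> fst D.
      w C (snd C p) = w D (snd D p) * jac_det (snd D \<circ> inv_into (fst C) (snd C)) (snd C p)"
    using sympl unfolding symplectic_form_def case_prod_beta prod.collapse by (rule conjunct2)
  from this[rule_format, OF *(2,1), of p] * show ?thesis by (simp add: coeff_def)
qed

lemma derivative_along_curve:
  assumes c: "isCont \<gamma> t" and V: "compat V \<psi>" "\<gamma> t \<in> V"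
    and X: "(\<psi> \<circ> \<gamma> has_vector_derivative X) (at t)"
    and f: "(f \<circ> inv_into V \<psi> has_derivative f') (at (\<psi> (\<gamma> t)))"
  shows "(f \<circ> \<gamma> has_vector_derivative f' X) (at t)"
proof -
  have "((f \<circ> inv_into V \<psi>) \<circ> (\<psi> \<circ> \<gamma>) has_vector_derivative f' X) (at t)"
    by (rule vector_derivative_diff_chain_within[OF X])
      (use has_derivative_at_withinI[OF f] in \<open>simp add: o_def\<close>)
  moreover have "\<forall>\<^sub>F s in nhds t. ((f \<circ> inv_into V \<psi>) \<circ> (\<psi> \<circ> \<gamma>)) s = (f \<circ> \<gamma>) s"
  proof -
    have "\<forall>\<^sub>F s in nhds t. \<gamma> s \<in> V"
      using c[unfolded isCont_def tendsto_at_iff_tendsto_nhds] eventually_nhds_in_open[OF chart_open(1)[OF V(1)] V(2)]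
      unfolding filterlim_iff by blast
    then show ?thesis by eventually_elim (simp add: chart_inv[OF V(1)])
  qed
  ultimately show ?thesis
    unfolding has_vector_derivative_def
    by (rule has_derivative_cong_eventually)
qed

lemma frechet_H:
  assumes "compat U \<phi>" "p \<in> U"
  shows "(H \<circ> inv_into U \<phi> has_derivative
    (\<lambda>v. pd (1,0) (loc (U, \<phi>) H) (\<phi> p) * fst v + pd (0,1) (loc (U, \<phi>) H) (\<phi> p) * snd v)) (at (\<phi> p))"
proof -
  obtain h' where "(H \<circ> inv_into U \<phi> has_derivative h') (at (\<phi> p))"
    using mdiffD[OF mdiff_H assms] unfolding differentiable_def by blast
  from has_derivative_pd[OF this] show ?thesis by (simp add: loc_def)
qed

text \<open>Naturality of the Hamiltonian field: the differential of \<open>H\<close> pulls back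
  through the Jacobian \<open>?G\<close>, while the area coefficient is multiplied by its
  determinant. With the entries a, b, c, d written out, the two effects cancel by the adjugate
  formula for the inverse matrix.\<close>

lemma ham_vec_transform:
  assumes V: "(V, \<psi>) \<in> A" and U: "compat U \<phi>" and p: "p \<in> U" "p \<in> V"
    and nz: "coeff V \<psi> U \<phi> p \<noteq> 0"
  shows "frechet_derivative (\<psi> \<circ> inv_into U \<phi>) (at (\<phi> p))
      (- pd (0,1) (loc (U, \<phi>) H) (\<phi> p) / coeff V \<psi> U \<phi> p, pd (1,0) (loc (U, \<phi>) H) (\<phi> p) / coeff V \<psi> U \<phi> p)
      = XH (V, \<psi>) (\<psi> p)"
proof -
  let ?G = "frechet_derivative (\<psi> \<circ> inv_into U \<phi>) (at (\<phi> p))"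
  let ?hx = "pd (1,0) (loc (V, \<psi>) H) (\<psi> p)" and ?hy = "pd (0,1) (loc (V, \<psi>) H) (\<psi> p)"
  let ?kx = "pd (1,0) (loc (U, \<phi>) H) (\<phi> p)" and ?ky = "pd (0,1) (loc (U, \<phi>) H) (\<phi> p)"
  have V': "compat V \<psi>" by (rule compat_atlas[OF V])
  have lin: "linear ?G"
    using transition_derivative[OF V' U disjI1[OF V] p] has_derivative_linear by blast
  obtain a b c d where G1: "?G (1,0) = (a, c)" "?G (0,1) = (b, d)" by fastforce
  have G: "?G v = (fst v * a + snd v * b, fst v * c + snd v * d)" for v
    by (subst linear_real_pair[OF lin]) (simp add: G1)
  have k: "(\<lambda>v. ?kx * fst v + ?ky * snd v) = (\<lambda>v. ?hx * fst (?G v) + ?hy * snd (?G v))"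
    using chart_change_derivative[OF V' U disjI1[OF V] p frechet_H[OF V' p(2)]]
      frechet_H[OF U p(1)] has_derivative_unique by blast
  have kx: "?kx = ?hx * a + ?hy * c" using fun_cong[OF k, of "(1,0)"] by (simp add: G)
  have ky: "?ky = ?hx * b + ?hy * d" using fun_cong[OF k, of "(0,1)"] by (simp add: G)
  have co: "coeff V \<psi> U \<phi> p = w (V, \<psi>) (\<psi> p) * (a * d - b * c)"
    by (simp add: coeff_def jac_det_def Let_def G1)
  with nz have "w (V, \<psi>) (\<psi> p) \<noteq> 0" "a * d - b * c \<noteq> 0" by auto
  then show ?thesis
    unfolding G ham_vec_def kx ky co by (auto simp: divide_simps) (simp_all add: algebra_simps)
qed

lemma ham_vec_chart_change:
  assumes V: "(V, \<psi>) \<in> A" and U: "compat U \<phi>" and p: "\<gamma> t \<in> U" "\<gamma> t \<in> V"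
    and nz: "coeff V \<psi> U \<phi> (\<gamma> t) \<noteq> 0" and c: "isCont \<gamma> t"
    and X: "(\<psi> \<circ> \<gamma> has_vector_derivative XH (V, \<psi>) (\<psi> (\<gamma> t))) (at t)"
  shows "(\<phi> \<circ> \<gamma> has_vector_derivative
    (- pd (0,1) (loc (U, \<phi>) H) (\<phi> (\<gamma> t)) / coeff V \<psi> U \<phi> (\<gamma> t),
       pd (1,0) (loc (U, \<phi>) H) (\<phi> (\<gamma> t)) / coeff V \<psi> U \<phi> (\<gamma> t))) (at t)" (is "(_ has_vector_derivative ?Y) _")
proof -
  have V': "compat V \<psi>" by (rule compat_atlas[OF V])
  let ?F = "frechet_derivative (\<phi> \<circ> inv_into V \<psi>) (at (\<psi> (\<gamma> t)))"
  have F: "(\<phi> \<circ> inv_into V \<psi> has_derivative ?F) (at (\<psi> (\<gamma> t)))"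
    by (rule transition_derivative[OF U V' disjI2[OF V] p(2,1)])
  have "(\<phi> \<circ> inv_into U \<phi> has_derivative (\<lambda>v. ?F (frechet_derivative (\<psi> \<circ> inv_into U \<phi>) (at (\<phi> (\<gamma> t))) v))) (at (\<phi> (\<gamma> t)))"
    by (rule chart_change_derivative[OF V' U disjI1[OF V] p F])
  moreover have "(\<phi> \<circ> inv_into U \<phi> has_derivative (\<lambda>v. v)) (at (\<phi> (\<gamma> t)))"
  proof (rule has_derivative_transform_within_open[OF has_derivative_ident chart_open(2)[OF U]])
    show "\<phi> (\<gamma> t) \<in> \<phi> ` U" using p by blast
    show "y = (\<phi> \<circ> inv_into U \<phi>) y" if "y \<in> \<phi> ` U" for y
      using that by (simp add: f_inv_into_f)
  qed
  ultimately have FG: "?F (frechet_derivative (\<psi> \<circ> inv_into U \<phi>) (at (\<phi> (\<gamma> t))) v) = v" for v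
    using has_derivative_unique by metis
  show ?thesis
    using derivative_along_curve[OF c V' p(2) X F] FG[of ?Y]
    unfolding ham_vec_transform[OF V U p nz] by simp
qed

text \<open>By naturality of the field the correct velocity in one chart is the correct velocity in
  all of them.\<close>

lemma odeI:
  assumes c: "isCont \<gamma> t" and V: "(V, \<psi>) \<in> A" "\<gamma> t \<in> V"
    and X: "(\<psi> \<circ> \<gamma> has_vector_derivative XH (V, \<psi>) (\<psi> (\<gamma> t))) (at t)"
  shows "ode \<gamma> t"
  unfolding ode_def
proof (intro conjI c ballI, clarify)
  fix U \<phi> assume U: "(U, \<phi>) \<in> A" "\<gamma> t \<in> U"
  have co: "coeff V \<psi> U \<phi> (\<gamma> t) = w (U, \<phi>) (\<phi> (\<gamma> t))" by (rule coeff_atlas) (use U V in auto)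
  show "(\<phi> \<circ> \<gamma> has_vector_derivative XH (U, \<phi>) (\<phi> (\<gamma> t))) (at t)"
    using ham_vec_chart_change[OF V(1) compat_atlas[OF U(1)] U(2) V(2) _ c X] w_nonzero[OF U]
    unfolding co ham_vec_def[of w H "(U, \<phi>)"] by simp
qed

lemma odeD:
  assumes "ode \<gamma> t"
  shows "isCont \<gamma> t" "(V, \<psi>) \<in> A \<Longrightarrow> \<gamma> t \<in> V \<Longrightarrow> (\<psi> \<circ> \<gamma> has_vector_derivative XH (V, \<psi>) (\<psi> (\<gamma> t))) (at t)"
  using assms unfolding ode_def by blast+

lemma ham_curve_iff: "ham_curve A w H \<gamma> \<longleftrightarrow> (\<forall>t. ode \<gamma> t)"
  unfolding ham_curve_def ode_def continuous_on_eq_continuous_at[OF open_UNIV] by blast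

lemma ode_cong:
  assumes "ode \<gamma> t" "\<forall>\<^sub>F s in nhds t. \<gamma> s = \<eta> s"
  shows "ode \<eta> t"
proof -
  have e: "\<gamma> t = \<eta> t" using assms(2) eventually_nhds_x_imp_x by fastforce
  obtain V \<psi> where V: "(V, \<psi>) \<in> A" "\<gamma> t \<in> V" by (rule atlas_cover)
  show ?thesis
  proof (rule odeI[OF _ V(1)])
    show "isCont \<eta> t" using odeD(1)[OF assms(1)] isCont_cong[OF assms(2)] by blast
    have "\<forall>\<^sub>F s in nhds t. (\<psi> \<circ> \<gamma>) s = (\<psi> \<circ> \<eta>) s"
      using assms(2) by eventually_elim simp
    then show "(\<psi> \<circ> \<eta> has_vector_derivative XH (V, \<psi>) (\<psi> (\<eta> t))) (at t)"
      using odeD(2)[OF assms(1) V] e unfolding has_vector_derivative_def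
      by (metis has_derivative_cong_eventually)
    show "\<eta> t \<in> V" using V e by simp
  qed
qed

lemma ode_shift:
  assumes "ode \<gamma> (t + s)"
  shows "ode (\<lambda>t. \<gamma> (t + s)) t"
proof -
  obtain V \<psi> where V: "(V, \<psi>) \<in> A" "\<gamma> (t + s) \<in> V" by (rule atlas_cover)
  show ?thesis
  proof (rule odeI[where V = V and \<psi> = \<psi>, OF _ V(1)])
    show "isCont (\<lambda>t. \<gamma> (t + s)) t"
      using odeD(1)[OF assms] by (intro isCont_o2[of t "\<lambda>t. t + s" \<gamma>]) auto
    show "\<gamma> (t + s) \<in> V" by (rule V)
    show "(\<psi> \<circ> (\<lambda>t. \<gamma> (t + s)) has_vector_derivative XH (V, \<psi>) (\<psi> (\<gamma> (t + s)))) (at t)"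
    proof -
      have "((\<lambda>t. t + s) has_vector_derivative 1) (at t)" by (auto intro!: derivative_eq_intros)
      from vector_diff_chain_at[OF this, of "\<psi> \<circ> \<gamma>"] odeD(2)[OF assms V]
      show ?thesis by (simp add: o_def)
    qed
  qed
qed

text \<open>The derivative of \<open>f\<close> along a solution depends only on the field at the
  point. This is how an arbitrary solution is compared with a coordinate line of a box.\<close>

lemma derivative_unique_along_curves:
  assumes "ode \<gamma> t" "ode \<eta> s" "\<gamma> t = \<eta> s" "mdiff f (\<gamma> t)"
  obtains d where "(f \<circ> \<gamma> has_vector_derivative d) (at t)" "(f \<circ> \<eta> has_vector_derivative d) (at s)"
proof -
  obtain V \<psi> where V: "(V, \<psi>) \<in> A" "\<gamma> t \<in> V" by (rule atlas_cover)
  note c = compat_atlas[OF V(1)]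
  obtain f' where f': "(f \<circ> inv_into V \<psi> has_derivative f') (at (\<psi> (\<gamma> t)))"
    using mdiffD[OF assms(4) c V(2)] unfolding differentiable_def by blast
  show ?thesis
    using derivative_along_curve[OF odeD(1)[OF assms(1)] c V(2) odeD(2)[OF assms(1) V] f']
      derivative_along_curve[OF odeD(1)[OF assms(2)] c _ odeD(2)[OF assms(2) V(1)], of f f'] f' V(2) assms(3)
    by (intro that) auto
qed

lemma H_ode_derivative:
  assumes "ode \<gamma> t"
  shows "(H \<circ> \<gamma> has_vector_derivative 0) (at t)"
proof -
  obtain V \<psi> where V: "(V, \<psi>) \<in> A" "\<gamma> t \<in> V" by (rule atlas_cover)
  note c = compat_atlas[OF V(1)]
  show ?thesis
    using derivative_along_curve[OF odeD(1)[OF assms] c V(2) odeD(2)[OF assms V] frechet_H[OF c V(2)]]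
    by (simp add: ham_vec_def)
qed

lemma H_constant:
  assumes "is_interval I" "\<And>t. t \<in> I \<Longrightarrow> ode \<gamma> t" "s \<in> I" "t \<in> I"
  shows "H (\<gamma> s) = H (\<gamma> t)"
proof -
  obtain c where "\<And>x. x \<in> I \<Longrightarrow> (H \<circ> \<gamma>) x = c"
    using has_vector_derivative_zero_constant[OF is_interval_convex[OF assms(1)],
        OF has_vector_derivative_at_within[OF H_ode_derivative[OF assms(2)]]] by blast
  then show ?thesis using assms(3,4) by simp
qed

lemma reg_iff:
  assumes V: "(V, \<psi>) \<in> A" "p \<in> V"
  shows "reg p \<longleftrightarrow> XH (V, \<psi>) (\<psi> p) \<noteq> 0"
proof
  assume "reg p"
  then obtain U \<phi> where U: "(U, \<phi>) \<in> A" "p \<in> U" "XH (U, \<phi>) (\<phi> p) \<noteq> 0" unfolding reg_def by auto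
  have co: "coeff U \<phi> V \<psi> p = w (V, \<psi>) (\<psi> p)" by (rule coeff_atlas) (use U V in auto)
  have "linear (frechet_derivative (\<phi> \<circ> inv_into V \<psi>) (at (\<psi> p)))"
    using transition_derivative[OF compat_atlas compat_atlas disjI1, OF U(1) V(1) U(1) V(2) U(2)]
      has_derivative_linear by blast
  from linear_0[OF this] show "XH (V, \<psi>) (\<psi> p) \<noteq> 0"
    using ham_vec_transform[OF U(1) compat_atlas[OF V(1)] V(2) U(2)] w_nonzero[OF V] U(3)
    unfolding co ham_vec_def[of w H "(V, \<psi>)"] by force
qed (use V reg_def in auto)

text \<open>Differentiability is recorded through real functions: the time coordinate is
  differentiable on \<open>Q\<close>, and \<open>\<Psi>\<close> pulls differentiable functions back
  to the square. The energy coordinate is \<open>H\<close> itself, which is known to be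
  differentiable.\<close>

definition time_energy_box :: "real \<Rightarrow> real \<Rightarrow> 'a set \<Rightarrow> (real \<times> real \<Rightarrow> 'a) \<Rightarrow> ('a \<Rightarrow> real \<times> real) \<Rightarrow> bool" where
  "time_energy_box a e0 Q \<Psi> \<Theta> \<longleftrightarrow> a > 0 \<and> open Q \<and> homeomorphism (square a 0 e0) Q \<Psi> \<Theta> \<and>
     (\<forall>p\<in>Q. reg p \<and> snd (\<Theta> p) = H p \<and> mdiff (fst \<circ> \<Theta>) p) \<and>
     (\<forall>t e. (t, e) \<in> square a 0 e0 \<longrightarrow> ode (\<lambda>t. \<Psi> (t, e)) t) \<and>
     (\<forall>b\<in>square a 0 e0. \<forall>f. mdiff f (\<Psi> b) \<longrightarrow> (f \<circ> \<Psi>) differentiable (at b))"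

lemma time_energy_box_exists:
  assumes "reg p"
  obtains a Q \<Psi> \<Theta> where "time_energy_box a (H p) Q \<Psi> \<Theta>" "\<Psi> (0, H p) = p"
proof -
  obtain V \<psi> where V: "(V, \<psi>) \<in> A" "p \<in> V" by (rule atlas_cover)
  note c = compat_atlas[OF V(1)]
  let ?S = "{z \<in> \<psi> ` V. XH (V, \<psi>) z \<noteq> 0}"
  let ?h = "H \<circ> inv_into V \<psi>"
  have sm: "smooth_on (\<psi> ` V) ?h" "smooth_on (\<psi> ` V) (w (V, \<psi>))"
    using smooth_H sympl V unfolding smooth_fun_def symplectic_form_def by blast+
  have w0: "w (V, \<psi>) z \<noteq> 0" if "z \<in> \<psi> ` V" for z using w_nonzero[OF V(1)] that by blast
  have X: "XH (V, \<psi>) = (\<lambda>z. (- pd (0,1) ?h z / w (V, \<psi>) z, pd (1,0) ?h z / w (V, \<psi>) z))"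
    by (simp add: ham_vec_def loc_def fun_eq_iff)
  have "XH (V, \<psi>) (\<psi> p) \<noteq> 0" using assms reg_iff[OF V] by simp
  with planar_flow_box[OF chart_open(2)[OF c] _ sm w0] V(2)
  obtain a W g \<theta> where box: "flow_box a (?h (\<psi> p)) W g \<theta> ?h (XH (V, \<psi>))" "W \<subseteq> \<psi> ` V" "g (0, ?h (\<psi> p)) = \<psi> p"
    unfolding X by blast
  have hp: "?h (\<psi> p) = H p" by (simp add: chart_inv[OF c V(2)])
  define \<Psi> where "\<Psi> = inv_into V \<psi> \<circ> g"
  define \<Theta> where "\<Theta> = \<theta> \<circ> \<psi>"
  define Q where "Q = inv_into V \<psi> ` W"
  have "homeomorphism W Q (inv_into V \<psi>) \<psi>"
    unfolding Q_def by (rule homeomorphism_restrict[OF homeomorphism_symD[OF chart_homeo[OF c]] box(2)])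
  moreover have hg: "homeomorphism (square a 0 (H p)) W g \<theta>" using box(1) unfolding flow_box_def hp by blast
  ultimately have hom: "homeomorphism (square a 0 (H p)) Q \<Psi> \<Theta>"
    unfolding \<Psi>_def \<Theta>_def by (rule homeomorphism_compose[rotated])
  have Q: "q \<in> Q \<longleftrightarrow> q \<in> V \<and> \<psi> q \<in> W" for q
  proof (intro iffI)
    assume "q \<in> V \<and> \<psi> q \<in> W"
    then show "q \<in> Q" unfolding Q_def using chart_inv[OF c, of q] by (metis imageI)
  next
    assume "q \<in> Q"
    then obtain y where y: "y \<in> W" "q = inv_into V \<psi> y" unfolding Q_def by blast
    then have "y \<in> \<psi> ` V" using box(2) by blast
    with y show "q \<in> V \<and> \<psi> q \<in> W" by (simp add: inv_into_into f_inv_into_f)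
  qed
  have "Q = V \<inter> \<psi> -` W" by (rule set_eqI) (simp only: Q Int_iff vimage_eq)
  moreover have "open W" using box(1) unfolding flow_box_def by blast
  ultimately have "open Q"
    using continuous_open_preimage[OF homeomorphism_cont1[OF chart_homeo[OF c]] chart_open(1)[OF c]] by simp
  have gW: "g b \<in> W" "\<Psi> b \<in> V" "\<psi> (\<Psi> b) = g b" if "b \<in> square a 0 (H p)" for b
  proof -
    show "g b \<in> W" using hg that unfolding homeomorphism_def by blast
    then have "g b \<in> \<psi> ` V" using box(2) by blast
    then show "\<Psi> b \<in> V" "\<psi> (\<Psi> b) = g b"
      unfolding \<Psi>_def by (simp_all only: o_apply inv_into_into f_inv_into_f)
  qed
  have "reg q \<and> snd (\<Theta> q) = H q \<and> mdiff (fst \<circ> \<Theta>) q" if "q \<in> Q" for q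
  proof (intro conjI)
    have q: "q \<in> V" "\<psi> q \<in> W" using that Q by auto
    obtain b where b: "b \<in> square a 0 (H p)" "g b = \<psi> q"
      using hg q unfolding homeomorphism_def by (metis imageE)
    then obtain g' where g': "(g has_derivative g') (at b)" "g' (1, 0) = XH (V, \<psi>) (\<psi> q)"
      using box(1) unfolding flow_box_def hp by metis
    obtain \<theta>' where \<theta>': "(\<theta> has_derivative \<theta>') (at (\<psi> q))"
      using box(1) q unfolding flow_box_def differentiable_def by blast
    have "((\<lambda>x. \<theta> (g x)) has_derivative (\<lambda>x. \<theta>' (g' x))) (at b)"
      using has_derivative_compose[OF g'(1)] \<theta>' b by simp
    moreover have "((\<lambda>x. \<theta> (g x)) has_derivative (\<lambda>x. x)) (at b)"
      by (rule has_derivative_transform_within_open[OF has_derivative_ident open_square b(1)])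
        (metis hg homeomorphism_apply1)
    ultimately have "(\<lambda>x. \<theta>' (g' x)) = (\<lambda>x. x)" by (rule has_derivative_unique)
    \<comment> \<open>\<open>\<theta>\<close> inverts \<open>g\<close>, so \<open>\<theta>'\<close>
      sends the field at \<open>q\<close> to a nonzero vector; hence every point of the box is
      regular.\<close>
    then have "\<theta>' (g' (1,0)) = (1, 0)" by metis
    then have "XH (V, \<psi>) (\<psi> q) \<noteq> 0"
      using g'(2) linear_0[OF has_derivative_linear[OF \<theta>']] by (auto simp: zero_prod_def)
    then show "reg q" using reg_iff[OF V(1) q(1)] by simp
    show "snd (\<Theta> q) = H q"
      using box(1) q chart_inv[OF c] unfolding flow_box_def \<Theta>_def by simp
    have "((fst \<circ> \<Theta>) \<circ> inv_into V \<psi> has_derivative (\<lambda>v. fst (\<theta>' v))) (at (\<psi> q))"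
    proof (rule has_derivative_transform_within_open[OF has_derivative_fst[OF \<theta>'] chart_open(2)[OF c]])
      show "\<psi> q \<in> \<psi> ` V" using q by blast
      show "fst (\<theta> y) = ((fst \<circ> \<Theta>) \<circ> inv_into V \<psi>) y" if "y \<in> \<psi> ` V" for y
        using that by (simp add: \<Theta>_def f_inv_into_f)
    qed
    then show "mdiff (fst \<circ> \<Theta>) q" unfolding mdiff_def differentiable_def using V q by blast
  qed
  moreover have "ode (\<lambda>t. \<Psi> (t, e)) t" if te: "(t, e) \<in> square a 0 (H p)" for t e
  proof (rule odeI[OF _ V(1)])
    note m = gW[OF te]
    show "\<Psi> (t, e) \<in> V" by (rule m)
    have "isCont \<Psi> (t, e)"
      using homeomorphism_cont1[OF hom] te continuous_on_eq_continuous_at[OF open_square] by blast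
    then show "isCont (\<lambda>t. \<Psi> (t, e)) t"
      by (intro isCont_o2[of t "\<lambda>t. (t, e)" \<Psi>]) (auto intro!: continuous_intros)
    obtain g' where g': "(g has_derivative g') (at (t, e))" "g' (1, 0) = XH (V, \<psi>) (g (t, e))"
      using box(1) te unfolding flow_box_def hp by blast
    have "((\<lambda>t. (t, e)) has_vector_derivative (1, 0)) (at t)"
      unfolding has_vector_derivative_def by (auto intro!: derivative_eq_intros)
    from vector_derivative_diff_chain_within[OF this has_derivative_at_withinI[OF g'(1)]]
    have 1: "(g \<circ> (\<lambda>t. (t, e)) has_vector_derivative XH (V, \<psi>) (g (t, e))) (at t)"
      using g'(2) by simp
    have "((\<psi> \<circ> (\<lambda>t. \<Psi> (t, e))) has_vector_derivative XH (V, \<psi>) (g (t, e))) (at t)"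
    proof (rule has_vector_derivative_transform_within_open[OF 1, of "{-a<..<a}"])
      show "(g \<circ> (\<lambda>t. (t, e))) s = (\<psi> \<circ> (\<lambda>t. \<Psi> (t, e))) s" if "s \<in> {-a<..<a}" for s
        using gW(3)[of "(s, e)"] that te by simp
    qed (use te in auto)
    then show "((\<psi> \<circ> (\<lambda>t. \<Psi> (t, e))) has_vector_derivative XH (V, \<psi>) (\<psi> (\<Psi> (t, e)))) (at t)"
      using m by simp
  qed
  moreover have "(f \<circ> \<Psi>) differentiable (at b)" if b: "b \<in> square a 0 (H p)" and f: "mdiff f (\<Psi> b)" for b f
  proof -
    have "(f \<circ> inv_into V \<psi>) differentiable (at (g b))"
      using mdiffD[OF f c gW(2)[OF b]] gW(3)[OF b] by simp
    moreover have "g differentiable (at b)"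
      using box(1) b unfolding flow_box_def hp differentiable_def by blast
    ultimately have "((f \<circ> inv_into V \<psi>) \<circ> g) differentiable (at b)" by (intro differentiable_chain_at)
    then show ?thesis unfolding \<Psi>_def by (simp add: o_assoc)
  qed
  moreover have "a > 0" using box(1) unfolding flow_box_def by blast
  ultimately have "time_energy_box a (H p) Q \<Psi> \<Theta>"
    using hom \<open>open Q\<close> unfolding time_energy_box_def by blast
  moreover have "\<Psi> (0, H p) = p" using box(3) chart_inv[OF c V(2)] by (simp add: \<Psi>_def)
  ultimately show ?thesis by (rule that)
qed

end

section \<open>Uniqueness and existence of global solutions\<close>

text \<open>Connectedness in the form used throughout: near each point of \<open>I\<close> the
  property either holds everywhere or fails everywhere. It serves uniqueness of solutions,
  differentiability of the flow in all times, and the spreading of a return time over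
  energies.\<close>

lemma real_interval_induction:
  fixes I :: "real set"
  assumes I: "is_interval I" and ab: "a \<in> I" "b \<in> I" and P: "P a"
    and loc: "\<And>t. t \<in> I \<Longrightarrow> (\<forall>\<^sub>F s in nhds t. s \<in> I \<longrightarrow> P s) \<or> (\<forall>\<^sub>F s in nhds t. s \<in> I \<longrightarrow> \<not> P s)"
  shows "P b"
proof (rule connected_induction_simple[of I a b P])
  show "connected I" using I by (simp add: is_interval_connected)
  fix t assume t: "t \<in> I"
  from loc[OF t] obtain T where "open T" "t \<in> T" "(\<forall>s\<in>T. s \<in> I \<longrightarrow> P s) \<or> (\<forall>s\<in>T. s \<in> I \<longrightarrow> \<not> P s)"
    unfolding eventually_nhds by auto
  then show "\<exists>T. openin (top_of_set I) T \<and> t \<in> T \<and> (\<forall>x\<in>T. \<forall>y\<in>T. P x \<longrightarrow> P y)"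
    using t by (intro exI[of _ "I \<inter> T"]) (auto simp: openin_open)
qed (use ab P in auto)

lemma isCont_eventually_open:
  assumes "isCont f t" "open S" "f t \<in> S"
  shows "\<forall>\<^sub>F s in nhds t. f s \<in> S"
  using assms(1)[unfolded isCont_def tendsto_at_iff_tendsto_nhds] eventually_nhds_in_open[OF assms(2,3)]
  unfolding filterlim_iff by blast

lemma isCont_eventually_neq:
  fixes f g :: "'a::t2_space \<Rightarrow> 'b::t2_space"
  assumes "isCont f t" "isCont g t" "f t \<noteq> g t"
  shows "\<forall>\<^sub>F s in nhds t. f s \<noteq> g s"
proof -
  obtain U V where "open U" "open V" "f t \<in> U" "g t \<in> V" "U \<inter> V = {}"
    using hausdorff[OF assms(3)] by blast
  then have "\<forall>\<^sub>F s in nhds t. f s \<in> U" "\<forall>\<^sub>F s in nhds t. g s \<in> V"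
    using isCont_eventually_open assms by blast+
  then show ?thesis by eventually_elim (use \<open>U \<inter> V = {}\<close> in auto)
qed

lemma Ck_on_uminus: "Ck_on k S f \<Longrightarrow> Ck_on k S (\<lambda>x. - f x)"
proof (induction k arbitrary: f)
  case 0
  then show ?case by (simp add: continuous_on_minus)
next
  case (Suc k)
  then obtain f' where "\<forall>x\<in>S. (f has_derivative f' x) (at x)" "\<forall>v. Ck_on k S (\<lambda>x. f' x v)" by auto
  then show ?case
    using Suc.IH by (auto intro!: exI[of _ "\<lambda>x v. - f' x v"] has_derivative_minus)
qed

lemma is_interval_real_greaterThanLessThan [simp]: "is_interval {a<..<b::real}"
  by (simp add: is_interval_1)

context hamiltonian_surface
begin

text \<open>Regularity along the curve is built in, because the uniqueness proof works in boxes
  around the points of the curve.\<close>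

definition sol :: "(real \<Rightarrow> 'a) \<Rightarrow> real set \<Rightarrow> bool" where
  "sol \<gamma> I \<longleftrightarrow> (\<forall>t\<in>I. ode \<gamma> t \<and> reg (\<gamma> t))"

lemma time_energy_boxD:
  assumes "time_energy_box a e0 Q \<Psi> \<Theta>"
  shows "a > 0" "open Q" "p \<in> Q \<Longrightarrow> \<Psi> (\<Theta> p) = p" "b \<in> square a 0 e0 \<Longrightarrow> \<Theta> (\<Psi> b) = b"
    "p \<in> Q \<Longrightarrow> \<Theta> p \<in> square a 0 e0" "b \<in> square a 0 e0 \<Longrightarrow> \<Psi> b \<in> Q"
    "p \<in> Q \<Longrightarrow> reg p" "p \<in> Q \<Longrightarrow> snd (\<Theta> p) = H p" "p \<in> Q \<Longrightarrow> mdiff (fst \<circ> \<Theta>) p"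
    "(t, e) \<in> square a 0 e0 \<Longrightarrow> ode (\<lambda>t. \<Psi> (t, e)) t"
    "b \<in> square a 0 e0 \<Longrightarrow> mdiff f (\<Psi> b) \<Longrightarrow> (f \<circ> \<Psi>) differentiable (at b)"
    "b \<in> square a 0 e0 \<Longrightarrow> isCont \<Psi> b" "p \<in> Q \<Longrightarrow> isCont \<Theta> p"
proof -
  have h: "homeomorphism (square a 0 e0) Q \<Psi> \<Theta>" using assms unfolding time_energy_box_def by blast
  show "p \<in> Q \<Longrightarrow> \<Psi> (\<Theta> p) = p" "b \<in> square a 0 e0 \<Longrightarrow> \<Theta> (\<Psi> b) = b"
    "p \<in> Q \<Longrightarrow> \<Theta> p \<in> square a 0 e0" "b \<in> square a 0 e0 \<Longrightarrow> \<Psi> b \<in> Q"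
    using h unfolding homeomorphism_def by blast+
  show o: "open Q" using assms unfolding time_energy_box_def by blast
  show "a > 0" "p \<in> Q \<Longrightarrow> reg p" "p \<in> Q \<Longrightarrow> snd (\<Theta> p) = H p" "p \<in> Q \<Longrightarrow> mdiff (fst \<circ> \<Theta>) p"
    "(t, e) \<in> square a 0 e0 \<Longrightarrow> ode (\<lambda>t. \<Psi> (t, e)) t"
    "b \<in> square a 0 e0 \<Longrightarrow> mdiff f (\<Psi> b) \<Longrightarrow> (f \<circ> \<Psi>) differentiable (at b)"
    using assms unfolding time_energy_box_def by blast+
  show "b \<in> square a 0 e0 \<Longrightarrow> isCont \<Psi> b"
    using homeomorphism_cont1[OF h] continuous_on_eq_continuous_at[OF open_square] by blast
  show "p \<in> Q \<Longrightarrow> isCont \<Theta> p"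
    using homeomorphism_cont2[OF h] continuous_on_eq_continuous_at[OF o] by blast
qed

text \<open>The horizontal line of the box through the same point is also a solution, and along it
  the time coordinate has slope 1.\<close>

lemma time_energy_box_time_derivative:
  assumes B: "time_energy_box a e0 Q \<Psi> \<Theta>" and g: "ode \<gamma> t" "\<gamma> t \<in> Q"
  shows "(fst \<circ> \<Theta> \<circ> \<gamma> has_vector_derivative 1) (at t)"
proof -
  note m = time_energy_boxD[OF B]
  obtain u e where ue: "\<Theta> (\<gamma> t) = (u, e)" by fastforce
  then have I: "(u, e) \<in> square a 0 e0" using m(5)[OF g(2)] by simp
  have "\<gamma> t = \<Psi> (u, e)" using m(3)[OF g(2)] ue by simp
  from derivative_unique_along_curves[OF g(1) m(10)[OF I] this m(9)[OF g(2)]]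
  obtain d where d: "(fst \<circ> \<Theta> \<circ> \<gamma> has_vector_derivative d) (at t)"
    "((fst \<circ> \<Theta>) \<circ> (\<lambda>t. \<Psi> (t, e)) has_vector_derivative d) (at u)" by blast
  have "((fst \<circ> \<Theta>) \<circ> (\<lambda>t. \<Psi> (t, e)) has_vector_derivative 1) (at u)"
  proof (rule has_vector_derivative_transform_within_open[OF has_vector_derivative_id, of "{-a<..<a}"])
    show "s = ((fst \<circ> \<Theta>) \<circ> (\<lambda>t. \<Psi> (t, e))) s" if "s \<in> {-a<..<a}" for s
      using m(4)[of "(s, e)"] that I by simp
  qed (use I in auto)
  with d show ?thesis using vector_derivative_unique_at by blast
qed

text \<open>Time grows with slope 1 and energy is conserved, so in box coordinates every solution is
  the same translation. Local uniqueness is an immediate consequence.\<close>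

lemma time_energy_box_follow:
  assumes B: "time_energy_box a e0 Q \<Psi> \<Theta>" and I: "is_interval I" and g: "\<And>t. t \<in> I \<Longrightarrow> ode \<gamma> t \<and> \<gamma> t \<in> Q"
    and st: "s \<in> I" "t \<in> I"
  shows "\<Theta> (\<gamma> t) = (fst (\<Theta> (\<gamma> s)) + (t - s), H (\<gamma> s))"
proof -
  have "((\<lambda>t. (fst \<circ> \<Theta> \<circ> \<gamma>) t - t) has_vector_derivative 0) (at x within I)" if "x \<in> I" for x
    using has_vector_derivative_diff[OF time_energy_box_time_derivative[OF B] has_vector_derivative_id, of \<gamma> x] g[OF that]
    by (auto intro: has_vector_derivative_at_within)
  from has_vector_derivative_zero_constant[OF is_interval_convex[OF I] this]
  obtain c where "\<And>x. x \<in> I \<Longrightarrow> (fst \<circ> \<Theta> \<circ> \<gamma>) x - x = c" by blast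
  from this[OF st(1)] this[OF st(2)] have "fst (\<Theta> (\<gamma> t)) = fst (\<Theta> (\<gamma> s)) + (t - s)" by simp
  moreover have "snd (\<Theta> (\<gamma> t)) = H (\<gamma> s)"
    using time_energy_boxD(8)[OF B] g st H_constant[OF I, of \<gamma> t s] by auto
  ultimately show ?thesis by (simp add: prod_eq_iff)
qed

lemma sol_unique_local:
  assumes "open I" "t0 \<in> I" "sol \<gamma> I" "sol \<eta> I" "\<gamma> t0 = \<eta> t0"
  shows "\<forall>\<^sub>F t in nhds t0. \<gamma> t = \<eta> t"
proof -
  have r: "reg (\<gamma> t0)" "isCont \<gamma> t0" "isCont \<eta> t0" using assms odeD(1) unfolding sol_def by blast+
  obtain a Q \<Psi> \<Theta> where B: "time_energy_box a (H (\<gamma> t0)) Q \<Psi> \<Theta>" "\<Psi> (0, H (\<gamma> t0)) = \<gamma> t0"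
    using time_energy_box_exists[OF r(1)] by blast
  note m = time_energy_boxD[OF B(1)]
  have "\<gamma> t0 \<in> Q" using m(6)[of "(0, H (\<gamma> t0))"] B(2) m(1) by simp
  then have "\<forall>\<^sub>F t in nhds t0. \<gamma> t \<in> Q" "\<forall>\<^sub>F t in nhds t0. \<eta> t \<in> Q"
    using isCont_eventually_open r m(2) assms(5) by metis+
  moreover have "\<forall>\<^sub>F t in nhds t0. t \<in> I" using assms eventually_nhds_in_open by blast
  ultimately have "\<forall>\<^sub>F t in nhds t0. t \<in> I \<and> \<gamma> t \<in> Q \<and> \<eta> t \<in> Q" by eventually_elim blast
  then obtain d where d: "d > 0" "\<And>t. dist t t0 < d \<Longrightarrow> t \<in> I \<and> \<gamma> t \<in> Q \<and> \<eta> t \<in> Q"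
    unfolding eventually_nhds_metric by blast
  have "\<gamma> t = \<eta> t" if "dist t t0 < d" for t
  proof -
    have J: "is_interval (ball t0 d)" "t0 \<in> ball t0 d" "t \<in> ball t0 d"
      using d that by (auto simp: dist_commute is_interval_ball_real)
    have "\<Theta> (\<gamma> t) = \<Theta> (\<eta> t)"
      using time_energy_box_follow[OF B(1) J(1) _ J(2,3), of \<gamma>] time_energy_box_follow[OF B(1) J(1) _ J(2,3), of \<eta>]
        assms d(2) unfolding sol_def by (simp add: dist_commute)
    then show ?thesis using m(3) d(2)[OF that] by metis
  qed
  then show ?thesis unfolding eventually_nhds_metric using d by blast
qed

lemma sol_unique:
  assumes I: "open I" "is_interval I" and t: "t0 \<in> I" "t \<in> I" and s: "sol \<gamma> I" "sol \<eta> I" "\<gamma> t0 = \<eta> t0"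
  shows "\<gamma> t = \<eta> t"
proof (rule real_interval_induction[OF I(2) t, of "\<lambda>t. \<gamma> t = \<eta> t"])
  fix u assume u: "u \<in> I"
  show "(\<forall>\<^sub>F x in nhds u. x \<in> I \<longrightarrow> \<gamma> x = \<eta> x) \<or> (\<forall>\<^sub>F x in nhds u. x \<in> I \<longrightarrow> \<gamma> x \<noteq> \<eta> x)"
  proof (cases "\<gamma> u = \<eta> u")
    case True
    from sol_unique_local[OF I(1) u s(1,2) this] show ?thesis
      by (intro disjI1) (auto elim: eventually_mono)
  next
    case False
    have "isCont \<gamma> u" "isCont \<eta> u" using s u odeD(1) unfolding sol_def by blast+
    from isCont_eventually_neq[OF this False] show ?thesis
      by (intro disjI2) (auto elim: eventually_mono)
  qed
qed (rule s(3))

lemma sol_cong: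
  assumes "sol \<gamma> I" "open I" "\<And>t. t \<in> I \<Longrightarrow> \<eta> t = \<gamma> t"
  shows "sol \<eta> I"
  unfolding sol_def
proof (intro ballI conjI)
  fix t assume t: "t \<in> I"
  have "\<forall>\<^sub>F s in nhds t. \<gamma> s = \<eta> s"
    using eventually_nhds_in_open[OF assms(2) t] by eventually_elim (simp add: assms(3))
  then show "ode \<eta> t" using ode_cong assms(1) t unfolding sol_def by blast
  show "reg (\<eta> t)" using assms t unfolding sol_def by simp
qed

lemma sol_subset: "sol \<gamma> I \<Longrightarrow> J \<subseteq> I \<Longrightarrow> sol \<gamma> J"
  unfolding sol_def by blast

lemma sol_shift: "sol \<gamma> ((+) s ` I) \<Longrightarrow> sol (\<lambda>t. \<gamma> (t + s)) I"
  unfolding sol_def using ode_shift[of \<gamma> _ s] by (fastforce simp: image_iff add.commute[of s])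

lemma time_energy_box_sol:
  assumes B: "time_energy_box a e0 Q \<Psi> \<Theta>" and e: "e \<in> {e0 - a<..<e0 + a}"
  shows "sol (\<lambda>t. \<Psi> (t, e)) {-a<..<a}"
  using time_energy_boxD(6,7,10)[OF B] e unfolding sol_def by simp

text \<open>The solutions are chosen independently for each \<open>n\<close>; since they agree at 0,
  uniqueness makes them agree wherever two are defined.\<close>

lemma sol_glue:
  assumes I: "\<And>n. open (I n)" "\<And>n. is_interval (I n)" "\<And>n. 0 \<in> I n" "\<And>n. I n \<subseteq> I (Suc n)"
    and ex: "\<And>n::nat. \<exists>\<gamma>. sol \<gamma> (I n) \<and> \<gamma> 0 = p"
  shows "\<exists>\<gamma>. sol \<gamma> (\<Union>n. I n) \<and> \<gamma> 0 = p"
proof -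
  obtain G where G: "\<And>n. sol (G n) (I n)" "\<And>n. G n 0 = p" using ex by metis
  have mono: "I m \<subseteq> I n" if "m \<le> n" for m n using lift_Suc_mono_le[of I, OF I(4) that] .
  have agree: "G m t = G n t" if "m \<le> n" "t \<in> I m" for m n t
  proof (rule sol_unique[OF I(1,2) I(3) that(2)])
    show "sol (G m) (I m)" by (rule G)
    show "sol (G n) (I m)" using G(1)[of n] mono[OF that(1)] unfolding sol_def by blast
    show "G m 0 = G n 0" by (simp only: G(2))
  qed
  define \<gamma> where "\<gamma> = (\<lambda>t. G (LEAST n. t \<in> I n) t)"
  have eq: "\<gamma> t = G n t" if "t \<in> I n" for t n
    unfolding \<gamma>_def by (rule agree) (use that in \<open>auto intro: Least_le LeastI\<close>)
  have "sol \<gamma> (I n)" for n by (rule sol_cong[OF G(1) I(1) eq])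
  then have "sol \<gamma> (\<Union>n. I n)" unfolding sol_def by blast
  moreover have "\<gamma> 0 = p" using eq[OF I(3)] G(2) by simp
  ultimately show ?thesis by blast
qed

text \<open>Near a critical point the Hamiltonian field grows at most linearly, so by the
Gronwall argument a regular solution needs infinite time to get there.\<close>

lemma critical_point_linear_growth:
  assumes V: "(V, \<psi>) \<in> A" "q \<in> V" and "\<not> reg q"
  obtains K r where "K > 0" "r > 0" "cball (\<psi> q) r \<subseteq> \<psi> ` V"
    "\<And>x. x \<in> cball (\<psi> q) r \<Longrightarrow> norm (XH (V, \<psi>) x) \<le> K * norm (x - \<psi> q)"
proof -
  note c = compat_atlas[OF V(1)]
  have sm: "smooth_on (\<psi> ` V) (loc (V, \<psi>) H)" "smooth_on (\<psi> ` V) (w (V, \<psi>))"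
    using smooth_H sympl V unfolding smooth_fun_def symplectic_form_def loc_def by auto
  have in': "\<psi> q \<in> \<psi> ` V" using V by blast
  have D: "f differentiable (at (\<psi> q))" if "smooth_on (\<psi> ` V) f" for f :: "_ \<Rightarrow> real"
    using smooth_on_has_derivative[OF that in'] unfolding differentiable_def by blast
  let ?f = "\<lambda>e x. pd e (loc (V, \<psi>) H) x / w (V, \<psi>) x"
  have q: "?f e differentiable (at (\<psi> q))" for e
    using D[OF smooth_on_pd[OF chart_open(2)[OF c] sm(1)]] D[OF sm(2)] w_nonzero[OF V]
    by (intro differentiable_divide)
  obtain D1 D2 where "(?f (1,0) has_derivative D1) (at (\<psi> q))" "(?f (0,1) has_derivative D2) (at (\<psi> q))"
    using q[of "(1,0)"] q[of "(0,1)"] unfolding differentiable_def by blast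
  from has_derivative_Pair[OF has_derivative_minus[OF this(2)] this(1)]
  have "(XH (V, \<psi>) has_derivative (\<lambda>v. (- D2 v, D1 v))) (at (\<psi> q))"
    by (simp add: ham_vec_def[abs_def])
  then obtain D where D: "(XH (V, \<psi>) has_derivative D) (at (\<psi> q))" by blast
  have X0: "XH (V, \<psi>) (\<psi> q) = 0" using assms reg_iff by blast
  obtain d where d: "d > 0"
    "\<And>y. norm (y - \<psi> q) < d \<Longrightarrow> norm (XH (V, \<psi>) y - XH (V, \<psi>) (\<psi> q) - D (y - \<psi> q)) \<le> 1 * norm (y - \<psi> q)"
    using D[unfolded has_derivative_at_alt] zero_less_one by blast
  obtain K where K: "K > 0" "\<And>x. norm (D x) \<le> norm x * K"
    using bounded_linear.pos_bounded[OF has_derivative_bounded_linear[OF D]] by blast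
  obtain r where r: "r > 0" "cball (\<psi> q) r \<subseteq> \<psi> ` V"
    using chart_open(2)[OF c] in' open_contains_cball by blast
  show ?thesis
  proof (rule that[of "K + 1" "min r (d / 2)"])
    fix x assume "x \<in> cball (\<psi> q) (min r (d / 2))"
    then have "norm (x - \<psi> q) < d" using d(1) by (auto simp: dist_norm norm_minus_commute)
    from d(2)[OF this] have "norm (XH (V, \<psi>) x - D (x - \<psi> q)) \<le> norm (x - \<psi> q)" by (simp add: X0)
    moreover have "norm (XH (V, \<psi>) x) \<le> norm (XH (V, \<psi>) x - D (x - \<psi> q)) + norm (D (x - \<psi> q))"
      by (metis diff_add_cancel norm_triangle_ineq)
    ultimately show "norm (XH (V, \<psi>) x) \<le> (K + 1) * norm (x - \<psi> q)"
      using K(2)[of "x - \<psi> q"] by (simp add: algebra_simps)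
  qed (use K r d in auto)
qed

lemma critical_point_not_reached:
  assumes s: "sol \<gamma> {a<..<b}" and ab: "a < b" and q: "\<not> reg q"
    and cl: "\<And>S. open S \<Longrightarrow> q \<in> S \<Longrightarrow> \<exists>\<^sub>F t in at_left b. \<gamma> t \<in> S"
  shows False
proof -
  obtain V \<psi> where V: "(V, \<psi>) \<in> A" "q \<in> V" by (rule atlas_cover)
  note c = compat_atlas[OF V(1)]
  obtain K r where K: "K > 0" "r > 0" "cball (\<psi> q) r \<subseteq> \<psi> ` V"
    "\<And>x. x \<in> cball (\<psi> q) r \<Longrightarrow> norm (XH (V, \<psi>) x) \<le> K * norm (x - \<psi> q)"
    using critical_point_linear_growth[OF V q] by blast
  define O' where "O' s = {p \<in> V. \<psi> p \<in> ball (\<psi> q) s}" for s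
  have "O' s = V \<inter> \<psi> -` ball (\<psi> q) s" for s by (auto simp: O'_def)
  then have oO: "open (O' s)" for s
    using continuous_open_preimage[OF homeomorphism_cont1[OF chart_homeo[OF c]] chart_open(1)[OF c] open_ball]
    by simp
  have qO: "q \<in> O' s" if "s > 0" for s using V that by (simp add: O'_def)
  \<comment> \<open>The closed chart ball is compact, hence closed in the Hausdorff surface. So the
    curve cannot leave the open ball by jumping out of the chart: its first point outside must still
    lie in \<open>C\<close>.\<close>
  define C where "C = inv_into V \<psi> ` cball (\<psi> q) r"
  have "compact C" unfolding C_def
    using homeomorphism_cont2[OF chart_homeo[OF c]] K(3)
    by (intro compact_continuous_image) (auto intro: continuous_on_subset)
  then have clC: "closed C" by (rule compact_imp_closed)
  have C: "p \<in> V" "\<psi> p \<in> cball (\<psi> q) r" if "p \<in> C" for p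
  proof -
    obtain y where y: "y \<in> cball (\<psi> q) r" "p = inv_into V \<psi> y" using \<open>p \<in> C\<close> C_def by blast
    then have "y \<in> \<psi> ` V" using K(3) by blast
    with y show "p \<in> V" "\<psi> p \<in> cball (\<psi> q) r" by (simp_all add: inv_into_into f_inv_into_f del: mem_cball)
  qed
  have OC: "O' r \<subseteq> C"
  proof
    fix p assume "p \<in> O' r"
    then have "p = inv_into V \<psi> (\<psi> p)" "\<psi> p \<in> cball (\<psi> q) r"
      by (auto simp: O'_def chart_inv[OF c])
    then show "p \<in> C" unfolding C_def by blast
  qed
  define N where "N t = (\<psi> (\<gamma> t) - \<psi> q) \<bullet> (\<psi> (\<gamma> t) - \<psi> q)" for t
  have N: "N t = (dist (\<psi> q) (\<psi> (\<gamma> t)))\<^sup>2" for t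
    unfolding N_def power2_norm_eq_inner[symmetric] dist_norm by (simp add: norm_minus_commute)
  have N': "\<exists>D. (N has_real_derivative D) (at t) \<and> \<bar>D\<bar> \<le> 2 * K * N t" if t: "t \<in> {a<..<b}" "\<gamma> t \<in> C" for t
  proof (intro exI conjI)
    have "(\<psi> \<circ> \<gamma> has_vector_derivative XH (V, \<psi>) (\<psi> (\<gamma> t))) (at t)"
      using s t C odeD(2) V(1) unfolding sol_def by blast
    then show "(N has_real_derivative (2 * ((\<psi> (\<gamma> t) - \<psi> q) \<bullet> XH (V, \<psi>) (\<psi> (\<gamma> t))))) (at t)"
      unfolding N_def has_vector_derivative_def has_field_derivative_def o_def
      by (auto intro!: derivative_eq_intros simp: fun_eq_iff inner_commute)
    have "\<bar>(\<psi> (\<gamma> t) - \<psi> q) \<bullet> XH (V, \<psi>) (\<psi> (\<gamma> t))\<bar> \<le> norm (\<psi> (\<gamma> t) - \<psi> q) * (K * norm (\<psi> (\<gamma> t) - \<psi> q))"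
      using Cauchy_Schwarz_ineq2 K(4)[OF C(2)[OF t(2)]] by (meson mult_left_mono norm_ge_zero order_trans)
    then show "\<bar>2 * ((\<psi> (\<gamma> t) - \<psi> q) \<bullet> XH (V, \<psi>) (\<psi> (\<gamma> t)))\<bar> \<le> 2 * K * N t"
      by (simp add: N_def abs_mult power2_norm_eq_inner[symmetric] power2_eq_square mult_ac)
  qed
  \<comment> \<open>Gronwall in both directions: \<open>\<bar>N'\<bar> \<le> 2 * K * N\<close> makes
    N exp(-2Kt) nonincreasing and N exp(2Kt) nondecreasing.\<close>
  have mono: "N t2 * exp (- 2 * K * t2) \<le> N t1 * exp (- 2 * K * t1) \<and> N t1 * exp (2 * K * t1) \<le> N t2 * exp (2 * K * t2)"
    if t: "a < t1" "t1 \<le> t2" "t2 < b" and C': "\<And>t. t \<in> {t1..t2} \<Longrightarrow> \<gamma> t \<in> C" for t1 t2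
  proof
    show "N t2 * exp (- 2 * K * t2) \<le> N t1 * exp (- 2 * K * t1)"
    proof (rule DERIV_nonpos_imp_nonincreasing[OF t(2)])
      fix x assume "t1 \<le> x" "x \<le> t2"
      then obtain D where D: "(N has_real_derivative D) (at x)" "\<bar>D\<bar> \<le> 2 * K * N x"
        using N'[of x] C' t by auto
      have "((\<lambda>a. N a * exp (- 2 * K * a)) has_real_derivative (D - 2 * K * N x) * exp (- 2 * K * x)) (at x)"
        using D(1) by (auto intro!: derivative_eq_intros simp: algebra_simps)
      moreover have "(D - 2 * K * N x) * exp (- 2 * K * x) \<le> 0"
        using D(2) by (intro mult_nonpos_nonneg) auto
      ultimately show "\<exists>y. ((\<lambda>a. N a * exp (- 2 * K * a)) has_real_derivative y) (at x) \<and> y \<le> 0" by blast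
    qed
    show "N t1 * exp (2 * K * t1) \<le> N t2 * exp (2 * K * t2)"
    proof (rule DERIV_nonneg_imp_nondecreasing[OF t(2)])
      fix x assume "t1 \<le> x" "x \<le> t2"
      then obtain D where D: "(N has_real_derivative D) (at x)" "\<bar>D\<bar> \<le> 2 * K * N x"
        using N'[of x] C' t by auto
      have "((\<lambda>a. N a * exp (2 * K * a)) has_real_derivative (D + 2 * K * N x) * exp (2 * K * x)) (at x)"
        using D(1) by (auto intro!: derivative_eq_intros simp: algebra_simps)
      moreover have "(D + 2 * K * N x) * exp (2 * K * x) \<ge> 0"
        using D(2) by (intro mult_nonneg_nonneg) auto
      ultimately show "\<exists>y. ((\<lambda>a. N a * exp (2 * K * a)) has_real_derivative y) (at x) \<and> y \<ge> 0" by blast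
    qed
  qed
  \<comment> \<open>Over a time of length at most \<open>b - a\<close> the distance to
    \<open>q\<close> grows at most by the factor \<open>1 / \<tau>\<close>, so starting within
    \<open>r * \<tau>\<close> keeps the curve within \<open>r\<close> up to time
    \<open>b\<close>.\<close>
  define \<tau> where "\<tau> = exp (- K * (b - a))"
  have \<tau>: "\<tau> > 0" "\<tau>\<^sup>2 = exp (- 2 * K * (b - a))"
    by (auto simp: \<tau>_def exp_double[symmetric] mult_ac)
  have freq: "\<exists>t>t0. t < b \<and> \<gamma> t \<in> S" if "open S" "q \<in> S" "t0 < b" for S t0
  proof -
    have "\<forall>\<^sub>F t in at_left b. t0 < t \<and> t < b"
      using that(3) by (simp add: eventually_at_left_field) blast
    with cl[OF that(1,2)] have "\<exists>\<^sub>F t in at_left b. \<gamma> t \<in> S \<and> (t0 < t \<and> t < b)"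
      by (rule frequently_eventually_frequently)
    then show ?thesis using frequently_ex by blast
  qed
  obtain t1 where t1: "a < t1" "t1 < b" "\<gamma> t1 \<in> O' (r * \<tau>)"
    using freq[OF oO qO ab, of "r * \<tau>"] K(2) \<tau>(1) by auto
  have "N t1 < (r * \<tau>)\<^sup>2"
    unfolding N using t1(3) by (intro power_strict_mono) (auto simp: O'_def)
  then have "N t1 * exp (2 * K * (b - a)) < (r * \<tau>)\<^sup>2 * exp (2 * K * (b - a))"
    by (intro mult_strict_right_mono) simp_all
  also have "\<dots> = r\<^sup>2 * (\<tau>\<^sup>2 * exp (2 * K * (b - a)))" by (simp only: power_mult_distrib mult.assoc)
  also have "\<tau>\<^sup>2 * exp (2 * K * (b - a)) = 1" unfolding \<tau>(2) exp_add[symmetric] by simp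
  finally have Nt1: "N t1 * exp (2 * K * (b - a)) < r\<^sup>2" by simp
  have "r * \<tau> \<le> r" using K ab by (simp add: \<tau>_def)
  then have t1O: "\<gamma> t1 \<in> O' r" using t1(3) by (auto simp: O'_def)
  have contI: "continuous_on {a<..<b} \<gamma>"
    using s odeD(1) unfolding sol_def by (intro continuous_at_imp_continuous_on) blast
  have stay: "\<gamma> t \<in> O' r" if t: "t1 \<le> t" "t < b" for t
  proof (rule ccontr)
    assume nt: "\<gamma> t \<notin> O' r"
    \<comment> \<open>The times outside the open ball; its infimum \<open>te\<close> is the first
      exit.\<close>
    define S where "S = {t1..t} \<inter> \<gamma> -` (- O' r)"
    have "closed S" unfolding S_def
      by (intro continuous_closed_preimage continuous_on_subset[OF contI])
        (use t t1 oO in \<open>auto simp: open_closed[symmetric] closed_Compl\<close>)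
    moreover have "S \<noteq> {}" using nt t by (auto simp: S_def)
    moreover have bb: "bdd_below S" by (auto simp: S_def intro: bdd_below_Int1)
    ultimately have te: "Inf S \<in> S" by (intro closed_contains_Inf)
    define te where "te = Inf S"
    have te': "t1 \<le> te" "te \<le> t" "\<gamma> te \<notin> O' r" using te unfolding te_def[symmetric] by (auto simp: S_def)
    have before: "\<gamma> x \<in> O' r" if "t1 \<le> x" "x < te" for x
    proof (rule ccontr)
      assume "\<gamma> x \<notin> O' r"
      then have "x \<in> S" using that te' by (simp add: S_def)
      from cInf_lower[OF this bb] that show False by (simp add: te_def)
    qed
    have "te \<noteq> t1" using te' t1O by auto
    with te' have "t1 < te" by simp
    \<comment> \<open>Otherwise the open complement of \<open>C\<close> would contain the curve just
      before \<open>te\<close>, although it is then still in the ball.\<close>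
    have "\<gamma> te \<in> C"
    proof (rule ccontr)
      assume "\<gamma> te \<notin> C"
      have "isCont \<gamma> te" using s odeD(1) te' t t1 unfolding sol_def by auto
      from isCont_eventually_open[OF this open_Compl[OF clC]] \<open>\<gamma> te \<notin> C\<close>
      have "\<forall>\<^sub>F x in nhds te. \<gamma> x \<in> - C" by simp
      then have "\<forall>\<^sub>F x in at_left te. \<gamma> x \<in> - C"
        unfolding at_within_def using filter_leD inf_le1 by blast
      moreover have "\<forall>\<^sub>F x in at_left te. t1 < x \<and> x < te"
        using \<open>t1 < te\<close> by (simp add: eventually_at_left_field) blast
      ultimately have "\<forall>\<^sub>F x in at_left te. False"
        by eventually_elim (use before OC in \<open>auto dest!: before[OF less_imp_le]\<close>)
      then show False by simp
    qed
    then have "\<gamma> x \<in> C" if "x \<in> {t1..te}" for x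
      using that before[of x] OC by (cases "x = te") auto
    then have "N te * exp (- 2 * K * te) \<le> N t1 * exp (- 2 * K * t1)"
      using mono[of t1 te] te' t t1 by auto
    then have "N te \<le> N t1 * exp (- 2 * K * t1) * exp (2 * K * te)"
      by (simp add: exp_minus field_simps)
    also have "\<dots> = N t1 * exp (2 * K * (te - t1))"
      by (simp add: exp_add[symmetric] algebra_simps)
    also have "\<dots> \<le> N t1 * exp (2 * K * (b - a))"
      using K te' t t1 by (intro mult_left_mono) (auto simp: N)
    finally have "N te < r\<^sup>2" using Nt1 by simp
    then have "dist (\<psi> q) (\<psi> (\<gamma> te)) < r"
      unfolding N using K(2) power2_less_imp_less by (metis less_imp_le)
    then have "\<gamma> te \<in> O' r" using C(1)[OF \<open>\<gamma> te \<in> C\<close>] by (simp add: O'_def)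
    with te' show False by simp
  qed
  \<comment> \<open>The other Gronwall inequality keeps \<open>N\<close> above \<open>m\<close> from
    \<open>t1\<close> until \<open>b\<close>, so the curve cannot accumulate at
    \<open>q\<close>.\<close>
  define m where "m = N t1 * exp (2 * K * (a - b))"
  have "\<gamma> t1 \<in> V" "\<gamma> t1 \<noteq> q" using t1 s q unfolding O'_def sol_def by auto
  then have "\<psi> (\<gamma> t1) \<noteq> \<psi> q" using chart_inv[OF c] V(2) by metis
  then have "m > 0" by (simp add: m_def N)
  obtain t2 where t2: "t2 > t1" "t2 < b" "\<gamma> t2 \<in> O' (sqrt m)"
    using freq[OF oO qO t1(2), of "sqrt m"] \<open>m > 0\<close> by auto
  have "N t1 * exp (2 * K * t1) \<le> N t2 * exp (2 * K * t2)"
  proof -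
    have "\<gamma> t \<in> C" if "t \<in> {t1..t2}" for t using stay[of t] OC that t2 by auto
    then show ?thesis using mono[of t1 t2] t1 t2 by auto
  qed
  then have "N t1 * exp (2 * K * (t1 - t2)) \<le> N t2"
    by (simp add: exp_diff right_diff_distrib field_simps)
  moreover have "m \<le> N t1 * exp (2 * K * (t1 - t2))"
    unfolding m_def using K t1 t2 by (intro mult_left_mono) (auto simp: N)
  moreover have "N t2 < (sqrt m)\<^sup>2"
    unfolding N using t2(3) by (intro power_strict_mono) (auto simp: O'_def)
  ultimately show False using \<open>m > 0\<close> by simp
qed

text \<open>By properness the curve stays in a compact level and so clusters at some
  \<open>q\<close> as time tends to \<open>b\<close>. This \<open>q\<close> is regular, since
  critical points are not reached in finite time, and a box around \<open>q\<close> carries the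
  solution beyond \<open>b\<close>. Only a cluster point is needed, not a limit.\<close>

lemma sol_extend:
  assumes s: "sol \<gamma> {a<..<b}" and ab: "a < b"
  shows "\<exists>e>0. \<exists>\<eta>. sol \<eta> {a<..<b + e} \<and> (\<forall>t\<in>{a<..<b}. \<eta> t = \<gamma> t)"
proof -
  define h where "h = H (\<gamma> ((a + b) / 2))"
  have Hh: "H (\<gamma> t) = h" if "t \<in> {a<..<b}" for t
    unfolding h_def by (rule H_constant[of "{a<..<b}"]) (use s that ab in \<open>auto simp: sol_def\<close>)
  define F where "F = filtermap \<gamma> (at_left b)"
  have "F \<noteq> bot" by (simp add: F_def filtermap_bot_iff)
  moreover have "\<forall>\<^sub>F p in F. p \<in> H -` {h}"
    unfolding F_def eventually_filtermap eventually_at_left_field using Hh ab by auto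
  moreover have "compact (H -` {h})" using proper_H unfolding proper_fun_def by simp
  ultimately obtain q where q: "inf (nhds q) F \<noteq> bot" unfolding compact_filter by blast
  have cl: "\<exists>\<^sub>F t in at_left b. \<gamma> t \<in> S" if "open S" "q \<in> S" for S
  proof (rule ccontr)
    assume "\<not> (\<exists>\<^sub>F t in at_left b. \<gamma> t \<in> S)"
    then have "\<forall>\<^sub>F p in F. p \<notin> S" unfolding F_def eventually_filtermap frequently_def by simp
    moreover have "\<forall>\<^sub>F p in nhds q. p \<in> S" using that eventually_nhds_in_open by blast
    ultimately have "\<forall>\<^sub>F p in inf (nhds q) F. False" unfolding eventually_inf by blast
    then show False using q trivial_limit_def by blast
  qed
  have "reg q" using critical_point_not_reached[OF s ab _ cl] by blast
  from time_energy_box_exists[OF this] obtain a0 Q \<Psi> \<Theta> where B: "time_energy_box a0 (H q) Q \<Psi> \<Theta>" "\<Psi> (0, H q) = q" by blast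
  note m = time_energy_boxD[OF B(1)]
  have q0: "q \<in> Q" using m(6)[of "(0, H q)"] B(2) m(1) by simp
  then have \<Theta>q: "\<Theta> q = (0, H q)" using B(2) m(4)[of "(0, H q)"] m(1) by simp
  \<comment> \<open>The middle half of the box in time: from there the box line runs for at least
    another \<open>a0/2\<close>. The curve is in \<open>S\<close> at some \<open>t1\<close> later
    than \<open>b - a0/2\<close>, so this reaches past \<open>b\<close>.\<close>
  define S where "S = Q \<inter> \<Theta> -` ({-a0/2<..<a0/2} \<times> UNIV)"
  have "open S" unfolding S_def
    by (rule continuous_open_preimage[OF _ m(2)])
      (use m(13) in \<open>auto intro!: continuous_at_imp_continuous_on open_Times\<close>)
  moreover have "q \<in> S" using q0 \<Theta>q m(1) by (simp add: S_def)
  ultimately have "\<exists>\<^sub>F t in at_left b. \<gamma> t \<in> S" by (rule cl)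
  moreover have "\<forall>\<^sub>F t in at_left b. max a (b - a0 / 2) < t \<and> t < b"
    unfolding eventually_at_left_field using m(1) ab by (intro exI[of _ "max a (b - a0 / 2)"]) auto
  ultimately have "\<exists>\<^sub>F t in at_left b. \<gamma> t \<in> S \<and> (max a (b - a0 / 2) < t \<and> t < b)"
    by (rule frequently_eventually_frequently)
  then obtain t1 where t1: "\<gamma> t1 \<in> S" "a < t1" "b - a0 / 2 < t1" "t1 < b"
    using frequently_ex by force
  obtain u e where ue: "\<Theta> (\<gamma> t1) = (u, e)" by fastforce
  have u: "\<bar>u\<bar> < a0 / 2" "(u, e) \<in> square a0 0 (H q)" "\<Psi> (u, e) = \<gamma> t1"
  proof -
    have Q: "\<gamma> t1 \<in> Q" "\<Theta> (\<gamma> t1) \<in> {-a0/2<..<a0/2} \<times> UNIV" using t1(1) unfolding S_def by auto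
    show "\<bar>u\<bar> < a0 / 2" using Q(2) unfolding ue by auto
    show "(u, e) \<in> square a0 0 (H q)" using m(5)[OF Q(1)] unfolding ue .
    show "\<Psi> (u, e) = \<gamma> t1" using m(3)[OF Q(1)] unfolding ue .
  qed
  \<comment> \<open>The box line through \<open>\<gamma> t1\<close>, reparametrised to pass it at
    time \<open>t1\<close>.\<close>
  define \<zeta> where "\<zeta> = (\<lambda>t. \<Psi> (t + (u - t1), e))"
  have \<zeta>: "sol \<zeta> {t1 - a0/2<..<t1 + a0/2}"
  proof -
    have "sol (\<lambda>t. \<Psi> (t, e)) {-a0<..<a0}" using time_energy_box_sol[OF B(1)] u by auto
    then show ?thesis
      unfolding \<zeta>_def by (intro sol_shift, elim sol_subset) (use u(1) in \<open>auto simp: abs_less_iff\<close>)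
  qed
  define c where "c = max a (t1 - a0/2)"
  have agree: "\<gamma> t = \<zeta> t" if "t \<in> {c<..<b}" for t
  proof (rule sol_unique[of "{c<..<b}" t1])
    show "\<gamma> t1 = \<zeta> t1" using u by (simp add: \<zeta>_def)
  qed (use that t1 s \<zeta> m(1) in \<open>auto simp: c_def sol_def\<close>)
  define \<eta> where "\<eta> = (\<lambda>t. if t < b then \<gamma> t else \<zeta> t)"
  have "sol \<eta> {a<..<b}" by (rule sol_cong[OF s]) (auto simp: \<eta>_def)
  moreover have "sol \<eta> {c<..<t1 + a0/2}"
    by (rule sol_cong[of \<zeta>]) (use \<zeta> agree in \<open>auto simp: \<eta>_def sol_def c_def\<close>)
  moreover have cb: "c < b" "b < t1 + a0/2" using t1 m(1) ab by (auto simp: c_def)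
  then have "{a<..<t1 + a0/2} \<subseteq> {a<..<b} \<union> {c<..<t1 + a0/2}" by auto
  ultimately have "sol \<eta> {a<..<t1 + a0/2}" unfolding sol_def by blast
  then show ?thesis
    using cb(2) by (intro exI[of _ "t1 + a0/2 - b"] exI[of _ \<eta>]) (auto simp: \<eta>_def)
qed

text \<open>If some end time were unattainable, the solutions up to times below the supremum would
  glue to one up to the supremum, and extending that one contradicts the choice of the supremum. The
  margin \<open>a\<close> to the left of 0 is kept for joining with a backward solution.\<close>

lemma forward_solution:
  assumes p: "reg p"
  obtains \<gamma> a where "a > 0" "sol \<gamma> {-a<..}" "\<gamma> 0 = p"
proof -
  obtain a Q \<Psi> \<Theta> where B: "time_energy_box a (H p) Q \<Psi> \<Theta>" "\<Psi> (0, H p) = p" using time_energy_box_exists[OF p] by blast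
  note a = time_energy_boxD(1)[OF B(1)]
  define E where "E b \<longleftrightarrow> (\<exists>\<gamma>. sol \<gamma> {-a<..<b} \<and> \<gamma> 0 = p)" for b
  have mono: "E b'" if E: "E b" "b' \<le> b" for b b'
  proof -
    obtain \<gamma> where "sol \<gamma> {-a<..<b}" "\<gamma> 0 = p" using E(1) unfolding E_def by blast
    then have "sol \<gamma> {-a<..<b'} \<and> \<gamma> 0 = p" using E(2) unfolding sol_def by simp
    then show ?thesis unfolding E_def by blast
  qed
  have "E a" unfolding E_def using time_energy_box_sol[OF B(1), of "H p"] a B(2) by (intro exI[of _ "\<lambda>t. \<Psi> (t, H p)"]) auto
  have all: "E b" for b
  proof (rule ccontr)
    assume "\<not> E b"
    then have bd: "x \<le> b" if "E x" for x using mono[OF that, of b] by (cases "b \<le> x") auto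
    then have bdd: "bdd_above {x. E x}" unfolding bdd_above_def by blast
    define s where "s = Sup {x. E x}"
    have "a \<le> s" unfolding s_def using cSup_upper[OF _ bdd] \<open>E a\<close> by blast
    then have s0: "s > 0" using a by simp
    have below: "E x" if xs: "x < s" for x
    proof -
      obtain y where "E y" "x < y"
        using xs less_cSup_iff[of "{x. E x}" x] \<open>E a\<close> bdd unfolding s_def by blast
      then show ?thesis using mono by force
    qed
    \<comment> \<open>The offset 2 makes the right end of \<open>I 0\<close> equal to
      \<open>s / 2\<close>, so that 0 lies in every \<open>I n\<close>.\<close>
    define I where "I n = {-a<..<s - s / (real n + 2)}" for n :: nat
    have "\<exists>\<gamma>. sol \<gamma> (\<Union>n. I n) \<and> \<gamma> 0 = p"
    proof (rule sol_glue)
      show "open (I n)" "is_interval (I n)" for n by (simp_all add: I_def)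
      show "0 \<in> I n" for n using s0 a by (simp add: I_def field_simps add_pos_nonneg)
      show "I n \<subseteq> I (Suc n)" for n
      proof -
        have "s / (real (Suc n) + 2) \<le> s / (real n + 2)" using s0 by (intro divide_left_mono) auto
        then show ?thesis unfolding I_def by auto
      qed
      show "\<exists>\<gamma>. sol \<gamma> (I n) \<and> \<gamma> 0 = p" for n
        using below[of "s - s / (real n + 2)"] s0 unfolding E_def I_def by simp
    qed
    moreover have "(\<Union>n. I n) = {-a<..<s}"
    proof (intro equalityI subsetI)
      fix x assume x: "x \<in> {-a<..<s}"
      obtain n :: nat where "s / (s - x) < real n" using reals_Archimedean2 by blast
      then have "s / (s - x) < real n + 2" by simp
      then have "s / (real n + 2) < s - x" using x by (simp add: field_simps)
      then show "x \<in> (\<Union>n. I n)" using x by (auto simp: I_def intro!: exI[of _ n])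
    next
      fix x assume "x \<in> (\<Union>n. I n)"
      then obtain n where "x \<in> I n" by blast
      moreover have "s / (real n + 2) > 0" using s0 by simp
      ultimately show "x \<in> {-a<..<s}" by (simp add: I_def)
    qed
    ultimately obtain \<gamma> where \<gamma>: "sol \<gamma> {-a<..<s}" "\<gamma> 0 = p" by auto
    from sol_extend[OF this(1)] s0 a obtain e \<eta> where e: "e > 0" "sol \<eta> {-a<..<s + e}"
      "\<forall>t\<in>{-a<..<s}. \<eta> t = \<gamma> t" by auto
    then have "E (s + e)" unfolding E_def using \<gamma>(2) s0 a by (intro exI[of _ \<eta>]) auto
    then have "s + e \<le> s" unfolding s_def using cSup_upper[OF _ bdd] by blast
    then show False using e(1) by simp
  qed
  have "\<exists>\<gamma>. sol \<gamma> (\<Union>n. {-a<..<real n + 1}) \<and> \<gamma> 0 = p"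
    by (rule sol_glue) (use a all in \<open>auto simp: E_def\<close>)
  moreover have "(\<Union>n. {-a<..<real n + 1}) = {-a<..}"
  proof (intro equalityI subsetI)
    fix x assume x: "x \<in> {-a<..}"
    obtain n :: nat where "x < real n" using reals_Archimedean2 by blast
    then show "x \<in> (\<Union>n. {-a<..<real n + 1})" using x by (auto intro!: exI[of _ n])
  qed auto
  ultimately show ?thesis using that a by auto
qed

text \<open>Negating the area form negates the Hamiltonian field, so every result for forward time
  holds for backward time by instantiating the locale with \<open>- w\<close>.\<close>

lemma reversed: "hamiltonian_surface A (\<lambda>C q. - w C q) H"
proof
  show "symplectic_form A (\<lambda>C q. - w C q)"
    unfolding symplectic_form_def case_prod_beta prod.collapse
  proof (intro conjI ballI)
    fix C assume "C \<in> A"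
    have "smooth_on (snd C ` fst C) (w C)"
      using sympl \<open>C \<in> A\<close> unfolding symplectic_form_def case_prod_beta prod.collapse by blast
    then show "smooth_on (snd C ` fst C) (\<lambda>q. - w C q)" using Ck_on_uminus unfolding smooth_on_def by blast
    show "- w C q \<noteq> 0" if "q \<in> snd C ` fst C" for q
      using sympl \<open>C \<in> A\<close> that unfolding symplectic_form_def case_prod_beta prod.collapse by auto
  next
    fix C D p assume *: "C \<in> A" "D \<in> A" "p \<in> fst C \<inter> fst D"
    have "\<forall>C\<in>A. \<forall>D\<in>A. \<forall>p\<in>fst C \<inter> fst D.
        w C (snd C p) = w D (snd D p) * jac_det (snd D \<circ> inv_into (fst C) (snd C)) (snd C p)"
      using sympl unfolding symplectic_form_def case_prod_beta prod.collapse by (rule conjunct2)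
    from bspec[OF bspec[OF bspec[OF this *(1)] *(2)] *(3)]
    show "- w C (snd C p) = - w D (snd D p) * jac_det (snd D \<circ> inv_into (fst C) (snd C)) (snd C p)"
      by (simp only: mult_minus_left)
  qed
qed (rule atlas smooth_H proper_H)+

lemma ham_vec_reversed: "ham_vec (\<lambda>C q. - w C q) H C q = - XH C q"
  by (simp add: ham_vec_def)

text \<open>A forward solution for the negated form, run backwards, covers the negative times. The
  two halves overlap in \<open>{-a<..<b}\<close>, where uniqueness makes them coincide, so no
  smoothness question arises at the joint.\<close>

lemma global_solution:
  assumes p: "reg p"
  shows "\<exists>\<gamma>. sol \<gamma> UNIV \<and> \<gamma> 0 = p"
proof -
  interpret rev: hamiltonian_surface A "\<lambda>C q. - w C q" H by (rule reversed)
  have rreg: "rev.reg q = reg q" for q unfolding rev.reg_def reg_def ham_vec_reversed by simp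
  have rode: "ode (\<lambda>s. \<gamma> (- s)) t" if "rev.ode \<gamma> (- t)" for \<gamma> t
  proof -
    obtain V \<psi> where V: "(V, \<psi>) \<in> A" "\<gamma> (- t) \<in> V" by (rule atlas_cover)
    show ?thesis
    proof (rule odeI[where V = V and \<psi> = \<psi>, OF _ V(1)])
      show "isCont (\<lambda>s. \<gamma> (- s)) t" using rev.odeD(1)[OF that] by (intro isCont_o2[of t uminus \<gamma>]) auto
      have "(uminus has_vector_derivative - 1) (at t)" by (auto intro!: derivative_eq_intros)
      from vector_diff_chain_at[OF this rev.odeD(2)[OF that V]]
      show "(\<psi> \<circ> (\<lambda>s. \<gamma> (- s)) has_vector_derivative XH (V, \<psi>) (\<psi> (\<gamma> (- t)))) (at t)"
        by (simp add: o_def ham_vec_reversed)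
    qed (rule V)
  qed
  obtain \<gamma>1 a where 1: "a > 0" "sol \<gamma>1 {-a<..}" "\<gamma>1 0 = p" using forward_solution[OF p] by blast
  obtain \<gamma>2 b where 2: "b > 0" "rev.sol \<gamma>2 {-b<..}" "\<gamma>2 0 = p" using rev.forward_solution p rreg by blast
  have 3: "sol (\<lambda>s. \<gamma>2 (- s)) {..<b}"
    using 2(2) rode rreg unfolding rev.sol_def sol_def by auto
  have agree: "\<gamma>1 t = \<gamma>2 (- t)" if "t \<in> {-a<..<b}" for t
  proof (rule sol_unique[of "{-a<..<b}" 0 t \<gamma>1 "\<lambda>s. \<gamma>2 (- s)"])
    show "sol \<gamma>1 {-a<..<b}" "sol (\<lambda>s. \<gamma>2 (- s)) {-a<..<b}" using 1 3 unfolding sol_def by auto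
  qed (use that 1 2 in auto)
  define \<gamma> where "\<gamma> t = (if t < 0 then \<gamma>2 (- t) else \<gamma>1 t)" for t
  have "sol \<gamma> {-a<..}" by (rule sol_cong[OF 1(2)]) (use agree 2 in \<open>auto simp: \<gamma>_def\<close>)
  moreover have "sol \<gamma> {..<b}" by (rule sol_cong[OF 3]) (use agree 1 in \<open>auto simp: \<gamma>_def\<close>)
  moreover have "{-a<..} \<union> {..<b} = UNIV" using 1(1) 2(1) by auto
  ultimately have "sol \<gamma> UNIV" unfolding sol_def by blast
  then show ?thesis using 1(3) by (intro exI[of _ \<gamma>]) (simp add: \<gamma>_def)
qed

section \<open>The flow and its periodic orbits\<close>

text \<open>Meaningful for regular points only.\<close>

definition flow :: "real \<Rightarrow> 'a \<Rightarrow> 'a" where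
  "flow t p = (SOME \<gamma>. sol \<gamma> UNIV \<and> \<gamma> 0 = p) t"

lemma flow_sol: "reg p \<Longrightarrow> sol (\<lambda>t. flow t p) UNIV"
  and flow_0 [simp]: "reg p \<Longrightarrow> flow 0 p = p"
proof -
  assume "reg p"
  from someI_ex[OF global_solution[OF this]]
  show "sol (\<lambda>t. flow t p) UNIV" "flow 0 p = p"
    by (simp_all add: flow_def[abs_def])
qed

lemma flow_reg: "reg p \<Longrightarrow> reg (flow t p)"
  using flow_sol unfolding sol_def by blast

lemma flow_ode: "reg p \<Longrightarrow> ode (\<lambda>t. flow t p) t"
  using flow_sol unfolding sol_def by blast

lemma flow_isCont_time: "reg p \<Longrightarrow> isCont (\<lambda>t. flow t p) t"
  by (rule odeD(1)[OF flow_ode])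

lemma flow_H: "reg p \<Longrightarrow> H (flow t p) = H p"
  using H_constant[of UNIV "\<lambda>t. flow t p" t 0] flow_ode by simp

lemma flow_add: "reg p \<Longrightarrow> flow (s + t) p = flow s (flow t p)"
proof -
  assume p: "reg p"
  show ?thesis
  proof (rule sol_unique[of UNIV 0 s "\<lambda>s. flow (s + t) p"])
    show "sol (\<lambda>s. flow (s + t) p) UNIV"
      using sol_shift[of "\<lambda>t. flow t p" t UNIV] flow_sol[OF p] by (simp add: surj_plus)
    show "sol (\<lambda>s. flow s (flow t p)) UNIV" by (rule flow_sol[OF flow_reg[OF p]])
  qed (use p flow_reg in auto)
qed

lemma flow_minus [simp]: "reg p \<Longrightarrow> flow (- t) (flow t p) = p" "reg p \<Longrightarrow> flow t (flow (- t) p) = p"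
  using flow_add[of p "- t" t] flow_add[of p t "- t"] by simp_all

lemma flow_time_energy_box:
  assumes B: "time_energy_box a e0 Q \<Psi> \<Theta>" and u: "(u, e) \<in> square a 0 e0" "(u + t, e) \<in> square a 0 e0"
  shows "flow t (\<Psi> (u, e)) = \<Psi> (u + t, e)"
proof -
  have r: "reg (\<Psi> (u, e))" using time_energy_boxD(6,7)[OF B] u by blast
  let ?I = "{- a - u<..<a - u}"
  have "sol (\<lambda>s. \<Psi> (s + u, e)) ?I"
    by (rule sol_shift, rule sol_subset[OF time_energy_box_sol[OF B]]) (use u in auto)
  moreover have "sol (\<lambda>t. flow t (\<Psi> (u, e))) ?I" by (rule sol_subset[OF flow_sol[OF r]]) simp
  ultimately show ?thesis
    using sol_unique[of ?I 0 t "\<lambda>t. flow t (\<Psi> (u, e))" "\<lambda>s. \<Psi> (s + u, e)"] u r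
    by (auto simp: add.commute)
qed

text \<open>Each level meets a box in a single flow line, traversed at unit speed. All return times
  below are corrected by this formula.\<close>

lemma time_energy_box_same_level:
  assumes B: "time_energy_box a e0 Q \<Psi> \<Theta>" and pq: "p \<in> Q" "q \<in> Q" "H p = H q"
  shows "q = flow (fst (\<Theta> q) - fst (\<Theta> p)) p"
proof -
  note m = time_energy_boxD[OF B]
  have e: "snd (\<Theta> p) = H p" "snd (\<Theta> q) = H p" using m(8) pq by auto
  have "flow (fst (\<Theta> q) - fst (\<Theta> p)) (\<Psi> (fst (\<Theta> p), H p)) = \<Psi> (fst (\<Theta> p) + (fst (\<Theta> q) - fst (\<Theta> p)), H p)"
    using m(5)[OF pq(1)] m(5)[OF pq(2)] e
    by (intro flow_time_energy_box[OF B]) (metis prod.collapse, simp add: mem_Times_iff)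
  then show ?thesis using m(3) pq e by (metis add.commute diff_add_cancel prod.collapse)
qed

lemma open_reg: "open {p. reg p}"
proof (subst open_subopen, intro ballI)
  fix p assume "p \<in> {p. reg p}"
  then obtain a Q \<Psi> \<Theta> where B: "time_energy_box a (H p) Q \<Psi> \<Theta>" "\<Psi> (0, H p) = p" using time_energy_box_exists by blast
  note m = time_energy_boxD[OF B(1)]
  show "\<exists>T. open T \<and> p \<in> T \<and> T \<subseteq> {p. reg p}"
    using m(2,7) m(6)[of "(0, H p)"] m(1) B(2) by (intro exI[of _ Q]) auto
qed

lemma eventually_reg: "reg p \<Longrightarrow> \<forall>\<^sub>F q in nhds p. reg q"
  using eventually_nhds_in_open[OF open_reg, of p] by simp

section \<open>Continuity and differentiability of the flow in the initial point\<close>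

lemma mdiff_compose2:
  assumes "mdiff f p" "mdiff g p" "F differentiable (at (f p, g p))"
  shows "mdiff (\<lambda>q. F (f q, g q)) p"
proof -
  obtain V \<psi> where V: "(V, \<psi>) \<in> A" "p \<in> V" by (rule atlas_cover)
  note c = compat_atlas[OF V(1)]
  obtain f' g' where "(f \<circ> inv_into V \<psi> has_derivative f') (at (\<psi> p))" "(g \<circ> inv_into V \<psi> has_derivative g') (at (\<psi> p))"
    using mdiffD[OF assms(1) c V(2)] mdiffD[OF assms(2) c V(2)] unfolding differentiable_def by blast
  from has_derivative_Pair[OF this]
  have 1: "(\<lambda>y. (f (inv_into V \<psi> y), g (inv_into V \<psi> y))) differentiable (at (\<psi> p))"
    unfolding differentiable_def o_def by blast
  have "(F \<circ> (\<lambda>y. (f (inv_into V \<psi> y), g (inv_into V \<psi> y)))) differentiable (at (\<psi> p))"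
    using assms(3) by (intro differentiable_chain_at[OF 1]) (simp add: chart_inv[OF c V(2)])
  then show ?thesis using V unfolding mdiff_def o_def by blast
qed

text \<open>Differentiability of a self-map of the surface, tested on real functions; this composes
  without choosing charts at source and target.\<close>

definition pulls_back :: "('a \<Rightarrow> 'a) \<Rightarrow> 'a \<Rightarrow> bool" where
  "pulls_back g p \<longleftrightarrow> isCont g p \<and> (\<forall>f. mdiff f (g p) \<longrightarrow> mdiff (f \<circ> g) p)"

lemma pulls_back_compose: "pulls_back g p \<Longrightarrow> pulls_back k (g p) \<Longrightarrow> pulls_back (k \<circ> g) p"
  unfolding pulls_back_def by (auto simp: o_assoc[symmetric] intro: continuous_at_compose)

lemma pulls_back_cong:
  assumes "pulls_back g p" "open S" "p \<in> S" "\<And>q. q \<in> S \<Longrightarrow> g q = k q"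
  shows "pulls_back k p"
proof -
  have "\<forall>\<^sub>F q in nhds p. g q = k q"
    using eventually_nhds_in_open[OF assms(2,3)] by eventually_elim (rule assms(4))
  then have "isCont k p" using assms(1) isCont_cong unfolding pulls_back_def by blast
  moreover have "mdiff (f \<circ> k) p" if "mdiff f (k p)" for f
  proof (rule mdiff_cong[OF _ assms(2,3)])
    show "mdiff (f \<circ> g) p" using that assms unfolding pulls_back_def by metis
  qed (use assms(4) in auto)
  ultimately show ?thesis unfolding pulls_back_def by blast
qed

text \<open>In box coordinates the flow is a translation in time. The set \<open>S\<close> is the
  middle half of a box, so that times up to half the width do not leave it.\<close>

lemma flow_local:
  assumes p: "reg p"
  obtains e S where "e > 0" "open S" "p \<in> S"
    "\<And>u q. \<bar>u\<bar> < e \<Longrightarrow> q \<in> S \<Longrightarrow> isCont (\<lambda>z. flow (fst z) (snd z)) (u, q) \<and> pulls_back (flow u) q"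
proof -
  obtain a Q \<Psi> \<Theta> where B: "time_energy_box a (H p) Q \<Psi> \<Theta>" "\<Psi> (0, H p) = p" using time_energy_box_exists[OF p] by blast
  note m = time_energy_boxD[OF B(1)]
  define S where "S = Q \<inter> \<Theta> -` ({-a/2<..<a/2} \<times> UNIV)"
  have oS: "open S" unfolding S_def
    by (rule continuous_open_preimage[OF _ m(2)])
      (use m(13) in \<open>auto intro!: continuous_at_imp_continuous_on open_Times\<close>)
  have "p \<in> S" using m(1) m(4,6)[of "(0, H p)"] B(2) by (simp add: S_def)
  have fl: "flow s q = \<Psi> (fst (\<Theta> q) + s, snd (\<Theta> q))" "(fst (\<Theta> q) + s, snd (\<Theta> q)) \<in> square a 0 (H p)"
    if "\<bar>s\<bar> < a/2" "q \<in> S" for s q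
  proof -
    obtain u e where ue: "\<Theta> q = (u, e)" by fastforce
    have "q \<in> Q" "\<Theta> q \<in> {-a/2<..<a/2} \<times> UNIV" using that(2) by (auto simp: S_def)
    then have 1: "q = \<Psi> (u, e)" "(u, e) \<in> square a 0 (H p)" "\<bar>u\<bar> < a/2"
      using m(3,5)[of q] ue by auto
    show 2: "(fst (\<Theta> q) + s, snd (\<Theta> q)) \<in> square a 0 (H p)"
      using 1(2,3) that(1) unfolding ue by auto
    show "flow s q = \<Psi> (fst (\<Theta> q) + s, snd (\<Theta> q))"
      using flow_time_energy_box[OF B(1) 1(2), of s] 2 unfolding 1(1)[symmetric] ue fst_conv snd_conv by blast
  qed
  show ?thesis
  proof (rule that[OF _ oS \<open>p \<in> S\<close>, of "a/2"])
    show "a/2 > 0" using m(1) by simp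
    fix u q assume u: "\<bar>u\<bar> < a/2" and q: "q \<in> S"
    have qQ: "q \<in> Q" using q by (simp add: S_def)
    define G where "G = (\<lambda>z. (fst (\<Theta> (snd z)) + fst z, snd (\<Theta> (snd z))))"
    have "isCont (\<lambda>z. \<Theta> (snd z)) (u, q)" using m(13)[OF qQ] by (intro isCont_o2[of _ snd \<Theta>]) (auto intro: continuous_intros)
    then have "isCont G (u, q)" unfolding G_def by (intro continuous_intros)
    then have "isCont (\<lambda>z. \<Psi> (G z)) (u, q)"
      using fl(2)[OF u q] m(12) by (intro isCont_o2[of _ G \<Psi>]) (simp_all add: G_def)
    moreover have "\<forall>\<^sub>F z in nhds (u, q). \<Psi> (G z) = flow (fst z) (snd z)"
    proof -
      have "\<forall>\<^sub>F z in nhds (u, q). z \<in> {-a/2<..<a/2} \<times> S"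
        using u q oS by (intro eventually_nhds_in_open open_Times) auto
      then show ?thesis by eventually_elim (use fl(1) in \<open>auto simp: G_def\<close>)
    qed
    ultimately have 1: "isCont (\<lambda>z. flow (fst z) (snd z)) (u, q)" by (simp only: isCont_cong)
    have "isCont (\<lambda>q. (u, q)) q" by (intro continuous_intros)
    from isCont_o2[OF this 1] have c: "isCont (flow u) q" by simp
    have "mdiff (f \<circ> flow u) q" if f: "mdiff f (flow u q)" for f
    proof (rule mdiff_cong[OF _ oS q])
      have d: "(f \<circ> \<Psi>) differentiable (at (fst (\<Theta> q) + u, snd (\<Theta> q)))"
        using m(11)[OF fl(2)[OF u q]] f fl(1)[OF u q] by simp
      define F where "F = (\<lambda>z. (f \<circ> \<Psi>) (fst z + u, snd z))"
      have "((\<lambda>z. (fst z + u, snd z)) has_derivative (\<lambda>z. z)) (at (fst (\<Theta> q), H q))"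
        by (auto intro!: derivative_eq_intros)
      then have "(\<lambda>z. (fst z + u, snd z)) differentiable (at (fst (\<Theta> q), H q))"
        unfolding differentiable_def by blast
      from differentiable_chain_at[OF this, of "f \<circ> \<Psi>"] d m(8)[OF qQ]
      have "F differentiable (at ((fst \<circ> \<Theta>) q, H q))" unfolding F_def by (simp add: o_def)
      from mdiff_compose2[OF m(9)[OF qQ] mdiff_H this]
      show "mdiff (\<lambda>q. F ((fst \<circ> \<Theta>) q, H q)) q" .
      show "F ((fst \<circ> \<Theta>) q, H q) = (f \<circ> flow u) q" if "q \<in> S" for q
        using fl(1)[OF u that] m(8)[of q] that by (simp add: F_def S_def)
    qed
    with c 1 show "isCont (\<lambda>z. flow (fst z) (snd z)) (u, q) \<and> pulls_back (flow u) q"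
      unfolding pulls_back_def by blast
  qed
qed

text \<open>By the group law \<open>flow s\<close> is \<open>flow t\<close> followed by a short
  flow, and conversely. Near \<open>flow t p\<close> short flows are differentiable, so the good
  times form a set that is open and closed.\<close>

lemma flow_pulls_back:
  assumes p: "reg p"
  shows "pulls_back (flow t) p"
proof (rule real_interval_induction[of UNIV 0 t "\<lambda>t. pulls_back (flow t) p"])
  show "pulls_back (flow 0) p" using flow_local[OF p] by (metis abs_zero)
  have comp: "pulls_back (flow s) p" if "pulls_back (flow t) p" "pulls_back (flow (s - t)) (flow t p)" for s t
  proof (rule pulls_back_cong[OF pulls_back_compose[OF that] open_reg])
    show "(flow (s - t) \<circ> flow t) q = flow s q" if "q \<in> {p. reg p}" for q
      using flow_add[of q "s - t" t] that by simp
  qed (use p in simp)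
  fix t :: real
  obtain e S where S: "e > 0" "open S" "flow t p \<in> S" "\<And>u q. \<bar>u\<bar> < e \<Longrightarrow> q \<in> S \<Longrightarrow> pulls_back (flow u) q"
    using flow_local[OF flow_reg[OF p, of t]] by metis
  have "\<forall>\<^sub>F s in nhds t. s \<in> {t - e<..<t + e}"
    using S(1) by (intro eventually_nhds_in_open) auto
  moreover have "\<forall>\<^sub>F s in nhds t. flow s p \<in> S"
    by (rule isCont_eventually_open[OF flow_isCont_time[OF p] S(2,3)])
  ultimately have ev: "\<forall>\<^sub>F s in nhds t. pulls_back (flow s) p = pulls_back (flow t) p"
  proof eventually_elim
    fix s assume s: "s \<in> {t - e<..<t + e}" "flow s p \<in> S"
    have "pulls_back (flow (s - t)) (flow t p)" "pulls_back (flow (t - s)) (flow s p)"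
      using S(3,4) s by (auto simp: abs_less_iff)
    then show "pulls_back (flow s) p = pulls_back (flow t) p" using comp by blast
  qed
  then show "(\<forall>\<^sub>F s in nhds t. s \<in> UNIV \<longrightarrow> pulls_back (flow s) p) \<or> (\<forall>\<^sub>F s in nhds t. s \<in> UNIV \<longrightarrow> \<not> pulls_back (flow s) p)"
    by (cases "pulls_back (flow t) p") (auto elim: eventually_mono)
qed auto

lemma flow_isCont: "reg p \<Longrightarrow> isCont (flow t) p"
  using flow_pulls_back unfolding pulls_back_def by blast

lemma flow_mdiff: "reg p \<Longrightarrow> mdiff f (flow t p) \<Longrightarrow> mdiff (f \<circ> flow t) p"
  using flow_pulls_back unfolding pulls_back_def by blast

text \<open>Writing \<open>flow s q = flow (s - t) (flow t q)\<close> reduces joint continuity to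
  time 0, where a box gives it, and to continuity in \<open>q\<close> alone.\<close>

lemma flow_joint_isCont:
  assumes p: "reg p"
  shows "isCont (\<lambda>z. flow (fst z) (snd z)) (t, p)"
proof -
  have 1: "isCont (\<lambda>z. flow (fst z) (snd z)) (0, flow t p)"
    using flow_local[OF flow_reg[OF p, of t]] by (metis abs_zero)
  have "isCont (\<lambda>z. flow t (snd z)) (t, p)"
    using flow_isCont[OF p] by (intro isCont_o2[of _ snd "flow t"]) (auto intro: continuous_intros)
  then have "isCont (\<lambda>z. (fst z - t, flow t (snd z))) (t, p)" by (intro continuous_intros)
  from isCont_o2[OF this, of "\<lambda>z. flow (fst z) (snd z)"] 1
  have "isCont (\<lambda>z. flow (fst z - t) (flow t (snd z))) (t, p)" by simp
  moreover have "\<forall>\<^sub>F z in nhds (t, p). flow (fst z - t) (flow t (snd z)) = flow (fst z) (snd z)"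
  proof -
    have "\<forall>\<^sub>F z in nhds (t, p). z \<in> UNIV \<times> {p. reg p}"
      using p open_reg by (intro eventually_nhds_in_open open_Times) auto
    then show ?thesis
    proof eventually_elim
      fix z :: "real \<times> 'a" assume "z \<in> UNIV \<times> {p. reg p}"
      then show "flow (fst z - t) (flow t (snd z)) = flow (fst z) (snd z)"
        using flow_add[of "snd z" "fst z - t" t] by (simp add: mem_Times_iff)
    qed
  qed
  ultimately show ?thesis by (simp only: isCont_cong)
qed

text \<open>Inside a box two points of equal energy lie on one flow line, so being on the orbit of
  \<open>p\<close> is a locally constant property along \<open>C\<close>.\<close>

lemma connected_level_in_orbit:
  assumes C: "connected C" "\<And>x. x \<in> C \<Longrightarrow> reg x \<and> H x = h" and pq: "p \<in> C" "q \<in> C"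
  shows "\<exists>t. q = flow t p"
proof (rule connected_induction_simple[OF C(1) pq])
  show "\<exists>t. p = flow t p" using C(2)[OF pq(1)] flow_0 by metis
  fix a assume a: "a \<in> C"
  obtain d Q \<Psi> \<Theta> where B: "time_energy_box d (H a) Q \<Psi> \<Theta>" "\<Psi> (0, H a) = a" using time_energy_box_exists C(2)[OF a] by blast
  note m = time_energy_boxD[OF B(1)]
  have "a \<in> Q" using m(6)[of "(0, H a)"] B(2) m(1) by simp
  show "\<exists>T. openin (top_of_set C) T \<and> a \<in> T \<and> (\<forall>x\<in>T. \<forall>y\<in>T. (\<exists>t. x = flow t p) \<longrightarrow> (\<exists>t. y = flow t p))"
  proof (intro exI[of _ "C \<inter> Q"] conjI ballI impI)
    fix x y assume xy: "x \<in> C \<inter> Q" "y \<in> C \<inter> Q" "\<exists>t. x = flow t p"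
    then have "y = flow (fst (\<Theta> y) - fst (\<Theta> x)) x" using C(2) by (intro time_energy_box_same_level[OF B(1)]) auto
    then show "\<exists>t. y = flow t p" using xy(3) flow_add C(2)[OF pq(1)] by metis
  qed (use a \<open>a \<in> Q\<close> m(2) in \<open>auto simp: openin_open\<close>)
qed

text \<open>The time coordinate of a box is injective along a flow line. The bound \<open>a\<close>
  is uniform for starting points near \<open>p\<close>, as needed for comparing minimal periods of
  neighbouring orbits.\<close>

lemma no_early_return:
  assumes p: "reg p"
  obtains a S where "a > 0" "open S" "p \<in> S" "\<forall>q\<in>S. \<forall>t. 0 < t \<and> t < a \<longrightarrow> flow t q \<noteq> q"
proof -
  obtain a Q \<Psi> \<Theta> where B: "time_energy_box a (H p) Q \<Psi> \<Theta>" "\<Psi> (0, H p) = p" using time_energy_box_exists[OF p] by blast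
  note m = time_energy_boxD[OF B(1)]
  define S where "S = Q \<inter> \<Theta> -` ({-a/2<..<a/2} \<times> UNIV)"
  have oS: "open S" unfolding S_def
    by (rule continuous_open_preimage[OF _ m(2)])
      (use m(13) in \<open>auto intro!: continuous_at_imp_continuous_on open_Times\<close>)
  have pS: "p \<in> S" using m(1) m(4,6)[of "(0, H p)"] B(2) by (simp add: S_def)
  show ?thesis
  proof (rule that[OF _ oS pS, of "a/2"])
    have "flow t q \<noteq> q" if q: "q \<in> S" and t: "0 < t" "t < a/2" for q t
    proof -
    obtain u e where ue: "\<Theta> q = (u, e)" by fastforce
    have "q \<in> Q" "\<Theta> q \<in> {-a/2<..<a/2} \<times> UNIV" using q by (auto simp: S_def)
    then have 1: "q = \<Psi> (u, e)" "(u, e) \<in> square a 0 (H p)" "\<bar>u\<bar> < a/2"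
      using m(3,5)[of q] ue by auto
    then have 2: "(u + t, e) \<in> square a 0 (H p)" using t by auto
    show "flow t q \<noteq> q"
      using flow_time_energy_box[OF B(1) 1(2) 2] m(4)[OF 2] m(4)[OF 1(2)] 1(1) t(1) by auto
    qed
    then show "\<forall>q\<in>S. \<forall>t. 0 < t \<and> t < a/2 \<longrightarrow> flow t q \<noteq> q" by blast
  qed (use m(1) in simp)
qed

section \<open>Minimal periods and their dependence on the energy\<close>

definition minper :: "'a \<Rightarrow> real" where
  "minper p = Inf {t. t > 0 \<and> flow t p = p}"

definition periodic :: "'a \<Rightarrow> bool" where
  "periodic p \<longleftrightarrow> reg p \<and> (\<exists>t>0. flow t p = p)"

lemma minper:
  assumes "periodic p"
  shows "minper p > 0" "flow (minper p) p = p" "\<And>t. 0 < t \<Longrightarrow> flow t p = p \<Longrightarrow> minper p \<le> t"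
proof -
  have p: "reg p" using assms periodic_def by blast
  obtain a S where a: "a > 0" "open S" "p \<in> S" "\<forall>q\<in>S. \<forall>t. 0 < t \<and> t < a \<longrightarrow> flow t q \<noteq> q"
    by (rule no_early_return[OF p])
  define Z where "Z = {t. t > 0 \<and> flow t p = p}"
  \<comment> \<open>Return times stay away from 0, which makes the set of positive return times
    closed; hence its infimum is attained.\<close>
  have Z: "Z = {a..} \<inter> {t. flow t p = p}"
  proof (intro set_eqI)
    fix t show "t \<in> Z \<longleftrightarrow> t \<in> {a..} \<inter> {t. flow t p = p}"
      using a(1) bspec[OF a(4,3)] unfolding Z_def by (cases "t < a") auto
  qed
  have "closed {t. flow t p = p}"
    by (rule closed_Collect_eq)
      (use flow_isCont_time[OF p] in \<open>auto intro: continuous_at_imp_continuous_on\<close>)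
  then have "closed Z" unfolding Z by blast
  moreover have "Z \<noteq> {}" using assms unfolding periodic_def Z_def by blast
  moreover have bd: "bdd_below Z" by (auto simp: Z_def intro!: bdd_belowI[of _ 0])
  ultimately have "Inf Z \<in> Z" by (intro closed_contains_Inf)
  then show "minper p > 0" "flow (minper p) p = p" unfolding minper_def Z_def by auto
  show "minper p \<le> t" if "0 < t" "flow t p = p" for t
    unfolding minper_def using cInf_lower[OF _ bd, of t] that unfolding Z_def by simp
qed

lemma flow_multiple:
  assumes "reg p" "flow T p = p"
  shows "flow (real n * T) p = p"
proof (induction n)
  case (Suc n)
  have "flow (real (Suc n) * T) p = flow T (flow (real n * T) p)"
    using flow_add[OF assms(1), of T "real n * T"] by (simp add: algebra_simps)
  with Suc assms show ?case by simp
qed (use assms in simp)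

text \<open>Division with remainder: the remainder is a return time smaller than the minimal period,
  so it vanishes.\<close>

lemma period_multiple:
  assumes p: "periodic p" and T: "T > 0" "flow T p = p"
  obtains n where "T = real n * minper p"
proof -
  note m = minper[OF p]
  have r: "reg p" using p periodic_def by blast
  define n where "n = nat \<lfloor>T / minper p\<rfloor>"
  have "real n = of_int \<lfloor>T / minper p\<rfloor>" using T m(1) by (simp add: n_def)
  then have "real n \<le> T / minper p" "T / minper p < real n + 1" by linarith+
  then have n: "real n * minper p \<le> T" "T < (real n + 1) * minper p"
    using m(1) by (simp_all only: pos_le_divide_eq pos_divide_less_eq)
  have "flow (T - real n * minper p) p = p"
    using flow_add[OF r, of "T - real n * minper p" "real n * minper p"] T flow_multiple[OF r m(2)] by simp
  then have "T - real n * minper p = 0"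
    using m(3)[of "T - real n * minper p"] n by (fastforce simp: algebra_simps)
  then show ?thesis by (intro that[of n]) simp
qed

lemma is_period_flow: "reg p \<Longrightarrow> is_period (\<lambda>t. flow t p) T \<longleftrightarrow> T > 0 \<and> flow T p = p"
  unfolding is_period_def by (metis add.left_neutral flow_0 flow_add)

lemma min_period_flow: "periodic p \<Longrightarrow> min_period (\<lambda>t. flow t p) (minper p)"
  using minper[of p] is_period_flow[of p] unfolding min_period_def periodic_def by force

lemma emb_circle_flow:
  assumes "periodic p"
  shows "emb_circle A w H (range (\<lambda>t. flow t p))"
  unfolding emb_circle_def
proof (intro exI[of _ "\<lambda>t. flow t p"] conjI)
  have r: "reg p" using assms periodic_def by blast
  show "ham_curve A w H (\<lambda>t. flow t p)" unfolding ham_curve_iff using flow_ode[OF r] by blast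
  show "\<exists>T. is_period (\<lambda>t. flow t p) T" using min_period_flow[OF assms] unfolding min_period_def by blast
  obtain a S where "a > 0" "open S" "p \<in> S" "\<forall>q\<in>S. \<forall>t. 0 < t \<and> t < a \<longrightarrow> flow t q \<noteq> q"
    by (rule no_early_return[OF r])
  then have "flow (a / 2) p \<noteq> flow 0 p" using r by simp
  then show "\<exists>s t. flow s p \<noteq> flow t p" by blast
qed simp

text \<open>The curve is parametrised by its own energy, which forces it to cross the levels; its
  differentiability is again tested on real functions.\<close>

definition transversal :: "(real \<Rightarrow> 'a) \<Rightarrow> real set \<Rightarrow> bool" where
  "transversal P J \<longleftrightarrow> open J \<and> (\<forall>e\<in>J. reg (P e) \<and> H (P e) = e \<and> isCont P e \<and>
      (\<forall>f. mdiff f (P e) \<longrightarrow> (f \<circ> P) differentiable (at e)))"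

lemma transversalD:
  assumes "transversal P J" "e \<in> J"
  shows "reg (P e)" "H (P e) = e" "isCont P e" "mdiff f (P e) \<Longrightarrow> (f \<circ> P) differentiable (at e)"
  using assms unfolding transversal_def by blast+

lemma transversal_flow_isCont:
  assumes "transversal P J" "e \<in> J"
  shows "isCont (\<lambda>z. flow (snd z) (P (fst z))) (e, t)"
proof -
  note T = transversalD[OF assms]
  have "isCont (\<lambda>z. P (fst z)) (e, t)"
    using T(3) by (intro isCont_o2[of _ fst P]) (auto intro: continuous_intros)
  then have "isCont (\<lambda>z. (snd z, P (fst z))) (e, t)" by (intro continuous_intros)
  from isCont_o2[OF this, of "\<lambda>z. flow (fst z) (snd z)"] flow_joint_isCont[OF T(1)]
  show ?thesis by simp
qed

text \<open>After the fixed time \<open>T0\<close> the point \<open>P e\<close> comes back into a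
  box around \<open>P e0\<close>, on its own level but perhaps not to its starting point. The
  difference of the two time coordinates is the missing time, and it depends differentiably on
  \<open>e\<close>.\<close>

lemma nearby_period:
  assumes P: "transversal P J" and e0: "e0 \<in> J" and T0: "flow T0 (P e0) = P e0"
  obtains R where "R e0 = T0" "R differentiable (at e0)" "\<forall>\<^sub>F e in nhds e0. flow (R e) (P e) = P e"
proof -
  note T = transversalD[OF P e0]
  obtain a Q \<Psi> \<Theta> where B: "time_energy_box a (H (P e0)) Q \<Psi> \<Theta>" "\<Psi> (0, H (P e0)) = P e0" using time_energy_box_exists[OF T(1)] by blast
  note m = time_energy_boxD[OF B(1)]
  have Q: "P e0 \<in> Q" using m(6)[of "(0, H (P e0))"] B(2) m(1) by simp
  let ?t = "fst \<circ> \<Theta>"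
  define R where "R = (\<lambda>e. T0 + (?t (P e) - ?t (flow T0 (P e))))"
  have "R e0 = T0" by (simp add: R_def T0)
  moreover have "R differentiable (at e0)"
  proof -
    have "(?t \<circ> P) differentiable (at e0)" by (rule T(4)[OF m(9)[OF Q]])
    moreover have "(?t \<circ> flow T0 \<circ> P) differentiable (at e0)"
      using T(4)[OF flow_mdiff[OF T(1)]] m(9)[OF Q] T0 by metis
    ultimately show ?thesis unfolding R_def o_def by (intro derivative_intros)
  qed
  moreover have "\<forall>\<^sub>F e in nhds e0. flow (R e) (P e) = P e"
  proof -
    have c: "isCont (\<lambda>e. flow T0 (P e)) e0" using T(3) flow_isCont[OF T(1)] by (rule isCont_o2)
    have "\<forall>\<^sub>F e in nhds e0. e \<in> J" using P e0 unfolding transversal_def by (intro eventually_nhds_in_open) auto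
    moreover have "\<forall>\<^sub>F e in nhds e0. P e \<in> Q" by (rule isCont_eventually_open[OF T(3) m(2) Q])
    moreover have "\<forall>\<^sub>F e in nhds e0. flow T0 (P e) \<in> Q"
      by (rule isCont_eventually_open[OF c m(2)]) (simp add: T0 Q)
    ultimately show ?thesis
    proof eventually_elim
      fix e assume e: "e \<in> J" "P e \<in> Q" "flow T0 (P e) \<in> Q"
      note Te = transversalD[OF P e(1)]
      have "P e = flow (?t (P e) - ?t (flow T0 (P e))) (flow T0 (P e))"
        using time_energy_box_same_level[OF B(1) e(3,2)] flow_H[OF Te(1)] by simp
      then show "flow (R e) (P e) = P e"
        using flow_add[OF Te(1), of "?t (P e) - ?t (flow T0 (P e))" T0] by (simp add: R_def add.commute)
    qed
  qed
  ultimately show ?thesis by (rule that)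
qed

text \<open>Times below \<open>a\<close> are excluded by the box around \<open>P e0\<close>; the
  remaining times form the compact interval \<open>{a..T}\<close>, where the tube lemma makes the
  exclusion uniform in \<open>e\<close>.\<close>

lemma no_short_period_nearby:
  assumes P: "transversal P J" and e0: "e0 \<in> J" and T: "\<And>t. 0 < t \<Longrightarrow> t \<le> T \<Longrightarrow> flow t (P e0) \<noteq> P e0"
  shows "\<forall>\<^sub>F e in nhds e0. \<forall>t. 0 < t \<and> t \<le> T \<longrightarrow> flow t (P e) \<noteq> P e"
proof -
  note D = transversalD[OF P e0]
  obtain a S where a: "a > 0" "open S" "P e0 \<in> S" "\<forall>q\<in>S. \<forall>t. 0 < t \<and> t < a \<longrightarrow> flow t q \<noteq> q"
    by (rule no_early_return[OF D(1)])
  define W where "W = interior {z. flow (snd z) (P (fst z)) \<noteq> P (fst z)}"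
  have sub: "{e0} \<times> {a..T} \<subseteq> W"
  proof clarify
    fix t assume t: "t \<in> {a..T}"
    have "isCont (\<lambda>z. P (fst z)) (e0, t)"
      using D(3) by (intro isCont_o2[of _ fst P]) (auto intro: continuous_intros)
    from isCont_eventually_neq[OF transversal_flow_isCont[OF P e0, of t] this] T[of t] t a(1)
    show "(e0, t) \<in> W" unfolding W_def interior_def eventually_nhds by fastforce
  qed
  then obtain X where X: "e0 \<in> X" "open X" "X \<times> {a..T} \<subseteq> W"
    using Elementary_Topology.tube_lemma[OF compact_Icc _ sub] unfolding W_def by blast
  have "\<forall>\<^sub>F e in nhds e0. e \<in> X" using X by (intro eventually_nhds_in_open)
  moreover have "\<forall>\<^sub>F e in nhds e0. P e \<in> S" by (rule isCont_eventually_open[OF D(3) a(2,3)])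
  ultimately show ?thesis
  proof eventually_elim
    fix e assume e: "e \<in> X" "P e \<in> S"
    show "\<forall>t. 0 < t \<and> t \<le> T \<longrightarrow> flow t (P e) \<noteq> P e"
    proof (intro allI impI)
      fix t assume t: "0 < t \<and> t \<le> T"
      show "flow t (P e) \<noteq> P e"
      proof (cases "t < a")
        case True then show ?thesis using bspec[OF a(4) e(2)] t by blast
      next
        case False
        then have "(e, t) \<in> W" using X(3) e(1) t by auto
        then have "(e, t) \<in> {z. flow (snd z) (P (fst z)) \<noteq> P (fst z)}"
          unfolding W_def using interior_subset by blast
        then show ?thesis by simp
      qed
    qed
  qed
qed

text \<open>The corrected return time \<open>R\<close> is differentiable, but a priori only some
  period. It remains to see that it is the minimal one near \<open>e0\<close>, so that the minimal
  period does not drop there.\<close>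

lemma minper_differentiable:
  assumes P: "transversal P J" and e0: "e0 \<in> J" and per: "periodic (P e0)"
  shows "\<forall>\<^sub>F e in nhds e0. e \<in> J \<and> periodic (P e)" "\<exists>D. ((\<lambda>e. minper (P e)) has_real_derivative D) (at e0)"
proof -
  note D = transversalD[OF P e0]
  note m = minper[OF per]
  define T0 where "T0 = minper (P e0)"
  obtain R where R: "R e0 = T0" "R differentiable (at e0)" "\<forall>\<^sub>F e in nhds e0. flow (R e) (P e) = P e"
    using nearby_period[OF P e0 m(2)] unfolding T0_def by blast
  have "isCont R e0" using R(2) by (simp add: differentiable_imp_continuous_within)
  \<comment> \<open>Minimal periods nearby exceed \<open>3/4 * T0\<close> and \<open>R\<close> stays
    below \<open>5/4 * T0\<close>. So the excess of \<open>R\<close> over the minimal period is a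
    return time below \<open>T0 / 2\<close>, which must be 0.\<close>
  from isCont_eventually_open[OF this, of "{3/4 * T0<..<5/4 * T0}"]
  have 1: "\<forall>\<^sub>F e in nhds e0. R e \<in> {3/4 * T0<..<5/4 * T0}" using R(1) m(1) T0_def by simp
  have 2: "\<forall>\<^sub>F e in nhds e0. e \<in> J" using P e0 unfolding transversal_def by (intro eventually_nhds_in_open) auto
  have 3: "\<forall>\<^sub>F e in nhds e0. \<forall>t. 0 < t \<and> t \<le> 3/4 * T0 \<longrightarrow> flow t (P e) \<noteq> P e"
    by (rule no_short_period_nearby[OF P e0]) (use m T0_def in force)
  have ev: "\<forall>\<^sub>F e in nhds e0. e \<in> J \<and> periodic (P e) \<and> R e = minper (P e)"
    using 1 2 3 R(3)
  proof eventually_elim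
    fix e assume e: "R e \<in> {3/4 * T0<..<5/4 * T0}" "e \<in> J"
      "\<forall>t. 0 < t \<and> t \<le> 3/4 * T0 \<longrightarrow> flow t (P e) \<noteq> P e" "flow (R e) (P e) = P e"
    have r: "reg (P e)" using transversalD(1)[OF P e(2)] .
    have R0: "R e > 0" using e(1) m(1) T0_def by auto
    then have per: "periodic (P e)" unfolding periodic_def using r e(4) by blast
    note m' = minper[OF per]
    have "minper (P e) > 3/4 * T0" using e(3) m'(1,2) by force
    moreover have le: "minper (P e) \<le> R e" using m'(3)[OF R0 e(4)] .
    moreover have "flow (R e - minper (P e)) (P e) = P e"
      using flow_add[OF r, of "R e - minper (P e)" "minper (P e)"] e(4) m'(2) by simp
    ultimately have "R e - minper (P e) = 0"
      using e(3)[rule_format, of "R e - minper (P e)"] e(1) m(1) T0_def by force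
    with per e(2) show "e \<in> J \<and> periodic (P e) \<and> R e = minper (P e)" by simp
  qed
  then show "\<forall>\<^sub>F e in nhds e0. e \<in> J \<and> periodic (P e)" by eventually_elim blast
  obtain D where "(R has_real_derivative D) (at e0)"
    using R(2) real_differentiable_def by blast
  moreover have "\<forall>\<^sub>F e in nhds e0. R e = minper (P e)" using ev by eventually_elim blast
  ultimately have "((\<lambda>e. minper (P e)) has_real_derivative D) (at e0)"
    unfolding has_field_derivative_def by (rule has_derivative_cong_eventually)
  then show "\<exists>D. ((\<lambda>e. minper (P e)) has_real_derivative D) (at e0)" by blast
qed

lemma nonresonant_flow:
  assumes P: "transversal P J" and e0: "e0 \<in> J" and per: "periodic (P e0)"
    and D: "((\<lambda>e. minper (P e)) has_real_derivative D) (at e0)" "D \<noteq> 0"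
  shows "nonresonant A w H (range (\<lambda>t. flow t (P e0)))"
proof -
  obtain d where d: "d > 0" "\<And>e. dist e e0 < d \<Longrightarrow> e \<in> J \<and> periodic (P e)"
    using minper_differentiable(1)[OF P e0 per] unfolding eventually_nhds_metric by blast
  have d': "e \<in> J" "periodic (P e)" "reg (P e)" "H (P e) = e" if "e \<in> {e0 - d<..<e0 + d}" for e
    using d(2)[of e] that transversalD[OF P, of e] by (auto simp: dist_real_def abs_less_iff)
  show ?thesis
    unfolding nonresonant_def
  proof (rule exI[of _ e0], rule exI[of _ d], rule exI[of _ "\<lambda>e t. flow t (P e)"],
      rule exI[of _ "\<lambda>e. minper (P e)"], intro conjI ballI allI)
    show "ham_curve A w H (\<lambda>t. flow t (P e))" if "e \<in> {e0 - d<..<e0 + d}" for e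
      unfolding ham_curve_iff using flow_ode[OF d'(3)[OF that]] by blast
    show "min_period (\<lambda>t. flow t (P e)) (minper (P e))" if "e \<in> {e0 - d<..<e0 + d}" for e
      by (rule min_period_flow[OF d'(2)[OF that]])
    show "H (flow t (P e)) = e" if "e \<in> {e0 - d<..<e0 + d}" for e t
      using flow_H[OF d'(3)[OF that]] d'(4)[OF that] by simp
    show "continuous_on ({e0 - d<..<e0 + d} \<times> UNIV) (\<lambda>(e, t). flow t (P e))"
      using transversal_flow_isCont[OF P d'(1)]
      by (auto intro!: continuous_at_imp_continuous_on simp: case_prod_beta)
  qed (use d(1) D in auto)
qed

text \<open>If the period is stationary on all periodic orbits through an interval of the
transversal, it is locally constant there, so the condition \<open>flow T (P e) = P e\<close> is both open
and closed in \<open>e\<close>.\<close>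

lemma stationary_period_propagates:
  assumes P: "transversal P J" and I: "is_interval I" "I \<subseteq> J" "open I"
    and st: "\<And>e D. e \<in> I \<Longrightarrow> periodic (P e) \<Longrightarrow> ((\<lambda>e. minper (P e)) has_real_derivative D) (at e) \<Longrightarrow> D = 0"
    and e: "e0 \<in> I" "e \<in> I" and T: "T > 0" "flow T (P e0) = P e0"
  shows "flow T (P e) = P e"
proof (rule real_interval_induction[OF I(1) e, of "\<lambda>e. flow T (P e) = P e"])
  fix x assume x: "x \<in> I"
  then have xJ: "x \<in> J" using I by blast
  note D = transversalD[OF P xJ]
  show "(\<forall>\<^sub>F s in nhds x. s \<in> I \<longrightarrow> flow T (P s) = P s) \<or> (\<forall>\<^sub>F s in nhds x. s \<in> I \<longrightarrow> flow T (P s) \<noteq> P s)"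
  proof (cases "flow T (P x) = P x")
    case False
    have "isCont (\<lambda>e. flow T (P e)) x" using D(3) flow_isCont[OF D(1)] by (rule isCont_o2)
    from isCont_eventually_neq[OF this D(3) False] show ?thesis
      by (intro disjI2) (auto elim: eventually_mono)
  next
    case True
    then have per: "periodic (P x)" unfolding periodic_def using D(1) T(1) by blast
    \<comment> \<open>\<open>T\<close> may be a proper multiple of the minimal period at
      \<open>x\<close>. The factor \<open>n\<close> is kept while the minimal period, having zero
      derivative around \<open>x\<close>, stays the same.\<close>
    obtain n where n: "T = real n * minper (P x)" using period_multiple[OF per T(1) True] by blast
    have "\<forall>\<^sub>F e in nhds x. e \<in> I" using I(3) x by (intro eventually_nhds_in_open)
    with minper_differentiable(1)[OF P xJ per]
    have "\<forall>\<^sub>F e in nhds x. e \<in> I \<and> e \<in> J \<and> periodic (P e)" by eventually_elim blast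
    then obtain d where d: "d > 0" "\<And>e. dist e x < d \<Longrightarrow> e \<in> I \<and> e \<in> J \<and> periodic (P e)"
      unfolding eventually_nhds_metric by blast
    have "((\<lambda>e. minper (P e)) has_real_derivative 0) (at e)" if "e \<in> ball x d" for e
      using minper_differentiable(2)[OF P] st d(2)[of e] that by (metis dist_commute mem_ball)
    then have "((\<lambda>e. minper (P e)) has_field_derivative 0) (at e within ball x d)" if "e \<in> ball x d" for e
      using that has_field_derivative_at_within by blast
    from has_field_derivative_zero_constant[OF convex_ball this]
    obtain k where k: "\<And>e. e \<in> ball x d \<Longrightarrow> minper (P e) = k" by blast
    have "flow T (P s) = P s" if "dist s x < d" for s
    proof -
      have "minper (P s) = minper (P x)" using k[of s] k[of x] that d(1) by (simp add: dist_commute)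
      moreover have "periodic (P s)" using d(2)[OF that] by blast
      ultimately show ?thesis
        using flow_multiple[of "P s" "minper (P s)" n] minper(2)[of "P s"] n unfolding periodic_def by simp
    qed
    then show ?thesis using d(1) by (intro disjI1) (auto simp: eventually_nhds_metric)
  qed
qed (rule T(2))

end

section \<open>Recurrence by area preservation\<close>

text \<open>Identifies the plane of pairs with \<open>real ^ 2\<close>, where determinants and
  measures of differentiable images are stated.\<close>

definition vec2 :: "real \<times> real \<Rightarrow> real ^ 2" where
  "vec2 z = fst z *\<^sub>R axis 1 1 + snd z *\<^sub>R axis 2 1"

definition unvec2 :: "real ^ 2 \<Rightarrow> real \<times> real" where
  "unvec2 v = (v $ 1, v $ 2)"

lemma vec2_nth [simp]: "vec2 z $ 1 = fst z" "vec2 z $ 2 = snd z"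
  by (simp_all add: vec2_def axis_def)

lemma unvec2_vec2 [simp]: "unvec2 (vec2 z) = z"
  by (simp add: unvec2_def)

lemma vec2_unvec2 [simp]: "vec2 (unvec2 v) = v"
  by (simp add: vec_eq_iff forall_2 unvec2_def)

lemma bounded_linear_vec2: "bounded_linear vec2"
  unfolding vec2_def[abs_def]
  by (intro bounded_linear_add bounded_linear_scaleR_left[THEN bounded_linear_compose]
      bounded_linear_fst bounded_linear_snd)

lemma bounded_linear_unvec2: "bounded_linear unvec2"
  unfolding unvec2_def[abs_def] by (intro bounded_linear_Pair bounded_linear_vec_nth)

lemma vec2_image_eq_vimage: "vec2 ` S = unvec2 -` S"
proof (intro set_eqI iffI)
  fix v assume "v \<in> unvec2 -` S"
  then have "v = vec2 (unvec2 v)" "unvec2 v \<in> S" by simp_all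
  then show "v \<in> vec2 ` S" by blast
qed auto

lemma lmeasurable_vec2_open: "open S \<Longrightarrow> bounded S \<Longrightarrow> vec2 ` S \<in> lmeasurable"
  unfolding vec2_image_eq_vimage
  by (intro lmeasurable_open open_vimage)
    (simp_all add: vec2_image_eq_vimage[symmetric] bounded_linear_image bounded_linear_vec2
      linear_continuous_on bounded_linear_unvec2)

text \<open>A bounded Jacobian on a bounded open set gives an image of finite area; the finiteness
  in \<open>lmeasurable\<close> is what the recurrence argument uses.\<close>

lemma lmeasurable_planar_image:
  fixes g :: "real \<times> real \<Rightarrow> real \<times> real"
  assumes S: "open S" "bounded S"
    and g': "\<And>z. z \<in> S \<Longrightarrow> (g has_derivative g' z) (at z)"
    and det: "\<And>z. z \<in> S \<Longrightarrow> fst (g' z (1,0)) * snd (g' z (0,1)) - fst (g' z (0,1)) * snd (g' z (1,0)) = k z"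
    and k: "continuous_on S k" "\<And>z. z \<in> S \<Longrightarrow> \<bar>k z\<bar> \<le> B"
  shows "vec2 ` (g ` S) \<in> lmeasurable"
proof -
  let ?T = "vec2 ` S" and ?g = "vec2 \<circ> g \<circ> unvec2"
  let ?g' = "\<lambda>v. vec2 \<circ> g' (unvec2 v) \<circ> unvec2"
  have T: "?T \<in> lmeasurable" by (rule lmeasurable_vec2_open[OF S])
  have d: "(?g has_derivative ?g' v) (at v within ?T)" if "v \<in> ?T" for v
  proof -
    have "unvec2 v \<in> S" using that by auto
    from has_derivative_compose[OF bounded_linear_imp_has_derivative[OF bounded_linear_unvec2] g'[OF this]]
    have "((\<lambda>v. g (unvec2 v)) has_derivative (\<lambda>h. g' (unvec2 v) (unvec2 h))) (at v)" .
    from bounded_linear.has_derivative[OF bounded_linear_vec2 this]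
    show ?thesis unfolding o_def by (rule has_derivative_at_withinI)
  qed
  have D: "det (matrix (?g' v)) = k (unvec2 v)" if "v \<in> ?T" for v
  proof -
    have "unvec2 (axis 1 1) = (1, 0)" "unvec2 (axis 2 1) = (0, 1)"
      by (simp_all add: unvec2_def axis_def)
    then show ?thesis using det[of "unvec2 v"] that by (auto simp: det_2 matrix_def)
  qed
  have "(\<lambda>v. \<bar>det (matrix (?g' v))\<bar>) integrable_on ?T"
  proof (rule measurable_bounded_by_integrable_imp_integrable_real[OF _ integrable_on_const[OF T]])
    have "continuous_on ?T (\<lambda>v. \<bar>k (unvec2 v)\<bar>)"
      by (intro continuous_intros continuous_on_compose2[OF k(1)] linear_continuous_on bounded_linear_unvec2) auto
    then have "(\<lambda>v. \<bar>k (unvec2 v)\<bar>) \<in> borel_measurable (lebesgue_on ?T)"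
      using T by (intro continuous_imp_measurable_on_sets_lebesgue) auto
    then show "(\<lambda>v. \<bar>det (matrix (?g' v))\<bar>) \<in> borel_measurable (lebesgue_on ?T)"
      by (rule measurable_cong[THEN iffD1, rotated]) (simp add: D)
    show "\<bar>\<bar>det (matrix (?g' v))\<bar>\<bar> \<le> B" if "v \<in> ?T" for v
      unfolding D[OF that] using k(2)[of "unvec2 v"] that by auto
  qed (use T in auto)
  moreover have "\<bar>det (matrix (?g' v))\<bar> \<le> B" if "v \<in> ?T" for v
    unfolding D[OF that] using k(2)[of "unvec2 v"] that by auto
  ultimately have "?g ` ?T \<in> lmeasurable"
    by (intro measurable_bounded_differentiable_image[OF T d])
  also have "?g ` ?T = vec2 ` (g ` S)" by (auto simp: image_comp)
  finally show ?thesis .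
qed

lemma strip_not_in_lmeasurable:
  assumes M: "M \<in> lmeasurable" and ab: "a < b"
  shows "\<exists>t e. e \<in> {a<..<b} \<and> vec2 (t, e) \<notin> M"
proof (rule ccontr)
  assume "\<not> ?thesis"
  then have sub: "vec2 (t, e) \<in> M" if "e \<in> {a<..<b}" for t e using that by blast
  \<comment> \<open>The middle third of the height: closed rectangles of this height and arbitrary
    length \<open>n\<close> lie inside the open strip.\<close>
  define l where "l = (b - a) / 3"
  have l: "l > 0" using ab by (simp add: l_def)
  have "real n * l \<le> measure lebesgue M" for n :: nat
  proof -
    let ?C = "cbox (vec2 (0, a + l)) (vec2 (real n, a + 2 * l))"
    have "?C \<subseteq> M"
    proof
      fix v assume "v \<in> ?C"
      then have "v $ 2 \<in> {a<..<b}" using l by (auto simp: mem_box_cart forall_2 l_def field_simps)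
      then have "vec2 (v $ 1, v $ 2) \<in> M" by (rule sub)
      then show "v \<in> M" using vec2_unvec2[of v] unfolding unvec2_def by simp
    qed
    then have "measure lebesgue ?C \<le> measure lebesgue M"
      by (rule measure_mono_fmeasurable) (use M in auto)
    moreover have "vec2 (0, a + l) \<in> ?C" using l by (simp add: mem_box_cart forall_2)
    then have "measure lborel ?C = real n * l"
      by (subst content_cbox_cart) (auto simp: UNIV_2)
    ultimately show ?thesis by simp
  qed
  moreover obtain n :: nat where "measure lebesgue M / l < real n" using reals_Archimedean2 by blast
  ultimately show False using l by (simp add: field_simps) (metis not_le)
qed

context hamiltonian_surface
begin

text \<open>If no orbit closes up, the time since leaving the segment is a well-defined function
  \<open>\<tau>\<close> on the set \<open>W\<close> swept out, and \<open>(\<tau>, H)\<close> maps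
  \<open>W\<close> onto the whole strip over the interval. In charts this map has Jacobian
  \<open>- w\<close>, so finitely many chart pieces covering a compact energy band would give the
  strip finite area.\<close>

lemma recurrence:
  assumes P: "transversal P J" and J: "{e1<..<e2} \<subseteq> J" and e12: "e1 < e2"
  shows "\<exists>e\<in>{e1<..<e2}. periodic (P e)"
proof (rule ccontr)
  assume "\<not> ?thesis"
  then have np: "\<not> periodic (P e)" if "e \<in> {e1<..<e2}" for e using that by blast
  define I where "I = {e1<..<e2}"
  have D: "reg (P e)" "H (P e) = e" "isCont P e" if "e \<in> I" for e
    using transversalD[OF P] J that unfolding I_def by blast+
  have inj: "t = t'" if "e \<in> I" "flow t (P e) = flow t' (P e)" for e t t'
  proof -
    note r = D(1)[OF that(1)]
    have "flow s (P e) \<noteq> P e" if "s > 0" for s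
      using np \<open>e \<in> I\<close> r that unfolding I_def periodic_def by blast
    moreover have "flow (t - t') (P e) = P e"
      using flow_add[OF r, of "- t'" t] that(2) r by simp
    moreover have "flow (t' - t) (P e) = P e"
      using flow_add[OF r, of "- t" t'] that(2)[symmetric] r by simp
    ultimately show ?thesis by (metis diff_gt_0_iff_gt linorder_neqE_linordered_idom)
  qed
  define W where "W = {q. reg q \<and> H q \<in> I \<and> (\<exists>t. q = flow t (P (H q)))}"
  define \<tau> where "\<tau> q = (THE t. q = flow t (P (H q)))" for q
  have \<tau>I: "\<tau> q = t" if "q = flow t (P (H q))" "H q \<in> I" for q t
    unfolding \<tau>_def by (rule the_equality) (use that inj[OF that(2)] in metis)+
  have \<tau>: "q = flow (\<tau> q) (P (H q))" if "q \<in> W" for q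
    using that \<tau>I unfolding W_def by blast
  have loc: "\<exists>S. open S \<and> q \<in> S \<and> S \<subseteq> W \<and> mdiff \<tau> q" if qW: "q \<in> W" for q
  proof -
    define e where "e = H q"
    define t where "t = \<tau> q"
    have e: "e \<in> I" "reg q" using qW by (auto simp: W_def e_def)
    then have eJ: "e \<in> J" using J by (auto simp: I_def)
    have q: "q = flow t (P e)" unfolding t_def e_def by (rule \<tau>[OF qW])
    note r = D(1)[OF e(1)]
    have bq: "flow (- t) q = P e" unfolding q by (simp add: r)
    obtain a Q \<Psi> \<Theta> where B: "time_energy_box a (H (P e)) Q \<Psi> \<Theta>" "\<Psi> (0, H (P e)) = P e" using time_energy_box_exists[OF r] by blast
    note m = time_energy_boxD[OF B(1)]
    have Q: "P e \<in> Q" using m(6)[of "(0, H (P e))"] B(2) m(1) by simp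
    let ?t = "fst \<circ> \<Theta>"
    have "isCont H q" using continuous_H continuous_on_eq_continuous_at by blast
    then have PH: "isCont (\<lambda>q. P (H q)) q" using D(3)[OF e(1)] unfolding e_def by (rule isCont_o2)
    have "\<forall>\<^sub>F x in nhds q. H x \<in> I"
      by (rule isCont_eventually_open[OF \<open>isCont H q\<close>]) (use e in \<open>auto simp: I_def e_def\<close>)
    moreover have "\<forall>\<^sub>F x in nhds q. flow (- t) x \<in> Q"
      by (rule isCont_eventually_open[OF flow_isCont[OF e(2)] m(2)]) (simp add: bq Q)
    moreover have "\<forall>\<^sub>F x in nhds q. P (H x) \<in> Q"
      by (rule isCont_eventually_open[OF PH m(2)]) (use Q e_def in simp)
    \<comment> \<open>Flow points near \<open>q\<close> back by the fixed time \<open>t\<close> into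
      a box around \<open>P e\<close>; the time coordinates then measure the remaining distance to
      the segment. This shows that \<open>W\<close> is open and gives a differentiable formula for
      \<open>\<tau>\<close>.\<close>
    ultimately have "\<forall>\<^sub>F x in nhds q. x \<in> W \<and> \<tau> x = t + (?t (flow (- t) x) - ?t (P (H x)))"
      using eventually_reg[OF e(2)]
    proof eventually_elim
      fix x assume x: "H x \<in> I" "flow (- t) x \<in> Q" "P (H x) \<in> Q" "reg x"
      have "flow (- t) x = flow (?t (flow (- t) x) - ?t (P (H x))) (P (H x))"
        using time_energy_box_same_level[OF B(1) x(3,2)] flow_H[OF x(4)] D(2)[OF x(1)] by simp
      then have "x = flow (t + (?t (flow (- t) x) - ?t (P (H x)))) (P (H x))"
        using flow_add[OF D(1)[OF x(1)], of t] flow_minus(2)[OF x(4), of t] by metis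
      then show "x \<in> W \<and> \<tau> x = t + (?t (flow (- t) x) - ?t (P (H x)))"
        using \<tau>I[OF _ x(1)] x unfolding W_def by blast
    qed
    then obtain S where S: "open S" "q \<in> S"
      "\<And>x. x \<in> S \<Longrightarrow> x \<in> W \<and> \<tau> x = t + (?t (flow (- t) x) - ?t (P (H x)))"
      unfolding eventually_nhds by blast
    have d1: "mdiff (?t \<circ> flow (- t)) q"
      by (rule flow_mdiff[OF e(2)]) (use m(9)[OF Q] bq in simp)
    have "(?t \<circ> P) differentiable (at (H q))"
      using transversalD(4)[OF P eJ m(9)[OF Q]] unfolding e_def .
    then have "(\<lambda>z. (?t \<circ> P) (fst z)) differentiable (at (H q, H q))"
      using differentiable_chain_at[of fst "(H q, H q)" "?t \<circ> P"]
      by (simp add: o_def linear_imp_differentiable linear_fst)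
    from mdiff_compose2[OF mdiff_H mdiff_H this] have d2: "mdiff (\<lambda>q. (?t \<circ> P) (H q)) q" by simp
    have "(\<lambda>z. t + (fst z - snd z)) differentiable (at ((?t \<circ> flow (- t)) q, (?t \<circ> P) (H q)))"
      by (intro differentiable_add differentiable_diff differentiable_const linear_imp_differentiable linear_fst linear_snd)
    from mdiff_compose2[OF d1 d2 this]
    have "mdiff (\<lambda>x. t + (?t (flow (- t) x) - ?t (P (H x)))) q" by simp
    then have "mdiff \<tau> q" by (rule mdiff_cong[OF _ S(1,2)]) (use S(3) in simp)
    with S show ?thesis by blast
  qed
  have oW: "open W" by (subst open_subopen) (use loc in blast)
  have \<tau>flow: "\<tau> (flow s q) = \<tau> q + s" if "q \<in> W" for s q
  proof (rule \<tau>I)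
    have q: "reg q" "H q \<in> I" using that by (auto simp: W_def)
    show "H (flow s q) \<in> I" using q flow_H by simp
    show "flow s q = flow (\<tau> q + s) (P (H (flow s q)))"
      using flow_add[OF D(1)[OF q(2)], of s "\<tau> q"] \<tau>[OF that] flow_H[OF q(1)] by (simp add: add.commute)
  qed
  define G where "G q = (\<tau> q, H q)" for q
  \<comment> \<open>Required at every \<open>x\<close>, also at critical points and outside
    \<open>W\<close>: the compact band to be covered contains them, and \<open>W\<close> itself need
    not be compact.\<close>
  have chart: "\<exists>S. open S \<and> x \<in> S \<and> vec2 ` G ` (S \<inter> W) \<in> lmeasurable" for x
  proof -
    obtain V \<psi> where V: "(V, \<psi>) \<in> A" "x \<in> V" by (rule atlas_cover)
    note c = compat_atlas[OF V(1)]
    obtain r where r: "r > 0" "cball (\<psi> x) r \<subseteq> \<psi> ` V"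
      using chart_open(2)[OF c] V(2) open_contains_cball by blast
    have cw: "continuous_on (\<psi> ` V) (w (V, \<psi>))"
      using sympl V(1) smooth_on_continuous unfolding symplectic_form_def by blast
    have "bounded (w (V, \<psi>) ` cball (\<psi> x) r)"
      by (intro compact_imp_bounded compact_continuous_image continuous_on_subset[OF cw r(2)] compact_cball)
    then obtain K where K: "\<And>z. z \<in> cball (\<psi> x) r \<Longrightarrow> \<bar>w (V, \<psi>) z\<bar> \<le> K"
      unfolding bounded_iff real_norm_def by blast
    define S where "S = V \<inter> \<psi> -` ball (\<psi> x) r"
    have oS: "open S" "x \<in> S" unfolding S_def
      using continuous_open_preimage[OF homeomorphism_cont1[OF chart_homeo[OF c]] chart_open(1)[OF c] open_ball]
        V(2) r(1) by simp_all
    let ?T = "\<psi> ` (S \<inter> W)" and ?g = "G \<circ> inv_into V \<psi>"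
    have T: "open ?T" "?T \<subseteq> ball (\<psi> x) r"
      using chart_open_image[OF c, of "S \<inter> W"] oS oW by (auto simp: S_def)
    have "\<exists>g'. (?g has_derivative g') (at z) \<and>
        fst (g' (1,0)) * snd (g' (0,1)) - fst (g' (0,1)) * snd (g' (1,0)) = - w (V, \<psi>) z" if zT: "z \<in> ?T" for z
    proof -
      obtain q where q: "q \<in> S" "q \<in> W" "z = \<psi> q" using zT by blast
      have qV: "q \<in> V" "reg q" using q by (auto simp: S_def W_def)
      obtain t' where t': "(\<tau> \<circ> inv_into V \<psi> has_derivative t') (at z)"
        using loc[OF q(2)] mdiffD[OF _ c qV(1)] q(3) unfolding differentiable_def by blast
      define hx where "hx = pd (1,0) (loc (V, \<psi>) H) z"
      define hy where "hy = pd (0,1) (loc (V, \<psi>) H) z"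
      have h: "(H \<circ> inv_into V \<psi> has_derivative (\<lambda>v. hx * fst v + hy * snd v)) (at z)"
        using frechet_H[OF c qV(1)] by (simp add: hx_def hy_def q(3))
      have G': "(?g has_derivative (\<lambda>v. (t' v, hx * fst v + hy * snd v))) (at z)"
        using has_derivative_Pair[OF t' h] by (simp add: o_def G_def)
      have w0: "w (V, \<psi>) z \<noteq> 0" using w_nonzero[OF V(1) qV(1)] q(3) by simp
      have "(\<tau> \<circ> (\<lambda>s. flow s q) has_vector_derivative t' (XH (V, \<psi>) z)) (at 0)"
        using derivative_along_curve[OF flow_isCont_time[OF qV(2)] c, of 0 "XH (V, \<psi>) z" \<tau> t']
          odeD(2)[OF flow_ode[OF qV(2), of 0] V(1)] qV t' by (simp add: q(3))
      moreover have "\<tau> \<circ> (\<lambda>s. flow s q) = (\<lambda>s. \<tau> q + s)" using \<tau>flow[OF q(2)] by (simp add: fun_eq_iff)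
      moreover have "((\<lambda>s. \<tau> q + s) has_vector_derivative 1) (at 0)"
        by (auto intro!: derivative_eq_intros)
      ultimately have "t' (XH (V, \<psi>) z) = 1" using vector_derivative_unique_at by fastforce
      moreover have "t' v = fst v * t' (1,0) + snd v * t' (0,1)" for v
        by (subst linear_real_pair[OF has_derivative_linear[OF t']]) simp
      note this[of "XH (V, \<psi>) z"]
      ultimately have "- hy / w (V, \<psi>) z * t' (1,0) + hx / w (V, \<psi>) z * t' (0,1) = 1"
        by (simp add: ham_vec_def hx_def hy_def)
      \<comment> \<open>\<open>\<tau>\<close> has derivative 1 along the field
        \<open>(- hy / w, hx / w)\<close>; cleared of denominators, this is the Jacobian determinant
        of \<open>(\<tau>, H)\<close>.\<close>
      then have "t' (1,0) * hy - t' (0,1) * hx = - w (V, \<psi>) z" using w0 by (simp add: field_simps)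
      then show ?thesis using G' by (intro exI[of _ "\<lambda>v. (t' v, hx * fst v + hy * snd v)"]) simp
    qed
    then obtain g' where g': "\<And>z. z \<in> ?T \<Longrightarrow> (?g has_derivative g' z) (at z)"
      "\<And>z. z \<in> ?T \<Longrightarrow> fst (g' z (1,0)) * snd (g' z (0,1)) - fst (g' z (0,1)) * snd (g' z (1,0)) = - w (V, \<psi>) z"
      by metis
    have "vec2 ` ?g ` ?T \<in> lmeasurable"
    proof (rule lmeasurable_planar_image[OF T(1) _ g'])
      show "bounded ?T" using T(2) bounded_ball bounded_subset by blast
      show "continuous_on ?T (\<lambda>z. - w (V, \<psi>) z)"
        by (intro continuous_on_minus continuous_on_subset[OF cw]) (use T(2) r in force)
      show "\<bar>- w (V, \<psi>) z\<bar> \<le> K" if "z \<in> ?T" for z using K[of z] T(2) that by force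
    qed
    moreover have "?g ` ?T = G ` (S \<inter> W)"
      by (auto simp: image_image S_def chart_inv[OF c] intro!: image_cong)
    ultimately show ?thesis using oS by metis
  qed
  then obtain N where N: "\<And>x. open (N x)" "\<And>x. x \<in> N x" "\<And>x. vec2 ` G ` (N x \<inter> W) \<in> lmeasurable" by metis
  have "compact (H -` {e1..e2})" using proper_H unfolding proper_fun_def by simp
  moreover have "H -` {e1..e2} \<subseteq> \<Union> (range N)" using N(2) by blast
  ultimately obtain F where F: "finite F" "H -` {e1..e2} \<subseteq> (\<Union>x\<in>F. N x)"
    using N(1) by (metis (no_types, lifting) compactE_image UNIV_I)
  define M where "M = (\<Union>x\<in>F. vec2 ` G ` (N x \<inter> W))"
  have "M \<in> lmeasurable" unfolding M_def using F(1) N(3) by (intro fmeasurable.finite_UN)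
  from strip_not_in_lmeasurable[OF this e12] obtain t e where te: "e \<in> I" "vec2 (t, e) \<notin> M"
    unfolding I_def by blast
  \<comment> \<open>The point of \<open>W\<close> with coordinates \<open>(t, e)\<close>; its energy
    puts it in the band, hence in one of the finitely many pieces.\<close>
  define q where "q = flow t (P e)"
  have Hq: "H q = e" "reg q" using flow_H flow_reg D te(1) by (simp_all add: q_def)
  have qW: "q \<in> W" using Hq te(1) by (auto simp: W_def q_def)
  have Gq: "G q = (t, e)" using \<tau>I[of q t] Hq te(1) by (simp add: G_def q_def)
  obtain x where "x \<in> F" "q \<in> N x" using F(2) Hq te(1) by (force simp: I_def)
  then have "vec2 (G q) \<in> M" unfolding M_def using qW by blast
  with te Gq show False by simp
qed

section \<open>Circles near a saddle\<close>

text \<open>Regularity in terms of the differential of \<open>H\<close> alone, so that it can be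
  read off in the saddle chart without an area coefficient there.\<close>

lemma reg_iff_derivative:
  assumes U: "compat U \<phi>" "p \<in> U"
  shows "reg p \<longleftrightarrow> \<not> (H \<circ> inv_into U \<phi> has_derivative (\<lambda>v. 0)) (at (\<phi> p))"
proof -
  obtain V \<psi> where V: "(V, \<psi>) \<in> A" "p \<in> V" by (rule atlas_cover)
  note c = compat_atlas[OF V(1)]
  let ?x = "pd (1,0) (loc (V, \<psi>) H) (\<psi> p)" and ?y = "pd (0,1) (loc (V, \<psi>) H) (\<psi> p)"
  have "\<not> reg p \<longleftrightarrow> ?x = 0 \<and> ?y = 0"
    using reg_iff[OF V] w_nonzero[OF V] by (auto simp: ham_vec_def zero_prod_def)
  also have "\<dots> \<longleftrightarrow> (H \<circ> inv_into V \<psi> has_derivative (\<lambda>v. 0)) (at (\<psi> p))"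
  proof
    assume "?x = 0 \<and> ?y = 0"
    then show "(H \<circ> inv_into V \<psi> has_derivative (\<lambda>v. 0)) (at (\<psi> p))" using frechet_H[OF c V(2)] by simp
  next
    assume "(H \<circ> inv_into V \<psi> has_derivative (\<lambda>v. 0)) (at (\<psi> p))"
    from has_derivative_unique[OF this frechet_H[OF c V(2)]]
    have "0 = ?x * fst v + ?y * snd v" for v :: "real \<times> real" by metis
    from this[of "(1,0)"] this[of "(0,1)"] show "?x = 0 \<and> ?y = 0" by simp
  qed
  also have "\<dots> \<longleftrightarrow> (H \<circ> inv_into U \<phi> has_derivative (\<lambda>v. 0)) (at (\<phi> p))"
    using chart_change_derivative[OF c U(1) disjI1[OF V(1)] U(2) V(2), of H "\<lambda>v. 0"]
      chart_change_derivative[OF U(1) c disjI2[OF V(1)] V(2) U(2), of H "\<lambda>v. 0"] by blast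
  finally show ?thesis by blast
qed

lemma orbit_compact:
  assumes "periodic p"
  shows "compact (range (\<lambda>t. flow t p))"
proof -
  have r: "reg p" using assms periodic_def by blast
  define T where "T = minper p"
  have T: "T > 0" "flow T p = p" using minper[OF assms] by (auto simp: T_def)
  have k: "flow (of_int k * T) p = p" for k :: int
  proof (cases "k \<ge> 0")
    case True
    then show ?thesis using flow_multiple[OF r T(2), of "nat k"] by simp
  next
    case False
    then have "flow (- (of_int k * T)) p = p" using flow_multiple[OF r T(2), of "nat (- k)"] by simp
    then show ?thesis using flow_minus(2)[OF r, of "of_int k * T"] by simp
  qed
  have "range (\<lambda>t. flow t p) = (\<lambda>t. flow t p) ` {0..T}"
  proof (intro equalityI subsetI)
    fix q assume "q \<in> range (\<lambda>t. flow t p)"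
    then obtain t where q: "q = flow t p" by blast
    define k where "k = \<lfloor>t / T\<rfloor>"
    have "of_int k \<le> t / T" "t / T < of_int k + 1" unfolding k_def by linarith+
    then have "t - of_int k * T \<in> {0..T}" using T(1) by (simp add: field_simps)
    moreover have "q = flow (t - of_int k * T) p"
      using flow_add[OF r, of "t - of_int k * T" "of_int k * T"] k q by simp
    ultimately show "q \<in> (\<lambda>t. flow t p) ` {0..T}" by blast
  qed auto
  moreover have "continuous_on {0..T} (\<lambda>t. flow t p)"
    using flow_isCont_time[OF r] by (intro continuous_at_imp_continuous_on) blast
  ultimately show ?thesis by (metis compact_Icc compact_continuous_image)
qed

section \<open>The normal form chart at the saddle\<close>

context
  fixes U :: "'a set" and \<phi> :: "'a \<Rightarrow> real \<times> real" and c \<delta>0 :: real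
  assumes U: "compat U \<phi>" and im: "\<phi> ` U = {-\<delta>0<..<\<delta>0} \<times> {-\<delta>0<..<\<delta>0}"
    and saddle: "\<And>p. p \<in> U \<Longrightarrow> H p = c + fst (\<phi> p) * snd (\<phi> p)"
begin

definition pt :: "real \<Rightarrow> real \<Rightarrow> 'a" where
  "pt x y = inv_into U \<phi> (x, y)"

lemma pt:
  assumes "\<bar>x\<bar> < \<delta>0" "\<bar>y\<bar> < \<delta>0"
  shows "pt x y \<in> U" "\<phi> (pt x y) = (x, y)" "H (pt x y) = c + x * y"
proof -
  have "(x, y) \<in> \<phi> ` U" using assms unfolding im by (auto simp: abs_less_iff)
  then show 1: "pt x y \<in> U" "\<phi> (pt x y) = (x, y)"
    by (simp_all only: pt_def inv_into_into f_inv_into_f)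
  show "H (pt x y) = c + x * y" using saddle[OF 1(1)] 1(2) by simp
qed

lemma pt_eq: "p \<in> U \<Longrightarrow> p = pt (fst (\<phi> p)) (snd (\<phi> p))"
  by (simp add: pt_def chart_inv[OF U])

lemma chart_bounds: "p \<in> U \<Longrightarrow> \<bar>fst (\<phi> p)\<bar> < \<delta>0 \<and> \<bar>snd (\<phi> p)\<bar> < \<delta>0"
  using imageI[of p U \<phi>] unfolding im by (auto simp: mem_Times_iff abs_less_iff)

lemma pt_isCont:
  assumes "\<bar>x\<bar> < \<delta>0" "\<bar>y\<bar> < \<delta>0"
  shows "isCont (\<lambda>z. pt (fst z) (snd z)) (x, y)"
  using chart_inv_isCont[OF U pt(1)[OF assms]] pt(2)[OF assms] by (simp add: pt_def)

lemma reg_pt: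
  assumes "\<bar>x\<bar> < \<delta>0" "\<bar>y\<bar> < \<delta>0"
  shows "reg (pt x y) \<longleftrightarrow> (x, y) \<noteq> (0, 0)"
proof -
  have 1: "((\<lambda>z. c + fst z * snd z) has_derivative (\<lambda>v. x * snd v + fst v * y)) (at (x, y))"
    by (auto intro!: derivative_eq_intros)
  have D: "(H \<circ> inv_into U \<phi> has_derivative (\<lambda>v. x * snd v + fst v * y)) (at (x, y))"
  proof (rule has_derivative_transform_within_open[OF 1 chart_open(2)[OF U]])
    show "(x, y) \<in> \<phi> ` U" using pt[OF assms] by (metis imageI)
    show "c + fst z * snd z = (H \<circ> inv_into U \<phi>) z" if "z \<in> \<phi> ` U" for z
      using saddle[OF inv_into_into[OF that]] f_inv_into_f[OF that] by simp
  qed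
  have "(H \<circ> inv_into U \<phi> has_derivative (\<lambda>v. 0)) (at (x, y)) \<longleftrightarrow> x = 0 \<and> y = 0"
  proof
    assume "(H \<circ> inv_into U \<phi> has_derivative (\<lambda>v. 0)) (at (x, y))"
    from has_derivative_unique[OF this D]
    have "0 = x * snd v + fst v * y" for v :: "real \<times> real" by metis
    from this[of "(1,0)"] this[of "(0,1)"] show "x = 0 \<and> y = 0" by simp
  qed (use D in simp)
  then show ?thesis using reg_iff_derivative[OF U pt(1)[OF assms]] pt(2)[OF assms] by simp
qed

text \<open>The half axis is connected and regular, so a periodic orbit meeting it would contain all
of it and, being compact, also the saddle.\<close>

lemma axis_not_periodic:
  assumes x: "x \<noteq> 0" "\<bar>x\<bar> < \<delta>0"
  shows "\<not> periodic (pt x 0)"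
proof
  assume per: "periodic (pt x 0)"
  define C where "C = range (\<lambda>t. flow t (pt x 0))"
  have bd: "\<bar>s * x\<bar> < \<delta>0" if "s \<in> {0..1}" for s
    using x that by (auto simp: abs_mult intro: le_less_trans[OF mult_left_le_one_le])
  have cont: "isCont (\<lambda>s. pt (s * x) 0) s" if "s \<in> {0..1}" for s
    using isCont_o2[of s "\<lambda>s. (s * x, 0)" "\<lambda>z. pt (fst z) (snd z)"] pt_isCont[OF bd[OF that], of 0] x
    by (auto intro!: continuous_intros)
  have inC: "pt (s * x) 0 \<in> C" if s: "s \<in> {0<..1}" for s
  proof -
    have "connected ((\<lambda>s. pt (s * x) 0) ` {0<..1})"
      using cont by (intro connected_continuous_image continuous_at_imp_continuous_on) auto
    moreover have "reg q \<and> H q = c" if "q \<in> (\<lambda>s. pt (s * x) 0) ` {0<..1}" for q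
      using that bd x reg_pt pt(3) by auto
    ultimately have "\<exists>t. pt (s * x) 0 = flow t (pt (1 * x) 0)"
    proof (rule connected_level_in_orbit)
      show "pt (1 * x) 0 \<in> (\<lambda>s. pt (s * x) 0) ` {0<..1}" by (rule imageI) simp
      show "pt (s * x) 0 \<in> (\<lambda>s. pt (s * x) 0) ` {0<..1}" by (rule imageI) (rule s)
    qed
    then show ?thesis by (auto simp: C_def)
  qed
  have "closed C" unfolding C_def by (intro compact_imp_closed orbit_compact per)
  have "pt (0 * x) 0 \<in> C"
  proof (rule ccontr)
    assume "pt (0 * x) 0 \<notin> C"
    then have "\<forall>\<^sub>F s in nhds 0. pt (s * x) 0 \<in> - C"
      by (intro isCont_eventually_open[OF cont]) (use \<open>closed C\<close> in auto)
    then obtain d where d: "d > 0" "\<And>s. dist s 0 < d \<Longrightarrow> pt (s * x) 0 \<in> - C"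
      unfolding eventually_nhds_metric by blast
    then show False using d(2)[of "min 1 (d / 2)"] inC[of "min 1 (d / 2)"] d(1) by auto
  qed
  then obtain t where t: "pt (0 * x) 0 = flow t (pt x 0)" unfolding C_def by (rule rangeE)
  have "reg (pt x 0)" using per periodic_def by blast
  then have "reg (pt (0 * x) 0)" unfolding t by (rule flow_reg)
  then show False using reg_pt[of 0 0] x by auto
qed

text \<open>The vertical segment over a fixed nonzero \<open>x\<close>, with y solved from
  \<open>e = c + x * y\<close>. At \<open>e = c\<close> it meets the half axis.\<close>

definition cross_section :: "real \<Rightarrow> real \<Rightarrow> 'a" where
  "cross_section x e = pt x ((e - c) / x)"

lemma cross_section_transversal:
  assumes x: "x \<noteq> 0" "\<bar>x\<bar> < \<delta>0"
  shows "transversal (cross_section x) {c - \<bar>x\<bar> * \<delta>0<..<c + \<bar>x\<bar> * \<delta>0}"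
  unfolding transversal_def
proof (intro conjI ballI allI impI)
  fix e assume "e \<in> {c - \<bar>x\<bar> * \<delta>0<..<c + \<bar>x\<bar> * \<delta>0}"
  then have "\<bar>e - c\<bar> < \<delta>0 * \<bar>x\<bar>" by (auto simp: abs_less_iff mult.commute)
  then have y: "\<bar>(e - c) / x\<bar> < \<delta>0" using x by (simp add: abs_divide pos_divide_less_eq)
  show "reg (cross_section x e)" using reg_pt[OF x(2) y] x by (simp add: cross_section_def)
  show "H (cross_section x e) = e" using pt(3)[OF x(2) y] x by (simp add: cross_section_def)
  have a: "((\<lambda>e. (x, (e - c) / x)) has_derivative (\<lambda>d. (0, d / x))) (at e)"
    using x(1) by (auto intro!: derivative_eq_intros)
  have "isCont (\<lambda>e. (x, (e - c) / x)) e" using has_derivative_continuous[OF a] .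
  from isCont_o2[OF this, of "\<lambda>z. pt (fst z) (snd z)"] pt_isCont[OF x(2) y]
  show "isCont (cross_section x) e" by (simp add: cross_section_def[abs_def])
  fix f assume "mdiff f (cross_section x e)"
  then have "(f \<circ> inv_into U \<phi>) differentiable (at (x, (e - c) / x))"
    using mdiffD[OF _ U pt(1)[OF x(2) y], of f] pt(2)[OF x(2) y] unfolding cross_section_def by simp
  moreover have "(\<lambda>e. (x, (e - c) / x)) differentiable (at e)" using a unfolding differentiable_def by blast
  ultimately have "((f \<circ> inv_into U \<phi>) \<circ> (\<lambda>e. (x, (e - c) / x))) differentiable (at e)"
    by (intro differentiable_chain_at)
  then show "(f \<circ> cross_section x) differentiable (at e)"
    by (simp add: cross_section_def[abs_def] pt_def o_def)
qed simp

text \<open>One branch of the hyperbola x y = s is a graph over an interval of the first axis, hence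
  connected; it avoids the saddle, so it lies in one orbit, namely that of its point over
  \<open>\<sigma> * \<delta>\<close>.\<close>

lemma hyperbola_in_orbit:
  assumes \<sigma>: "\<bar>\<sigma>\<bar> = 1" and \<delta>: "0 < \<delta>" "\<delta> < \<delta>0" and s: "s \<noteq> 0" "\<bar>s\<bar> < \<delta> * \<delta>0"
  shows "{p \<in> U. H p = c + s \<and> \<sigma> * fst (\<phi> p) > 0} \<subseteq> range (\<lambda>t. flow t (cross_section (\<sigma> * \<delta>) (c + s)))"
proof
  fix p assume p: "p \<in> {p \<in> U. H p = c + s \<and> \<sigma> * fst (\<phi> p) > 0}"
  then have pU: "p \<in> U" by blast
  have \<sigma>2: "\<sigma> * (\<sigma> * x) = x" for x
    using \<sigma> by (metis abs_mult_self_eq mult.assoc mult_1)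
  have d0: "\<delta>0 > 0" using \<delta> by simp
  \<comment> \<open>The values of |x| for which both |x| and |s / x| are below
    \<open>\<delta>0\<close>, that is, the branch within the square.\<close>
  define X where "X = {\<bar>s\<bar> / \<delta>0<..<\<delta>0}"
  define k where "k r = pt (\<sigma> * r) (s / (\<sigma> * r))" for r
  have X: "r > 0" "\<bar>\<sigma> * r\<bar> < \<delta>0" "\<bar>s / (\<sigma> * r)\<bar> < \<delta>0" if "r \<in> X" for r
  proof -
    have "\<bar>s\<bar> / \<delta>0 \<ge> 0" using d0 by simp
    then show r: "r > 0" using that unfolding X_def by simp
    show "\<bar>\<sigma> * r\<bar> < \<delta>0" using that r \<sigma> unfolding X_def by (simp add: abs_mult)
    show "\<bar>s / (\<sigma> * r)\<bar> < \<delta>0" using that r \<sigma> d0 unfolding X_def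
      by (simp add: abs_mult abs_divide field_simps)
  qed
  have "isCont k r" if "r \<in> X" for r
  proof -
    have "\<sigma> * r \<noteq> 0" using X(1)[OF that] \<sigma> by auto
    then have "isCont (\<lambda>r. (\<sigma> * r, s / (\<sigma> * r))) r" by (intro continuous_intros)
    from isCont_o2[OF this, of "\<lambda>z. pt (fst z) (snd z)"] pt_isCont X[OF that]
    show ?thesis by (simp add: k_def[abs_def])
  qed
  then have "connected (k ` X)"
    by (intro connected_continuous_image continuous_at_imp_continuous_on) (auto simp: X_def)
  moreover have "reg q \<and> H q = c + s" if q: "q \<in> k ` X" for q
  proof -
    obtain r where r: "r \<in> X" "q = k r" using q by blast
    have "\<sigma> * r \<noteq> 0" using X(1)[OF r(1)] \<sigma> by auto
    then show ?thesis using reg_pt[OF X(2,3)] pt(3)[OF X(2,3)] r by (simp add: k_def)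
  qed
  moreover have "k \<delta> \<in> k ` X" using \<delta> s d0 by (intro imageI) (simp add: X_def field_simps)
  moreover have "p \<in> k ` X"
  proof
    define r where "r = \<sigma> * fst (\<phi> p)"
    have x: "fst (\<phi> p) = \<sigma> * r" by (simp add: r_def \<sigma>2)
    have r0: "r > 0" using p by (simp add: r_def)
    have "s = \<sigma> * r * snd (\<phi> p)" using saddle[OF pU] p x by simp
    moreover have n0: "\<sigma> * r \<noteq> 0" using r0 \<sigma> by auto
    ultimately have y: "snd (\<phi> p) = s / (\<sigma> * r)" by simp
    show "p = k r" using pt_eq[OF pU] x y by (simp add: k_def)
    have b: "\<bar>\<sigma> * r\<bar> < \<delta>0" "\<bar>s / (\<sigma> * r)\<bar> < \<delta>0" using chart_bounds[OF pU] x y by simp_all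
    then show "r \<in> X" using r0 d0 \<sigma> by (simp add: X_def abs_mult abs_divide field_simps)
  qed
  ultimately have "\<exists>t. p = flow t (k \<delta>)" by (rule connected_level_in_orbit)
  moreover have "k \<delta> = cross_section (\<sigma> * \<delta>) (c + s)" by (simp add: k_def cross_section_def)
  ultimately show "p \<in> range (\<lambda>t. flow t (cross_section (\<sigma> * \<delta>) (c + s)))" by auto
qed

text \<open>\<open>\<sigma>\<close> selects the half axis that the segment crosses and
  \<open>\<rho>\<close> the side of \<open>c\<close> on which energies are taken; together they
  determine the quadrant.\<close>

lemma nonresonant_circle_in_quadrant:
  assumes \<sigma>: "\<bar>\<sigma>\<bar> = 1" and \<rho>: "\<bar>\<rho>\<bar> = 1" and \<epsilon>: "0 < \<epsilon>" "\<epsilon> < \<delta>" and \<delta>: "\<delta> < \<delta>0"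
  shows "\<exists>\<epsilon>1\<in>{0<..<\<epsilon>}. \<exists>L. emb_circle A w H L \<and> nonresonant A w H L \<and>
    {p \<in> U. H p = c + \<rho> * (\<delta> * \<epsilon>1) \<and> \<sigma> * fst (\<phi> p) > 0} \<subseteq> L"
proof -
  define P where "P = cross_section (\<sigma> * \<delta>)"
  have d: "\<delta> > 0" "\<delta>0 > 0" using \<epsilon> \<delta> by simp_all
  have x: "\<sigma> * \<delta> \<noteq> 0" "\<bar>\<sigma> * \<delta>\<bar> < \<delta>0" "\<bar>\<sigma> * \<delta>\<bar> = \<delta>" using \<sigma> d \<delta> by (auto simp: abs_mult)
  define J where "J = {c - \<delta> * \<delta>0<..<c + \<delta> * \<delta>0}"
  have T: "transversal P J"
    using cross_section_transversal[OF x(1,2)] unfolding x(3) P_def J_def .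
  define e1 where "e1 = min c (c + \<rho> * (\<delta> * \<epsilon>))"
  define e2 where "e2 = max c (c + \<rho> * (\<delta> * \<epsilon>))"
  have \<rho>': "\<rho> = 1 \<or> \<rho> = -1" using \<rho> by linarith
  have de: "\<delta> * \<epsilon> > 0" "\<delta> * \<epsilon> < \<delta> * \<delta>0" using d \<epsilon> \<delta> by auto
  have e12: "e1 < e2" "{e1<..<e2} \<subseteq> J"
    using \<rho>' de by (auto simp: e1_def e2_def J_def)
  have cJ: "c \<in> J" using d by (simp add: J_def)
  have "\<exists>e\<in>{e1<..<e2}. \<exists>D. periodic (P e) \<and> ((\<lambda>e. minper (P e)) has_real_derivative D) (at e) \<and> D \<noteq> 0"
  proof (rule ccontr)
    assume "\<not> ?thesis"
    then have st: "D = 0" if "e \<in> {e1<..<e2}" "periodic (P e)" "((\<lambda>e. minper (P e)) has_real_derivative D) (at e)" for e D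
      using that by blast
    obtain e0 where e0: "e0 \<in> {e1<..<e2}" "periodic (P e0)" using recurrence[OF T e12(2,1)] by blast
    define T0 where "T0 = minper (P e0)"
    have T0: "T0 > 0" "flow T0 (P e0) = P e0" using minper[OF e0(2)] by (auto simp: T0_def)
    have all: "flow T0 (P e) = P e" if "e \<in> {e1<..<e2}" for e
      by (rule stationary_period_propagates[OF T _ e12(2) _ st e0(1) that T0]) simp_all
    note D = transversalD[OF T cJ]
    \<comment> \<open>The interval has \<open>c\<close> as an end point only, so the return time
      \<open>T0\<close> is carried over by continuity: a failure at \<open>c\<close> would persist
      at the energies \<open>c + \<rho> * m\<close> for small \<open>m\<close>.\<close>
    have "flow T0 (P c) = P c"
    proof (rule ccontr)
      assume ne: "flow T0 (P c) \<noteq> P c"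
      have "isCont (\<lambda>e. flow T0 (P e)) c" using D(3) flow_isCont[OF D(1)] by (rule isCont_o2)
      from isCont_eventually_neq[OF this D(3) ne]
      obtain r where r: "r > 0" "\<And>e. dist e c < r \<Longrightarrow> flow T0 (P e) \<noteq> P e"
        unfolding eventually_nhds_metric by blast
      define m where "m = min (r / 2) (\<delta> * \<epsilon> / 2)"
      have m: "m > 0" "m < r" "m < \<delta> * \<epsilon>" using r(1) de by (auto simp: m_def)
      have "c + \<rho> * m \<in> {e1<..<e2}" using \<rho>' m by (auto simp: e1_def e2_def)
      moreover have "dist (c + \<rho> * m) c < r" using \<rho> m by (simp add: dist_real_def abs_mult)
      ultimately show False using all r(2) by blast
    qed
    then have "periodic (P c)" unfolding periodic_def using D(1) T0(1) by blast
    then show False using axis_not_periodic[OF x(1,2)] by (simp add: P_def cross_section_def)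
  qed
  then obtain e D where e: "e \<in> {e1<..<e2}" "periodic (P e)"
    "((\<lambda>e. minper (P e)) has_real_derivative D) (at e)" "D \<noteq> 0" by blast
  \<comment> \<open>Solves \<open>e = c + \<rho> * (\<delta> * \<epsilon>1)\<close>, since
    \<open>\<rho>\<close> is its own inverse.\<close>
  define \<epsilon>1 where "\<epsilon>1 = \<rho> * (e - c) / \<delta>"
  have e': "e = c + \<rho> * (\<delta> * \<epsilon>1)" using \<rho>' d by (auto simp: \<epsilon>1_def)
  have "0 < \<rho> * (e - c)" "\<rho> * (e - c) < \<delta> * \<epsilon>"
    using e(1) \<rho>' de by (auto simp: e1_def e2_def)
  then have \<epsilon>1: "\<epsilon>1 \<in> {0<..<\<epsilon>}" using d by (simp add: \<epsilon>1_def field_simps)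
  let ?s = "\<rho> * (\<delta> * \<epsilon>1)" and ?L = "range (\<lambda>t. flow t (P e))"
  have "?s \<noteq> 0" using \<rho> d \<epsilon>1 by auto
  moreover have "\<bar>?s\<bar> < \<delta> * \<delta>0" using \<rho> d \<epsilon>1 \<epsilon> \<delta> by (simp add: abs_mult)
  ultimately have "{p \<in> U. H p = c + ?s \<and> \<sigma> * fst (\<phi> p) > 0} \<subseteq> ?L"
    using hyperbola_in_orbit[OF \<sigma> d(1) \<delta>] unfolding P_def e' by blast
  moreover have "emb_circle A w H ?L" by (rule emb_circle_flow[OF e(2)])
  moreover have "nonresonant A w H ?L"
    using nonresonant_flow[OF T _ e(2,3,4)] e12(2) e(1) by blast
  ultimately show ?thesis using \<epsilon>1 by blast
qed

end

end

theorem theorem2p14: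
  fixes A :: "('a::{t2_space, second_countable_topology}) chart set"
    and w :: "'a chart \<Rightarrow> real \<times> real \<Rightarrow> real"
    and H :: "'a \<Rightarrow> real"
    and z1 :: 'a and c \<delta>0 :: real
    and U :: "'a set" and \<phi> :: "'a \<Rightarrow> real \<times> real"
  assumes "surface_atlas A"
    and "symplectic_form A w"
    and "smooth_fun A H"
    and "proper_fun H"
    and "nondeg_saddle A H z1"
    and "c = H z1"
    and "\<delta>0 > 0"
    and "compatible_chart A (U, \<phi>)"
    and "\<phi> ` U = {-\<delta>0<..<\<delta>0} \<times> {-\<delta>0<..<\<delta>0}"
    and "z1 \<in> U" and "\<phi> z1 = (0, 0)"
    and "positively_oriented A w (U, \<phi>)"
    and "\<forall>p\<in>U. H p = c + fst (\<phi> p) * snd (\<phi> p)"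
  shows "\<forall>\<epsilon> \<delta>. 0 < \<epsilon> \<and> \<epsilon> < \<delta> \<and> \<delta> < \<delta>0 \<longrightarrow>
     (\<exists>\<epsilon>1 \<epsilon>2 \<epsilon>3 \<epsilon>4. \<epsilon>1 \<in> {0<..<\<epsilon>} \<and> \<epsilon>2 \<in> {0<..<\<epsilon>} \<and> \<epsilon>3 \<in> {0<..<\<epsilon>} \<and> \<epsilon>4 \<in> {0<..<\<epsilon>} \<and>
       (\<exists>L. emb_circle A w H L \<and> nonresonant A w H L \<and>
          {p\<in>U. H p = c + \<delta> * \<epsilon>1 \<and> fst (\<phi> p) > 0 \<and> snd (\<phi> p) > 0} \<subseteq> L) \<and>
       (\<exists>L. emb_circle A w H L \<and> nonresonant A w H L \<and>
          {p\<in>U. H p = c - \<delta> * \<epsilon>2 \<and> fst (\<phi> p) < 0 \<and> snd (\<phi> p) > 0} \<subseteq> L) \<and>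
       (\<exists>L. emb_circle A w H L \<and> nonresonant A w H L \<and>
          {p\<in>U. H p = c + \<delta> * \<epsilon>3 \<and> fst (\<phi> p) < 0 \<and> snd (\<phi> p) < 0} \<subseteq> L) \<and>
       (\<exists>L. emb_circle A w H L \<and> nonresonant A w H L \<and>
          {p\<in>U. H p = c - \<delta> * \<epsilon>4 \<and> fst (\<phi> p) > 0 \<and> snd (\<phi> p) < 0} \<subseteq> L))"
proof (intro allI impI)
  fix \<epsilon> \<delta> :: real
  assume *: "0 < \<epsilon> \<and> \<epsilon> < \<delta> \<and> \<delta> < \<delta>0"
  interpret hamiltonian_surface A w H by standard (use assms in auto)
  have "compat U \<phi>" using assms(8) by (simp add: compat_def)
  \<comment> \<open>The sign of y is forced by that of x and of \<open>H p - c\<close>, so the four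
    arcs correspond to \<open>(\<sigma>, \<rho>)\<close> = (1, 1), (-1, -1), (-1, 1) and (1,
    -1).\<close>
  note quadrant = nonresonant_circle_in_quadrant[OF this assms(9) bspec[OF assms(13)], of _ _ \<epsilon> \<delta>]
  obtain \<epsilon>1 L1 where 1: "\<epsilon>1 \<in> {0<..<\<epsilon>}" "emb_circle A w H L1" "nonresonant A w H L1"
    "{p \<in> U. H p = c + 1 * (\<delta> * \<epsilon>1) \<and> 1 * fst (\<phi> p) > 0} \<subseteq> L1"
    using quadrant[of 1 1] * by auto
  obtain \<epsilon>2 L2 where 2: "\<epsilon>2 \<in> {0<..<\<epsilon>}" "emb_circle A w H L2" "nonresonant A w H L2"
    "{p \<in> U. H p = c + - 1 * (\<delta> * \<epsilon>2) \<and> - 1 * fst (\<phi> p) > 0} \<subseteq> L2"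
    using quadrant[of "- 1" "- 1"] * by auto
  obtain \<epsilon>3 L3 where 3: "\<epsilon>3 \<in> {0<..<\<epsilon>}" "emb_circle A w H L3" "nonresonant A w H L3"
    "{p \<in> U. H p = c + 1 * (\<delta> * \<epsilon>3) \<and> - 1 * fst (\<phi> p) > 0} \<subseteq> L3"
    using quadrant[of "- 1" 1] * by auto
  obtain \<epsilon>4 L4 where 4: "\<epsilon>4 \<in> {0<..<\<epsilon>}" "emb_circle A w H L4" "nonresonant A w H L4"
    "{p \<in> U. H p = c + - 1 * (\<delta> * \<epsilon>4) \<and> 1 * fst (\<phi> p) > 0} \<subseteq> L4"
    using quadrant[of 1 "- 1"] * by auto
  have "{p\<in>U. H p = c + \<delta> * \<epsilon>1 \<and> fst (\<phi> p) > 0 \<and> snd (\<phi> p) > 0} \<subseteq> L1"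
    "{p\<in>U. H p = c - \<delta> * \<epsilon>2 \<and> fst (\<phi> p) < 0 \<and> snd (\<phi> p) > 0} \<subseteq> L2"
    "{p\<in>U. H p = c + \<delta> * \<epsilon>3 \<and> fst (\<phi> p) < 0 \<and> snd (\<phi> p) < 0} \<subseteq> L3"
    "{p\<in>U. H p = c - \<delta> * \<epsilon>4 \<and> fst (\<phi> p) > 0 \<and> snd (\<phi> p) < 0} \<subseteq> L4"
    using 1(4) 2(4) 3(4) 4(4) by auto
  with 1(1-3) 2(1-3) 3(1-3) 4(1-3)
  show "\<exists>\<epsilon>1 \<epsilon>2 \<epsilon>3 \<epsilon>4. \<epsilon>1 \<in> {0<..<\<epsilon>} \<and> \<epsilon>2 \<in> {0<..<\<epsilon>} \<and> \<epsilon>3 \<in> {0<..<\<epsilon>} \<and> \<epsilon>4 \<in> {0<..<\<epsilon>} \<and>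
       (\<exists>L. emb_circle A w H L \<and> nonresonant A w H L \<and>
          {p\<in>U. H p = c + \<delta> * \<epsilon>1 \<and> fst (\<phi> p) > 0 \<and> snd (\<phi> p) > 0} \<subseteq> L) \<and>
       (\<exists>L. emb_circle A w H L \<and> nonresonant A w H L \<and>
          {p\<in>U. H p = c - \<delta> * \<epsilon>2 \<and> fst (\<phi> p) < 0 \<and> snd (\<phi> p) > 0} \<subseteq> L) \<and>
       (\<exists>L. emb_circle A w H L \<and> nonresonant A w H L \<and>
          {p\<in>U. H p = c + \<delta> * \<epsilon>3 \<and> fst (\<phi> p) < 0 \<and> snd (\<phi> p) < 0} \<subseteq> L) \<and>
       (\<exists>L. emb_circle A w H L \<and> nonresonant A w H L \<and>
          {p\<in>U. H p = c - \<delta> * \<epsilon>4 \<and> fst (\<phi> p) > 0 \<and> snd (\<phi> p) < 0} \<subseteq> L)"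
    by blast
qed

end
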